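(* Let $f\in\mathfrak L^0$, $f\neq\mathrm{id}$, and let $k\in\mathbb N$ be minimal such that $f\in\mathcal L_k^0$. Let $(\beta,\mathbf n):=\mathrm{ord}(f-\mathrm{id})>(1,\mathbf 0_k)$, $\mathbf n=(n_1,\dots,n_k)$, $a_{\mathbf m}:=[f]_{\beta,\mathbf m}$ for $\mathbf m\in\mathbb Z^k$, $\mathbf m\ge\mathbf n$. If $\beta>1$ put $L:=a_{\mathbf n}\boldsymbol\ell_1^{n_1}\cdots\boldsymbol\ell_k^{n_k}$; if $\beta=1$ put $L:=\sum_{\mathbf n\le\mathbf m\le\mathbf n'}a_{\mathbf m}\boldsymbol\ell_1^{m_1}\cdots\boldsymbol\ell_k^{m_k}$, where $\mathbf n':=\mathbf n+(\mathbf 1_v,\mathbf 0_{k-v})$ and $v$ is the index of the first nonzero (necessarily positive) entry of $\mathbf n$. Put $$f_0:=\mathrm{id}+z^\beta L.$$ Then there exists $\varphi\in\mathfrak L^0$ with $\varphi\circ f\circ\varphi^{-1}=f_0$. Moreover, every $\varphi\in\mathfrak L^0$ with $\varphi\circ f\circ\varphi^{-1}=f_0$ belongs to $\mathcal L_{k+1}^0$, and $f_0$ is minimal in $\mathfrak L^0$: it cannot be further reduced in $\mathfrak L^0$, nor can its coefficients be changed; that is, if $\varphi\in\mathfrak L^0$ and $h:=\varphi\circ f_0\circ\varphi^{-1}$ satisfies $\mathrm{Supp}(h)\subseteq\mathrm{Supp}(f_0)$, then $h=f_0$.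
   Context: $\mathbb N=\{0,1,2,\dots\}$. $z$ is a formal variable, $\boldsymbol\ell_1:=-\frac1{\log z}$ and $\boldsymbol\ell_{j+1}:=\boldsymbol\ell_j\circ\boldsymbol\ell_1=-\frac1{\log\boldsymbol\ell_j}$. $\mathcal L_k^\infty$ is the set of formal sums $f=\sum a_{\alpha,n_1,\dots,n_k}z^\alpha\boldsymbol\ell_1^{n_1}\cdots\boldsymbol\ell_k^{n_k}$, $(\alpha,n_1,\dots,n_k)\in\mathbb R\times\mathbb Z^k$, with real coefficients, whose support $\mathrm{Supp}(f)$ (set of exponent vectors with nonzero coefficient) is well-ordered for the lexicographic order (all comparisons of exponent vectors are lexicographic). With termwise operations it is a field, and a differential algebra for $\frac d{dz}$, where $\boldsymbol\ell_1'=z^{-1}\boldsymbol\ell_1^2$, $\boldsymbol\ell_{j+1}'=z^{-1}\boldsymbol\ell_1\cdots\boldsymbol\ell_j\boldsymbol\ell_{j+1}^2$. One regards $\mathcal L_k^\infty\subseteq\mathcal L_{k+1}^\infty$ (exponent vectors padded by zeros, also when comparing supports). $[f]_{\alpha,n_1,\dots,n_k}$ is the coefficient of $z^\alpha\boldsymbol\ell_1^{n_1}\cdots\boldsymbol\ell_k^{n_k}$. $\mathrm{ord}(f):=\min\mathrm{Supp}(f)$ for $f\ne0$. $\mathbf 0_j,\mathbf 1_j$ are the vectors of $j$ zeros, resp. ones. $\mathrm{id}=z$. $\mathcal L_k^0$ is the set of $z+g$ with $g\in\mathcal L_k^\infty$, $\mathrm{ord}(g)>(1,\mathbf 0_k)$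 (including $g=0$), and $\mathfrak L^0:=\bigcup_{k\in\mathbb N}\mathcal L_k^0$. For $f\in\mathcal L_k^\infty$ and $z+g\in\mathcal L_k^0$, $f\circ(z+g):=f+\sum_{i\ge1}\frac{f^{(i)}}{i!}g^i$ (coefficientwise convergent); $\mathcal L_k^0$ and $\mathfrak L^0$ are groups under composition. *)

theory Defs
  imports Complex_Main "HOL-Library.Poly_Mapping" "HOL-Library.Product_Lexorder"
    "HOL-Library.Product_Plus" "HOL-Algebra.Group"
begin

text \<open>
  An exponent \<open>(\<alpha>, n)\<close> stands for the monomial
  \<open>z^\<alpha> \<cdot> \<Prod>i. \<ell>(i+1)^(n i)\<close>: the entry of \<open>n\<close> at index \<open>i\<close> (counted from 0) is the
  exponent of \<open>\<ell>(i+1)\<close>.  Since \<open>n\<close> has finite support, padding by zeros is built in, and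
  vectors of length \<open>k\<close> are those with support in \<open>{..<k}\<close>.  The order on exponents is
  lexicographic: the first component first, then the first index at which the second components
  differ (instances of Product_Lexorder and Poly_Mapping).
\<close>

type_synonym expo = "real \<times> (nat \<Rightarrow>\<^sub>0 int)"

type_synonym series = "expo \<Rightarrow> real"

definition zvec :: "nat \<Rightarrow> (nat \<Rightarrow>\<^sub>0 int) set" where
  "zvec k = {n. Poly_Mapping.keys n \<subseteq> {..<k}}"

definition ones :: "nat \<Rightarrow> (nat \<Rightarrow>\<^sub>0 int)" where
  "ones j = (\<Sum>i<j. Poly_Mapping.single i 1)"

definition supp :: "series \<Rightarrow> expo set" where
  "supp f = {e. f e \<noteq> 0}"

definition Linf :: "nat \<Rightarrow> series set" where
  "Linf k = {f. supp f \<subseteq> UNIV \<times> zvec k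
              \<and> well_order_on (supp f) {(x, y) \<in> supp f \<times> supp f. x \<le> y}}"

text \<open>Only meaningful for a nonzero series with well-ordered support.\<close>

definition ts_ord :: "series \<Rightarrow> expo" where
  "ts_ord f = (LEAST e. e \<in> supp f)"

definition monom :: "expo \<Rightarrow> series" where
  "monom e = (\<lambda>x. if x = e then 1 else 0)"

definition ts_add :: "series \<Rightarrow> series \<Rightarrow> series" where
  "ts_add f g = (\<lambda>e. f e + g e)"

definition ts_diff :: "series \<Rightarrow> series \<Rightarrow> series" where
  "ts_diff f g = (\<lambda>e. f e - g e)"

definition ts_scale :: "real \<Rightarrow> series \<Rightarrow> series" where
  "ts_scale c f = (\<lambda>e. c * f e)"

text \<open>
  \<open>Sum_any\<close> sums a finitely supported family.  In \<open>ts_mult\<close> and \<open>ts_deriv\<close> the family is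
  finitely supported for each \<open>e\<close> whenever the series involved have well-ordered support.
\<close>

definition ts_mult :: "series \<Rightarrow> series \<Rightarrow> series" where
  "ts_mult f g = (\<lambda>e. Sum_any (\<lambda>x. f x * g (e - x)))"

definition ts_power :: "series \<Rightarrow> nat \<Rightarrow> series" where
  "ts_power f i = (ts_mult f ^^ i) (monom (0, 0))"

text \<open>
  Leibniz rule: with \<open>\<ell>(i+1)' = z^(-1) \<cdot> \<ell>(1) \<cdots> \<ell>(i) \<cdot> \<ell>(i+1)^2\<close>, differentiating the
  \<open>i\<close>-th factor \<open>\<ell>(i+1)^(n i)\<close> contributes \<open>n i\<close> times the monomial in which the exponent of
  \<open>z\<close> drops by 1 and those of \<open>\<ell>(1), \<dots>, \<ell>(i+1)\<close> all rise by 1.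
\<close>

definition monom_deriv :: "expo \<Rightarrow> series" where
  "monom_deriv = (\<lambda>(\<alpha>, n). ts_add
     (ts_scale \<alpha> (monom (\<alpha> - 1, n)))
     (\<lambda>e. \<Sum>i\<in>Poly_Mapping.keys n.
        of_int (Poly_Mapping.lookup n i) * monom (\<alpha> - 1, n + ones (Suc i)) e))"

definition ts_deriv :: "series \<Rightarrow> series" where
  "ts_deriv f = (\<lambda>e. Sum_any (\<lambda>x. f x * monom_deriv x e))"

definition ts_id :: series where
  "ts_id = monom (1, 0)"

definition L0 :: "nat \<Rightarrow> series set" where
  "L0 k = {ts_add ts_id g | g. g \<in> Linf k \<and> (supp g \<noteq> {} \<longrightarrow> ts_ord g > (1, 0))}"

definition frakL0 :: "series set" where
  "frakL0 = (\<Union>k. L0 k)"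

text \<open>\<open>ts_comp f h\<close> is \<open>f \<circ> h\<close>, where \<open>h = z + g\<close>.\<close>

definition ts_comp :: "series \<Rightarrow> series \<Rightarrow> series" where
  "ts_comp f h = (let g = ts_diff h ts_id in
     (\<lambda>e. f e + suminf (\<lambda>j. let i = Suc j in
            ts_mult ((ts_deriv ^^ i) f) (ts_power g i) e / fact i)))"

definition grpL0 :: "series monoid" where
  "grpL0 = \<lparr>carrier = frakL0, mult = ts_comp, one = ts_id\<rparr>"

definition ts_conj :: "series \<Rightarrow> series \<Rightarrow> series" where
  "ts_conj \<phi> f = \<phi> \<otimes>\<^bsub>grpL0\<^esub> f \<otimes>\<^bsub>grpL0\<^esub> inv\<^bsub>grpL0\<^esub> \<phi>"

end

theory Submission
  imports Defs "HOL-Library.Set_Algebras"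
begin

text \<open>
  Conjugating by \<open>z + \<psi>\<close> changes the error \<open>(z + \<psi>) \<circ> f - f0 \<circ> (z + \<psi>)\<close>, to leading order, by the
  Wronskian of \<open>\<psi>\<close> and \<open>f0 - z\<close>.  On exponents this is a strictly increasing map, because the
  exponents with the orders of logarithmic derivatives form an asymptotic couple, and its image is
  the set of all exponents beyond those of \<open>f0\<close>.  So the terms of \<open>\<psi>\<close> can be chosen one after the
  other, transfinitely, to cancel every error.  The powers of \<open>\<ell>(k+1)\<close> needed to solve the
  equation are all nonpositive, and such series are closed under all operations involved; since the
  leading term of the Wronskian with a series outside this class is again outside, every conjugation
  lies in it.  Finally, the Wronskian has order greater than all exponents of \<open>f0\<close>, which gives
  minimality.
\<close>

section \<open>Well-ordered subsets of an ordered abelian group\<close>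

text \<open>Write \<open>uu + B\<close> for the order of \<open>g0 = f0 - z\<close>. A term of
  \<open>\<psi>\<close> at \<open>uu + q\<close> acts on the error at
  \<open>uu + q + B + dl (ht (q - B))\<close>, where \<open>dl (ht e)\<close> is the order of the
  logarithmic derivative of a monomial with exponent \<open>e\<close>, up to a factor
  \<open>z\<close>. Setting \<open>q = 0\<close> gives \<open>uu + B + dl (ht B)\<close>, which is
  \<open>(\<beta>, n)\<close> if \<open>\<beta> > 1\<close> and \<open>(1, n')\<close> if
  \<open>\<beta> = 1\<close>; this is why \<open>f0\<close> is cut there. At \<open>q = B\<close>
  the Wronskian of the leading monomials vanishes, yet no target is lost: for instance
  \<open>uu + B + B + dl k\<close> is reached from \<open>B\<close> by lowering the exponent of
  \<open>\<ell>(k+1)\<close> by one, and this is where the new logarithm comes from. The obstacle is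
  that \<open>g0 \<circ> (z + \<psi>)\<close> is not linear in \<open>\<psi>\<close>. If
  \<open>q\<close> and \<open>B\<close> share their first nonzero entry, the Wronskian is pushed up
  from \<open>dl (ht B)\<close> to \<open>dl (ht (q - B))\<close>, and products with terms of
  \<open>\<psi>\<close> that are only infinitesimally smaller than \<open>z\<close>, compared with
  \<open>B\<close>, may no longer be negligible. Such terms are therefore settled in a stage of
  their own, for which the shift is constantly \<open>dl (ht B)\<close>.\<close>

definition wo :: "'a::linorder set \<Rightarrow> bool" where
  "wo A \<longleftrightarrow> (\<forall>B\<subseteq>A. B \<noteq> {} \<longrightarrow> (\<exists>m\<in>B. \<forall>x\<in>B. m \<le> x))"

lemma woD: "wo A \<Longrightarrow> B \<subseteq> A \<Longrightarrow> B \<noteq> {} \<Longrightarrow> \<exists>m\<in>B. \<forall>x\<in>B. m \<le> x"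
  unfolding wo_def by blast

lemma wo_least:
  assumes "wo A" "A \<noteq> {}"
  obtains m where "m \<in> A" "\<And>x. x \<in> A \<Longrightarrow> m \<le> x"
  using woD[OF assms(1) subset_refl assms(2)] by blast

lemma wo_subset: "wo A \<Longrightarrow> B \<subseteq> A \<Longrightarrow> wo B"
  unfolding wo_def by blast

lemma wo_empty [simp]: "wo {}"
  unfolding wo_def by blast

lemma wo_Un: "wo A \<Longrightarrow> wo B \<Longrightarrow> wo (A \<union> B)"
  unfolding wo_def
proof (intro allI impI)
  fix C assume A: "\<forall>X\<subseteq>A. X \<noteq> {} \<longrightarrow> (\<exists>m\<in>X. \<forall>x\<in>X. m \<le> x)"
    and B: "\<forall>X\<subseteq>B. X \<noteq> {} \<longrightarrow> (\<exists>m\<in>X. \<forall>x\<in>X. m \<le> x)"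
    and C: "C \<subseteq> A \<union> B" "C \<noteq> {}"
  show "\<exists>m\<in>C. \<forall>x\<in>C. m \<le> x"
  proof (cases "C \<inter> A = {} \<or> C \<inter> B = {}")
    case True
    then have "C \<subseteq> A \<or> C \<subseteq> B" using C by blast
    then show ?thesis using A B C by blast
  next
    case False
    then obtain a b where a: "a \<in> C \<inter> A" "\<forall>x\<in>C \<inter> A. a \<le> x"
      and b: "b \<in> C \<inter> B" "\<forall>x\<in>C \<inter> B. b \<le> x"
      using A B by (meson inf_le2)
    show ?thesis
    proof (cases "a \<le> b")
      case True
      have "a \<le> x" if "x \<in> C" for x using that a b C True order_trans[OF True] by blast
      then show ?thesis using a by blast
    next
      case False
      then have "b \<le> a" by simp
      have "b \<le> x" if "x \<in> C" for x using that a b C order_trans[OF \<open>b \<le> a\<close>] by blast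
      then show ?thesis using b by blast
    qed
  qed
qed

lemma wo_insert: "wo A \<Longrightarrow> wo (insert x A)"
  using wo_Un[of "{x}" A] by (auto simp: wo_def subset_singleton_iff)

lemma wo_finite: "finite A \<Longrightarrow> wo A"
  by (induction A rule: finite_induct) (auto intro: wo_insert)

lemma wo_mono_image:
  assumes "wo A" "mono_on A f"
  shows "wo (f ` A)"
  unfolding wo_def
proof (intro allI impI)
  fix B assume B: "B \<subseteq> f ` A" "B \<noteq> {}"
  then have "{a\<in>A. f a \<in> B} \<noteq> {}" by auto
  then obtain m where m: "m \<in> A" "f m \<in> B" "\<forall>x\<in>{a\<in>A. f a \<in> B}. m \<le> x"
    using woD[OF assms(1), of "{a\<in>A. f a \<in> B}"] by auto
  show "\<exists>m\<in>B. \<forall>x\<in>B. m \<le> x"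
    using m B assms(2) by (intro bexI[of _ "f m"]) (auto simp: mono_on_def)
qed

lemma finite_if_wo_and_reverse_wo:
  fixes A :: "'a::linorder set"
  assumes "wo A" and rev: "\<And>B. B \<subseteq> A \<Longrightarrow> B \<noteq> {} \<Longrightarrow> \<exists>m\<in>B. \<forall>x\<in>B. x \<le> m"
  shows "finite A"
proof (rule ccontr)
  assume inf: "infinite A"
  \<comment> \<open>The least element outside \<open>Y\<close> has an immediate predecessor, the
    largest element below it; that one lies in \<open>Y\<close>, so the segment up to its successor
    is finite as well.\<close>
  define Y where "Y = {x\<in>A. finite (A \<inter> {..x})}"
  have "A - Y \<noteq> {}"
  proof
    assume "A - Y = {}"
    moreover obtain m where "m \<in> A" "\<forall>x\<in>A. x \<le> m" using rev[of A] inf by auto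
    ultimately have "finite (A \<inter> {..m})" "A \<inter> {..m} = A" by (auto simp: Y_def)
    with inf show False by simp
  qed
  then obtain m where m: "m \<in> A - Y" "\<forall>x\<in>A - Y. m \<le> x"
    using woD[OF assms(1), of "A - Y"] by auto
  show False
  proof (cases "A \<inter> {..<m} = {}")
    case True
    then have "A \<inter> {..m} \<subseteq> {m}" by force
    then show False using m finite_subset by (auto simp: Y_def)
  next
    case False
    then obtain y where y: "y \<in> A" "y < m" "\<forall>x\<in>A \<inter> {..<m}. x \<le> y"
      using rev[of "A \<inter> {..<m}"] by auto
    then have "y \<in> Y" using m(2) by force
    moreover have "A \<inter> {..m} \<subseteq> insert m (A \<inter> {..y})" using y by force
    ultimately have "finite (A \<inter> {..m})" by (auto simp: Y_def intro: finite_subset)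
    then show False using m by (auto simp: Y_def)
  qed
qed

text \<open>Subtraction from \<open>e\<close> reverses the order, so the set is well-ordered in both
  directions. This finiteness is what gives the convolution product a meaning.\<close>

lemma wo_finite_sum_pairs:
  fixes A B :: "'a::linordered_ab_group_add set"
  assumes "wo A" "wo B"
  shows "finite {x \<in> A. e - x \<in> B}"
proof (rule finite_if_wo_and_reverse_wo)
  show "wo {x \<in> A. e - x \<in> B}" using assms(1) by (rule wo_subset) auto
  fix C assume C: "C \<subseteq> {x \<in> A. e - x \<in> B}" "C \<noteq> {}"
  then have "(\<lambda>x. e - x) ` C \<subseteq> B" "(\<lambda>x. e - x) ` C \<noteq> {}" by auto
  from woD[OF assms(2) this] obtain m where "m \<in> (\<lambda>x. e - x) ` C" "\<forall>y\<in>(\<lambda>x. e - x) ` C. m \<le> y"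
    by blast
  then show "\<exists>m\<in>C. \<forall>x\<in>C. x \<le> m" by fastforce
qed

lemma wo_set_plus:
  fixes A B :: "'a::linordered_ab_group_add set"
  assumes A: "wo A" and B: "wo B"
  shows "wo (A + B)"
  unfolding wo_def
proof (intro allI impI)
  fix C assume C: "C \<subseteq> A + B" "C \<noteq> {}"
  \<comment> \<open>Induction on the second component \<open>b\<close> of a pair in \<open>P\<close>
    with least first component \<open>a\<close>. Pairs with a sum below \<open>a + b\<close> have
    first components at least \<open>a\<close>, so among them the one with least first component has
    its second component below \<open>b\<close>.\<close>
  define Q where "Q b \<longleftrightarrow> (\<forall>P a. P \<subseteq> A \<times> B \<longrightarrow> (a, b) \<in> P \<longrightarrow>
      (\<forall>p\<in>P. a \<le> fst p) \<longrightarrow> (\<exists>p\<in>P. \<forall>p'\<in>P. fst p + snd p \<le> fst p' + snd p'))" for b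
  have fst_least: "\<exists>a b. (a, b) \<in> P \<and> (\<forall>p\<in>P. a \<le> fst p)" if "P \<subseteq> A \<times> B" "P \<noteq> {}" for P
  proof -
    have "fst ` P \<subseteq> A" "fst ` P \<noteq> {}" using that by auto
    from woD[OF A this] obtain a where "a \<in> fst ` P" "\<forall>x\<in>fst ` P. a \<le> x" by blast
    then show ?thesis by fastforce
  qed
  have Q: "Q b" if "b \<in> B" for b
  proof (rule ccontr)
    assume "\<not> Q b"
    then have "{b\<in>B. \<not> Q b} \<noteq> {}" using that by blast
    then obtain b where b: "b \<in> B" "\<not> Q b" and least: "\<And>x. x \<in> B \<Longrightarrow> x < b \<Longrightarrow> Q x"
      using woD[OF B, of "{b\<in>B. \<not> Q b}"] by force
    have "Q b"
      unfolding Q_def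
    proof (intro allI impI)
      fix P a assume P: "P \<subseteq> A \<times> B" "(a, b) \<in> P" "\<forall>p\<in>P. a \<le> fst p"
      define P' where "P' = {p\<in>P. fst p + snd p < a + b}"
      show "\<exists>p\<in>P. \<forall>p'\<in>P. fst p + snd p \<le> fst p' + snd p'"
      proof (cases "P' = {}")
        case True
        then show ?thesis using P(2) by (intro bexI[of _ "(a, b)"]) (auto simp: P'_def not_less)
      next
        case False
        have sub: "P' \<subseteq> A \<times> B" using P by (auto simp: P'_def)
        then obtain a' b' where ab: "(a', b') \<in> P'" "\<forall>p\<in>P'. a' \<le> fst p"
          using fst_least[OF _ False] by blast
        then have "a \<le> a'" "a' + b' < a + b" using P by (auto simp: P'_def)
        then have "b' < b" by (metis add_mono not_less)
        then have "Q b'" using least sub ab by auto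
        from this[unfolded Q_def, rule_format, OF sub ab(1)] ab(2)
        obtain p where p: "p \<in> P'" "\<forall>p'\<in>P'. fst p + snd p \<le> fst p' + snd p'"
          by blast
        have "fst p + snd p \<le> fst p' + snd p'" if "p' \<in> P" for p'
        proof (cases "p' \<in> P'")
          case False
          then have "a + b \<le> fst p' + snd p'" using that by (auto simp: P'_def not_less)
          then show ?thesis using p(1) by (auto simp: P'_def)
        qed (use p in auto)
        moreover have "p \<in> P" using p(1) by (simp add: P'_def)
        ultimately show ?thesis by blast
      qed
    qed
    with b show False by blast
  qed
  define P where "P = {p\<in>A \<times> B. fst p + snd p \<in> C}"
  have P: "P \<subseteq> A \<times> B" "P \<noteq> {}" using C by (fastforce simp: P_def set_plus_def)+
  then obtain a b where ab: "(a, b) \<in> P" "\<forall>p\<in>P. a \<le> fst p" using fst_least by blast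
  then have "Q b" using P Q by auto
  from this[unfolded Q_def, rule_format, OF P(1) ab(1)] ab(2)
  obtain p where p: "p \<in> P" "\<forall>p'\<in>P. fst p + snd p \<le> fst p' + snd p'"
    by blast
  show "\<exists>m\<in>C. \<forall>x\<in>C. m \<le> x"
  proof (intro bexI[of _ "fst p + snd p"] ballI)
    show "fst p + snd p \<in> C" using p by (auto simp: P_def)
    fix c assume "c \<in> C"
    then have "c \<in> A + B" using C by blast
    then obtain x y where c: "c = x + y" "x \<in> A" "y \<in> B" by (rule set_plus_elim)
    then have "(x, y) \<in> P" using \<open>c \<in> C\<close> by (auto simp: P_def)
    with p(2) c show "fst p + snd p \<le> c" by fastforce
  qed
qed

section \<open>Iterated sums of a well-ordered set of positive elements\<close>

primrec nsum :: "'a::ab_group_add set \<Rightarrow> nat \<Rightarrow> 'a set" where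
  "nsum S 0 = {0}"
| "nsum S (Suc n) = S + nsum S n"

lemma nsum_add: "x \<in> nsum S m \<Longrightarrow> y \<in> nsum S n \<Longrightarrow> x + y \<in> nsum S (m + n)"
proof (induction m arbitrary: x)
  case (Suc m)
  then obtain a t where "x = a + t" "a \<in> S" "t \<in> nsum S m" by (auto simp: set_plus_def)
  then show ?case using Suc.IH[of t] Suc.prems by (auto simp: set_plus_def add.assoc)
qed simp

lemma nsum_split:
  assumes "x \<in> nsum S (m + n)"
  shows "\<exists>y z. x = y + z \<and> y \<in> nsum S m \<and> z \<in> nsum S n"
  using assms
proof (induction m arbitrary: x)
  case (Suc m)
  then obtain a t where at: "x = a + t" "a \<in> S" "t \<in> nsum S (m + n)" by (auto simp: set_plus_def)
  then obtain y z where "t = y + z" "y \<in> nsum S m" "z \<in> nsum S n" using Suc.IH by blast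
  then have "x = (a + y) + z" "a + y \<in> nsum S (Suc m)" "z \<in> nsum S n"
    using at by (auto simp: add.assoc)
  then show ?case by blast
qed auto

lemma nsum_nonneg:
  fixes S :: "'a::linordered_ab_group_add set"
  assumes "\<And>s. s \<in> S \<Longrightarrow> 0 < s"
  shows "x \<in> nsum S n \<Longrightarrow> 0 \<le> x"
proof (induction n arbitrary: x)
  case (Suc n)
  then obtain a t where "x = a + t" "a \<in> S" "t \<in> nsum S n" by (auto simp: set_plus_def)
  then show ?case using Suc.IH[of t] assms[of a] by simp
qed simp

text \<open>Neumann's lemma.  If \<open>U\<close> below were nonempty, its elements would be sums of an
  element of \<open>S\<close> and an element of \<open>T - U\<close> whenever they have minimal length below
  a given bound; such sums form a well-ordered set, so \<open>U\<close> has no room to descend.\<close>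

theorem wo_Union_nsum:
  fixes S :: "'a::linordered_ab_group_add set"
  assumes S: "wo S" and pos: "\<And>s. s \<in> S \<Longrightarrow> 0 < s"
  shows "wo (\<Union>n. nsum S n)"
proof -
  define T where "T = (\<Union>n. nsum S n)"
  define W where "W = {t\<in>T. wo (T \<inter> {..t})}"
  define U where "U = T - W"
  define len where "len t = (LEAST n. t \<in> nsum S n)" for t
  have "wo W"
    unfolding wo_def
  proof (intro allI impI)
    fix B assume B: "B \<subseteq> W" "B \<noteq> {}"
    then obtain b where b: "b \<in> B" "wo (T \<inter> {..b})" by (auto simp: W_def)
    then obtain m where "m \<in> B \<inter> {..b}" "\<forall>x\<in>B \<inter> {..b}. m \<le> x"
      using woD[OF b(2), of "B \<inter> {..b}"] B by (auto simp: W_def)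
    then show "\<exists>m\<in>B. \<forall>x\<in>B. m \<le> x"
      by (metis Int_iff atMost_iff linorder_linear order_trans)
  qed
  have descent: "\<exists>u'\<in>U. u' < u" if "u \<in> U" for u
  proof (rule ccontr)
    assume "\<not> ?thesis"
    then have "T \<inter> {..u} \<subseteq> insert u W" by (force simp: U_def)
    then have "wo (T \<inter> {..u})" using \<open>wo W\<close> wo_insert wo_subset by blast
    then show False using that by (auto simp: U_def W_def)
  qed
  have zero: "0 \<notin> U"
  proof
    assume "0 \<in> U"
    then obtain u where "u \<in> U" "u < 0" using descent by blast
    then show False using nsum_nonneg[of S] pos by (force simp: U_def T_def)
  qed
  \<comment> \<open>Used with two bounds \<open>P\<close>: the whole group, and the elements below
    the least member of \<open>U \<inter> (S + W)\<close>.\<close>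
  have short: "\<exists>u'\<in>U \<inter> (S + W). u' \<in> P" if u: "u \<in> U \<inter> P" and P: "\<And>x y. x \<in> P \<Longrightarrow> y < x \<Longrightarrow> y \<in> P" for u P
  proof -
    have "\<exists>v. v \<in> U \<inter> P \<and> (\<forall>y. y \<in> U \<inter> P \<longrightarrow> len v \<le> len y)"
      using u ex_has_least_nat[of "\<lambda>v. v \<in> U \<inter> P" u len] by blast
    then obtain v where v: "v \<in> U \<inter> P" "\<And>y. y \<in> U \<inter> P \<Longrightarrow> len v \<le> len y" by blast
    then have "v \<in> T" by (auto simp: U_def)
    then have vn: "v \<in> nsum S (len v)" unfolding len_def T_def by (auto intro: LeastI)
    have "len v \<noteq> 0"
    proof
      assume "len v = 0"
      then have "v = 0" using vn by simp
      then show False using zero v(1) by blast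
    qed
    then obtain n where n: "len v = Suc n" using not0_implies_Suc by blast
    then obtain a t where at: "v = a + t" "a \<in> S" "t \<in> nsum S n" using vn by (auto simp: set_plus_def)
    have "len t \<le> n" unfolding len_def using at(3) by (rule Least_le)
    moreover have "t < v" using at pos by simp
    moreover have "t \<in> T" using at by (auto simp: T_def)
    ultimately have "t \<in> W" using v P[of v t] n by (force simp: U_def)
    then have "v \<in> S + W" using at by (auto simp: set_plus_def)
    then show ?thesis using v by blast
  qed
  have "U = {}"
  proof (rule ccontr)
    assume "U \<noteq> {}"
    then have "U \<inter> (S + W) \<noteq> {}" using short[of _ UNIV] by blast
    moreover have "wo (U \<inter> (S + W))" using wo_set_plus[OF S \<open>wo W\<close>] by (rule wo_subset) blast
    ultimately obtain m where m: "m \<in> U" "\<And>x. x \<in> U \<inter> (S + W) \<Longrightarrow> m \<le> x"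
      using wo_least by (metis IntD1)
    then obtain u where "u \<in> U \<inter> {..<m}" using descent by blast
    from short[OF this] m(2) show False by force
  qed
  then show ?thesis using \<open>wo W\<close> by (auto simp: U_def T_def intro: wo_subset)
qed

instance prod :: (linordered_ab_group_add, linordered_ab_group_add) linordered_ab_group_add
proof
  fix a b c :: "'a \<times> 'b"
  assume "a \<le> b"
  then show "c + a \<le> c + b" by (cases a; cases b; cases c) auto
qed

text \<open>Attach \<open>-1\<close> to every summand as a second component. The pairs are still
  positive for the lexicographic order, so their iterated sums are well-ordered by
  \<open>wo_Union_nsum\<close>; a sum of \<open>n\<close> elements carries \<open>-n\<close>, hence
  a least pair over \<open>t\<close> bounds \<open>n\<close> from above.\<close>

lemma finite_nsum_index:
  fixes S :: "'a::linordered_ab_group_add set"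
  assumes S: "wo S" and pos: "\<And>s. s \<in> S \<Longrightarrow> 0 < s"
  shows "finite {n. t \<in> nsum S n}"
proof -
  define S' where "S' = (\<lambda>s. (s, -1::int)) ` S"
  have S': "(x, - int n) \<in> nsum S' n" if "x \<in> nsum S n" for x n
    using that
  proof (induction n arbitrary: x)
    case (Suc n)
    then obtain a t where at: "x = a + t" "a \<in> S" "t \<in> nsum S n" by (auto simp: set_plus_def)
    then have "(x, - int (Suc n)) = (a, -1) + (t, - int n)" by simp
    then show ?case using Suc.IH[OF at(3)] at(2) set_plus_intro[of "(a, -1)" S' "(t, - int n)"] by (auto simp: S'_def)
  qed (simp add: zero_prod_def)
  have "wo S'" unfolding S'_def using S by (rule wo_mono_image) (auto simp: mono_on_def)
  moreover have "\<And>s. s \<in> S' \<Longrightarrow> 0 < s" using pos by (auto simp: S'_def zero_prod_def)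
  ultimately have wo: "wo (\<Union>n. nsum S' n)" by (rule wo_Union_nsum)
  show ?thesis
  proof (cases "{n. t \<in> nsum S n} = {}")
    case False
    define B where "B = (\<lambda>n. (t, - int n)) ` {n. t \<in> nsum S n}"
    have "B \<subseteq> (\<Union>n. nsum S' n)" "B \<noteq> {}" using S' False by (auto simp: B_def)
    from woD[OF wo this] obtain m where "m \<in> B" "\<forall>x\<in>B. m \<le> x" by blast
    then obtain N where "\<forall>n\<in>{n. t \<in> nsum S n}. n \<le> N" by (auto simp: B_def)
    then show ?thesis by (meson finite_nat_set_iff_bounded_le)
  qed simp
qed

lemma finite_plus_nsum_index:
  fixes S :: "'a::linordered_ab_group_add set"
  assumes A: "wo A" and S: "wo S" and pos: "\<And>s. s \<in> S \<Longrightarrow> 0 < s"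
  shows "finite {n. e \<in> A + nsum S n}"
proof -
  have "{n. e \<in> A + nsum S n} \<subseteq> (\<Union>x\<in>{x\<in>A. e - x \<in> (\<Union>n. nsum S n)}. {n. e - x \<in> nsum S n})"
  proof
    fix n assume "n \<in> {n. e \<in> A + nsum S n}"
    then obtain a t where "e = a + t" "a \<in> A" "t \<in> nsum S n" by (auto simp: set_plus_def)
    then show "n \<in> (\<Union>x\<in>{x\<in>A. e - x \<in> (\<Union>n. nsum S n)}. {n. e - x \<in> nsum S n})"
      by (intro UN_I[of a]) auto
  qed
  moreover have "finite (\<Union>x\<in>{x\<in>A. e - x \<in> (\<Union>n. nsum S n)}. {n. e - x \<in> nsum S n})"
    using wo_finite_sum_pairs[OF A wo_Union_nsum[OF S pos]] finite_nsum_index[OF S pos] by blast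
  ultimately show ?thesis by (rule finite_subset)
qed

lemma wo_Union_plus_nsum:
  fixes S :: "'a::linordered_ab_group_add set"
  assumes A: "wo A" and S: "wo S" and pos: "\<And>s. s \<in> S \<Longrightarrow> 0 < s"
  shows "wo (\<Union>n. A + nsum S n)"
proof -
  have "(\<Union>n. A + nsum S n) \<subseteq> A + (\<Union>n. nsum S n)" by (auto simp: set_plus_def)
  then show ?thesis using wo_set_plus[OF A wo_Union_nsum[OF S pos]] wo_subset by blast
qed

section \<open>Hahn series with real coefficients\<close>

text \<open>Well-ordered support is built into the type, so that the ring laws hold without side
  conditions. Bounds on the logarithmic depth are imposed on supports where they matter.\<close>

typedef (overloaded) 'a hahn = "{f :: 'a::linorder \<Rightarrow> real. wo {x. f x \<noteq> 0}}"
  morphisms coeff Hahn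
  by (rule exI[of _ "\<lambda>_. 0"]) simp

setup_lifting type_definition_hahn

definition sp :: "'a::linorder hahn \<Rightarrow> 'a set" where
  "sp f = {x. coeff f x \<noteq> 0}"

lemma wo_sp [simp]: "wo (sp f)"
  using coeff[of f] by (simp add: sp_def)

lemma in_sp: "x \<in> sp f \<longleftrightarrow> coeff f x \<noteq> 0"
  by (simp add: sp_def)

lemma coeff_Hahn: "wo {x. f x \<noteq> 0} \<Longrightarrow> coeff (Hahn f) = f"
  by (simp add: Hahn_inverse)

lemma hahn_eqI: "(\<And>x. coeff f x = coeff g x) \<Longrightarrow> f = g"
  by (simp add: coeff_inject[symmetric] fun_eq_iff)

instantiation hahn :: (linorder) real_vector
begin

lift_definition zero_hahn :: "'a hahn" is "\<lambda>_. 0" by simp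

lift_definition plus_hahn :: "'a hahn \<Rightarrow> 'a hahn \<Rightarrow> 'a hahn" is "\<lambda>f g x. f x + g x"
proof -
  fix f g :: "'a \<Rightarrow> real"
  assume "wo {x. f x \<noteq> 0}" "wo {x. g x \<noteq> 0}"
  then show "wo {x. f x + g x \<noteq> 0}" by (rule wo_subset[OF wo_Un]) auto
qed

lift_definition uminus_hahn :: "'a hahn \<Rightarrow> 'a hahn" is "\<lambda>f x. - f x" by simp

lift_definition minus_hahn :: "'a hahn \<Rightarrow> 'a hahn \<Rightarrow> 'a hahn" is "\<lambda>f g x. f x - g x"
proof -
  fix f g :: "'a \<Rightarrow> real"
  assume "wo {x. f x \<noteq> 0}" "wo {x. g x \<noteq> 0}"
  then show "wo {x. f x - g x \<noteq> 0}" by (rule wo_subset[OF wo_Un]) auto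
qed

lift_definition scaleR_hahn :: "real \<Rightarrow> 'a hahn \<Rightarrow> 'a hahn" is "\<lambda>c f x. c * f x"
  by (erule wo_subset) auto

instance
  by standard (transfer; simp add: algebra_simps fun_eq_iff)+

end

lemma coeff_simps [simp]:
  "coeff 0 x = 0" "coeff (f + g) x = coeff f x + coeff g x" "coeff (- f) x = - coeff f x"
  "coeff (f - g) x = coeff f x - coeff g x" "coeff (c *\<^sub>R f) x = c * coeff f x"
  by (simp_all add: zero_hahn.rep_eq plus_hahn.rep_eq uminus_hahn.rep_eq minus_hahn.rep_eq
      scaleR_hahn.rep_eq)

lemma coeff_sum [simp]: "coeff (sum F I) x = (\<Sum>i\<in>I. coeff (F i) x)"
  by (induction I rule: infinite_finite_induct) auto

lift_definition mon :: "'a::linorder \<Rightarrow> 'a hahn" is "\<lambda>e x. if x = e then 1 else 0"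
  by (rule wo_subset[OF wo_finite[OF finite.insertI[OF finite.emptyI]]]) auto

lemma coeff_mon: "coeff (mon e) x = (if x = e then 1 else 0)"
  by (rule mon.rep_eq[THEN fun_cong])

lemma sp_zero [simp]: "sp 0 = {}" and sp_mon [simp]: "sp (mon e) = {e}"
  by (auto simp: sp_def coeff_mon)

lemma sp_eq_empty_iff [simp]: "sp f = {} \<longleftrightarrow> f = 0"
  by (auto simp: sp_def intro: hahn_eqI)

lemma sp_add: "sp (f + g) \<subseteq> sp f \<union> sp g" and sp_diff: "sp (f - g) \<subseteq> sp f \<union> sp g"
  and sp_uminus [simp]: "sp (- f) = sp f" and sp_scaleR: "sp (c *\<^sub>R f) \<subseteq> sp f"
  by (auto simp: sp_def)

lemma sp_sum: "sp (sum F I) \<subseteq> (\<Union>i\<in>I. sp (F i))"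
  by (auto simp: sp_def dest: sum.not_neutral_contains_not_neutral)

lemma sum_sp_pairs:
  fixes f g :: "'a::linordered_ab_group_add hahn"
  shows "Sum_any (\<lambda>x. coeff f x * coeff g (e - x)) = (\<Sum>x\<in>{x\<in>sp f. e - x \<in> sp g}. coeff f x * coeff g (e - x))"
  using wo_finite_sum_pairs[OF wo_sp[of f] wo_sp[of g], of e]
  by (intro Sum_any.expand_superset) (auto simp: in_sp)

lemma sum_sp_pairs':
  fixes f g :: "'a::linordered_ab_group_add hahn"
  assumes "wo A" "wo B" "sp f \<subseteq> A" "sp g \<subseteq> B"
  shows "Sum_any (\<lambda>x. coeff f x * coeff g (e - x)) = (\<Sum>x\<in>{x\<in>A. e - x \<in> B}. coeff f x * coeff g (e - x))"
  using assms by (intro Sum_any.expand_superset) (auto simp: in_sp wo_finite_sum_pairs)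

lemma sum_sp_pairs_support:
  fixes f g :: "'a::linordered_ab_group_add hahn"
  shows "{e. Sum_any (\<lambda>x. coeff f x * coeff g (e - x)) \<noteq> 0} \<subseteq> sp f + sp g"
proof
  fix e assume "e \<in> {e. Sum_any (\<lambda>x. coeff f x * coeff g (e - x)) \<noteq> 0}"
  then obtain x where "coeff f x * coeff g (e - x) \<noteq> 0"
    by (auto elim: Sum_any.not_neutral_obtains_not_neutral)
  then have "x \<in> sp f" "e - x \<in> sp g" by (auto simp: in_sp)
  then show "e \<in> sp f + sp g" using set_plus_intro[of x "sp f" "e - x" "sp g"] by simp
qed

instantiation hahn :: (linordered_ab_group_add) "{comm_ring_1, real_algebra_1}"
begin

definition one_hahn :: "'a hahn" where "one_hahn = mon 0"

definition times_hahn :: "'a hahn \<Rightarrow> 'a hahn \<Rightarrow> 'a hahn" where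
  "times_hahn f g = Hahn (\<lambda>e. Sum_any (\<lambda>x. coeff f x * coeff g (e - x)))"

lemma coeff_times: "coeff (f * g) e = Sum_any (\<lambda>x. coeff f x * coeff g (e - x))"
  unfolding times_hahn_def
  by (subst coeff_Hahn) (rule wo_subset[OF wo_set_plus[OF wo_sp wo_sp] sum_sp_pairs_support], rule refl)

text \<open>Allowing supersets of the supports lets several products be summed over one index set,
  as needed for distributivity, scalars and associativity.\<close>

lemma coeff_times_superset:
  assumes "wo A" "wo B" "sp f \<subseteq> A" "sp g \<subseteq> B"
  shows "coeff (f * g) e = (\<Sum>x\<in>{x\<in>A. e - x \<in> B}. coeff f x * coeff g (e - x))"
  unfolding coeff_times using assms by (rule sum_sp_pairs')

lemma coeff_times_mon: "coeff (mon e * f) x = coeff f (x - e)"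
proof -
  have "coeff (mon e * f) x = (\<Sum>y\<in>{e}. coeff (mon e) y * coeff f (x - y))"
    unfolding coeff_times by (rule Sum_any.expand_superset) (auto simp: coeff_mon)
  then show ?thesis by (simp add: coeff_mon)
qed

lemma times_hahn_commute: "f * g = g * (f :: 'a hahn)"
proof (rule hahn_eqI)
  fix e
  have "coeff (f * g) e = (\<Sum>x\<in>{x\<in>sp f. e - x \<in> sp g}. coeff f x * coeff g (e - x))"
    unfolding coeff_times by (rule sum_sp_pairs)
  also have "\<dots> = (\<Sum>x\<in>{x\<in>sp g. e - x \<in> sp f}. coeff g x * coeff f (e - x))"
    by (rule sum.reindex_bij_witness[of _ "\<lambda>x. e - x" "\<lambda>x. e - x"]) (auto simp: mult.commute)
  also have "\<dots> = coeff (g * f) e"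
    unfolding coeff_times by (rule sum_sp_pairs[symmetric])
  finally show "coeff (f * g) e = coeff (g * f) e" .
qed

lemma times_hahn_distrib: "f * (g + h) = f * g + f * (h :: 'a hahn)"
proof (rule hahn_eqI)
  fix e
  have wo: "wo (sp f)" "wo (sp g \<union> sp h)" by (auto intro: wo_Un)
  show "coeff (f * (g + h)) e = coeff (f * g + f * h) e"
    unfolding coeff_simps
    by (subst (1 2 3) coeff_times_superset[OF wo])
      (use sp_add[of g h] in \<open>auto simp: distrib_left sum.distrib\<close>)
qed

lemma times_hahn_scaleR: "f * (c *\<^sub>R g) = c *\<^sub>R (f * (g :: 'a hahn))"
proof (rule hahn_eqI)
  fix e
  have wo: "wo (sp f)" "wo (sp g)" by auto
  show "coeff (f * (c *\<^sub>R g)) e = coeff (c *\<^sub>R (f * g)) e"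
    unfolding coeff_simps
    by (subst (1 2) coeff_times_superset[OF wo])
      (use sp_scaleR[of c g] in \<open>auto simp: sum_distrib_left mult_ac\<close>)
qed

lemma times_hahn_assoc: "f * g * h = f * (g * (h :: 'a hahn))"
proof (rule hahn_eqI)
  fix e
  define F G H where "F = sp f" and "G = sp g" and "H = sp h"
  have wo: "wo F" "wo G" "wo H" by (auto simp: F_def G_def H_def)
  have FG: "sp (f * g) \<subseteq> F + G" and GH: "sp (g * h) \<subseteq> G + H"
    using sum_sp_pairs_support[of f g] sum_sp_pairs_support[of g h]
    by (auto simp: F_def G_def H_def sp_def coeff_times)
  have woFG: "wo (F + G)" and woGH: "wo (G + H)" using wo by (auto intro: wo_set_plus)
  have "coeff (f * (g * h)) e = (\<Sum>x\<in>{x\<in>F. e - x \<in> G + H}. coeff f x * coeff (g * h) (e - x))"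
    by (rule coeff_times_superset) (use wo woGH GH in \<open>auto simp: F_def\<close>)
  also have "\<dots> = (\<Sum>x\<in>{x\<in>F. e - x \<in> G + H}. \<Sum>y\<in>{y\<in>G. e - x - y \<in> H}. coeff f x * (coeff g y * coeff h (e - x - y)))"
    by (subst coeff_times_superset[OF wo(2,3)]) (auto simp: G_def H_def sum_distrib_left)
  also have "\<dots> = (\<Sum>(x, y)\<in>Sigma {x\<in>F. e - x \<in> G + H} (\<lambda>x. {y\<in>G. e - x - y \<in> H}).
       coeff f x * coeff g y * coeff h (e - x - y))"
    by (subst sum.Sigma) (use wo woGH in \<open>auto intro!: wo_finite_sum_pairs simp: mult.assoc\<close>)
  \<comment> \<open>The triples \<open>x\<close>, \<open>y\<close>, \<open>e - x - y\<close> are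
    regrouped by their partial sum \<open>w = x + y\<close>.\<close>
  also have "\<dots> = (\<Sum>(w, x)\<in>Sigma {w\<in>F + G. e - w \<in> H} (\<lambda>w. {x\<in>F. w - x \<in> G}).
       coeff f x * coeff g (w - x) * coeff h (e - w))"
  proof (rule sum.reindex_bij_witness[of _ "\<lambda>(w, x). (x, w - x)" "\<lambda>(x, y). (x + y, x)"], goal_cases)
    case (2 a)
    then show ?case by (auto simp: diff_diff_eq)
  next
    case (4 b)
    then have "(snd b \<in> F \<and> fst b - snd b \<in> G) \<and> e - fst b \<in> H" by auto
    moreover from this have "(fst b - snd b) + (e - fst b) \<in> G + H" by (intro set_plus_intro) auto
    ultimately show ?case by (auto simp: case_prod_beta)
  qed (auto simp: diff_diff_eq)
  also have "\<dots> = (\<Sum>w\<in>{w\<in>F + G. e - w \<in> H}. \<Sum>x\<in>{x\<in>F. w - x \<in> G}. coeff f x * coeff g (w - x) * coeff h (e - w))"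
    by (subst sum.Sigma) (use wo woFG in \<open>auto intro!: wo_finite_sum_pairs\<close>)
  also have "\<dots> = (\<Sum>w\<in>{w\<in>F + G. e - w \<in> H}. coeff (f * g) w * coeff h (e - w))"
    by (subst coeff_times_superset[OF wo(1,2)]) (auto simp: F_def G_def sum_distrib_right)
  also have "\<dots> = coeff (f * g * h) e"
    by (rule coeff_times_superset[symmetric]) (use wo woFG FG in \<open>auto simp: H_def\<close>)
  finally show "coeff (f * g * h) e = coeff (f * (g * h)) e" by simp
qed

instance
proof
  fix f g h :: "'a hahn" and c :: real
  show "f * g * h = f * (g * h)" by (rule times_hahn_assoc)
  show "f * g = g * f" by (rule times_hahn_commute)
  show "1 * f = f"
    by (rule hahn_eqI) (simp add: one_hahn_def coeff_times_mon)
  then show "f * 1 = f" by (simp add: times_hahn_commute)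
  show "(f + g) * h = f * h + g * h"
    by (metis times_hahn_commute times_hahn_distrib)
  show "f * (g + h) = f * g + f * h" by (rule times_hahn_distrib)
  show "(0::'a hahn) \<noteq> 1"
    by (metis one_hahn_def sp_mon sp_zero insert_not_empty)
  show "c *\<^sub>R f * g = c *\<^sub>R (f * g)"
    by (metis times_hahn_commute times_hahn_scaleR)
  show "f * c *\<^sub>R g = c *\<^sub>R (f * g)" by (rule times_hahn_scaleR)
qed

end

lemma sp_mult: "sp (f * g) \<subseteq> sp f + sp g"
  using sum_sp_pairs_support[of f g] by (auto simp: sp_def coeff_times)

lemma sp_one [simp]: "sp 1 = {0}"
  by (simp add: one_hahn_def)

lemma sp_multE:
  assumes "e \<in> sp (f * g)"
  obtains x y where "x \<in> sp f" "y \<in> sp g" "e = x + y"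
  using assms sp_mult[of f g] by (auto simp: set_plus_def)

lemma mon_mult: "mon a * mon b = mon (a + b)"
  by (rule hahn_eqI) (auto simp: coeff_times_mon coeff_mon algebra_simps)

lemma coeff_times_least:
  assumes "\<And>x. x \<in> sp f \<Longrightarrow> a \<le> x" "\<And>x. x \<in> sp g \<Longrightarrow> b \<le> x"
  shows "coeff (f * g) (a + b) = coeff f a * coeff g b"
proof -
  have "coeff (f * g) (a + b) = (\<Sum>x\<in>{a}. coeff f x * coeff g (a + b - x))"
    unfolding coeff_times
  proof (rule Sum_any.expand_superset)
    show "{x. coeff f x * coeff g (a + b - x) \<noteq> 0} \<subseteq> {a}"
    proof
      fix x assume "x \<in> {x. coeff f x * coeff g (a + b - x) \<noteq> 0}"
      then have "a \<le> x" "b \<le> a + b - x" using assms by (auto simp: in_sp)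
      then show "x \<in> {a}" by (auto simp: algebra_simps)
    qed
  qed simp
  then show ?thesis by simp
qed

lift_definition hrestrict :: "'a set \<Rightarrow> 'a::linorder hahn \<Rightarrow> 'a hahn" is
  "\<lambda>X f x. if x \<in> X then f x else 0"
  by (erule wo_subset) auto

lemma coeff_restrict: "coeff (hrestrict X f) x = (if x \<in> X then coeff f x else 0)"
  by (rule hrestrict.rep_eq[THEN fun_cong])

lemma sp_restrict [simp]: "sp (hrestrict X f) = sp f \<inter> X"
  by (auto simp: sp_def coeff_restrict)

lemma sp_least:
  assumes "f \<noteq> 0"
  obtains m where "m \<in> sp f" "\<And>x. x \<in> sp f \<Longrightarrow> m \<le> x"
  using wo_least[OF wo_sp, of f] assms by (metis sp_eq_empty_iff)

section \<open>Infinite sums of graded families\<close>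

text \<open>By Neumann's lemma a graded family is summable: each exponent occurs in only finitely
  many of its members.\<close>

definition graded :: "'a::linordered_ab_group_add set \<Rightarrow> 'a set \<Rightarrow> (nat \<Rightarrow> 'a hahn) \<Rightarrow> bool" where
  "graded A S F \<longleftrightarrow> wo A \<and> wo S \<and> (\<forall>s\<in>S. 0 < s) \<and> (\<forall>i. sp (F i) \<subseteq> A + nsum S i)"

definition hsum :: "(nat \<Rightarrow> 'a::linordered_ab_group_add hahn) \<Rightarrow> 'a hahn" where
  "hsum F = Hahn (\<lambda>e. Sum_any (\<lambda>i. coeff (F i) e))"

lemma nsum_bound:
  fixes A S :: "'a::linordered_ab_group_add set"
  assumes "wo A" "wo S" "\<forall>s\<in>S. 0 < s"
  obtains N where "\<And>i. N \<le> i \<Longrightarrow> e \<notin> A + nsum S i"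
proof -
  have "finite {n. e \<in> A + nsum S n}" using assms by (intro finite_plus_nsum_index) auto
  then obtain N where "\<forall>n\<in>{n. e \<in> A + nsum S n}. n < N" by (meson finite_nat_set_iff_bounded)
  then have "N \<le> i \<Longrightarrow> e \<notin> A + nsum S i" for i by (metis mem_Collect_eq not_less)
  then show thesis using that by blast
qed

lemma coeff_hsum:
  assumes "graded A S F"
  shows "coeff (hsum F) e = Sum_any (\<lambda>i. coeff (F i) e)"
proof -
  have "{e. Sum_any (\<lambda>i. coeff (F i) e) \<noteq> 0} \<subseteq> (\<Union>i. A + nsum S i)"
  proof
    fix e assume "e \<in> {e. Sum_any (\<lambda>i. coeff (F i) e) \<noteq> 0}"
    then obtain i where "coeff (F i) e \<noteq> 0"
      using Sum_any.not_neutral_obtains_not_neutral by auto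
    then show "e \<in> (\<Union>i. A + nsum S i)" using assms by (auto simp: graded_def sp_def)
  qed
  then have "wo {e. Sum_any (\<lambda>i. coeff (F i) e) \<noteq> 0}"
    using wo_Union_plus_nsum[of A S] assms wo_subset by (metis graded_def)
  then show ?thesis by (simp add: hsum_def coeff_Hahn)
qed

lemma coeff_hsum_finite:
  assumes "graded A S F" "\<And>i. N \<le> i \<Longrightarrow> coeff (F i) e = 0"
  shows "coeff (hsum F) e = (\<Sum>i<N. coeff (F i) e)"
  unfolding coeff_hsum[OF assms(1)]
  by (rule Sum_any.expand_superset) (use assms(2) in \<open>auto simp: not_less[symmetric]\<close>)

lemma graded_bound:
  assumes "graded A S F"
  obtains N where "\<And>i. N \<le> i \<Longrightarrow> coeff (F i) e = 0"
proof -
  obtain N where "\<And>i. N \<le> i \<Longrightarrow> e \<notin> A + nsum S i" using nsum_bound assms by (metis graded_def)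
  then have "N \<le> i \<Longrightarrow> coeff (F i) e = 0" for i using assms by (auto simp: graded_def sp_def)
  then show thesis using that by blast
qed

lemma sp_hsum: "graded A S F \<Longrightarrow> sp (hsum F) \<subseteq> (\<Union>i. sp (F i))"
proof
  fix e assume *: "graded A S F" "e \<in> sp (hsum F)"
  then have "Sum_any (\<lambda>i. coeff (F i) e) \<noteq> 0" by (simp add: in_sp coeff_hsum)
  then show "e \<in> (\<Union>i. sp (F i))" using Sum_any.not_neutral_obtains_not_neutral by (auto simp: sp_def)
qed

lemma hsum_add:
  assumes "graded A S F" "graded A' S' G" "graded A'' S'' (\<lambda>i. F i + G i)"
  shows "hsum (\<lambda>i. F i + G i) = hsum F + hsum G"
proof (rule hahn_eqI)
  fix e
  obtain N M where N: "\<And>i. N \<le> i \<Longrightarrow> coeff (F i) e = 0" and M: "\<And>i. M \<le> i \<Longrightarrow> coeff (G i) e = 0"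
    using graded_bound assms by metis
  show "coeff (hsum (\<lambda>i. F i + G i)) e = coeff (hsum F + hsum G) e"
    unfolding coeff_simps
    by (subst (1 2 3) coeff_hsum_finite[where N = "max N M"])
      (use assms N M in \<open>auto simp: sum.distrib\<close>)
qed

lemma graded_shift:
  assumes "graded A S F" "wo Y" "\<And>f. sp (T f) \<subseteq> sp f + Y"
  shows "graded (A + Y) S (\<lambda>i. T (F i))"
  unfolding graded_def
proof (intro conjI allI)
  show "sp (T (F i)) \<subseteq> A + Y + nsum S i" for i
  proof -
    have "sp (T (F i)) \<subseteq> (A + nsum S i) + Y"
      using assms(1) assms(3)[of "F i"] set_plus_mono2[of "sp (F i)" "A + nsum S i" Y Y]
      by (auto simp: graded_def)
    then show ?thesis by (simp add: add_ac)
  qed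
qed (use assms wo_set_plus in \<open>auto simp: graded_def\<close>)

text \<open>Additive operators that shift supports by a well-ordered set commute with infinite sums.\<close>

lemma hsum_continuous:
  assumes F: "graded A S F" and Y: "wo Y" and T: "\<And>f. sp (T f) \<subseteq> sp f + Y"
    and add: "\<And>f g. T (f + g) = T f + T g"
  shows "T (hsum F) = hsum (\<lambda>i. T (F i))"
proof (rule hahn_eqI)
  fix e
  have AYS: "wo (A + Y)" "wo S" "\<forall>s\<in>S. 0 < s" using F Y wo_set_plus by (auto simp: graded_def)
  have TF: "graded (A + Y) S (\<lambda>i. T (F i))" using F Y T by (rule graded_shift)
  obtain N where N: "\<And>i. N \<le> i \<Longrightarrow> e \<notin> A + Y + nsum S i" using nsum_bound[OF AYS] by metis
  \<comment> \<open>The tail \<open>R\<close> has its exponents in sets \<open>A + nsum S i\<close>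
    with \<open>i \<ge> N\<close>. By the choice of \<open>N\<close> no shift by an element of
    \<open>Y\<close> leads from there to \<open>e\<close>, so \<open>T R\<close> does not contribute
    at \<open>e\<close>.\<close>
  define R where "R = hsum F - (\<Sum>i<N. F i)"
  have T0: "T 0 = 0" using add[of 0 0] by simp
  have sumT: "T (sum G I) = (\<Sum>i\<in>I. T (G i))" if "finite I" for G :: "nat \<Rightarrow> 'a hahn" and I
    using that by (induction I rule: finite_induct) (auto simp: add T0)
  have R: "\<exists>i\<ge>N. x \<in> A + nsum S i" if "x \<in> sp R" for x
  proof (rule ccontr)
    assume "\<not> ?thesis"
    then have "\<And>i. N \<le> i \<Longrightarrow> coeff (F i) x = 0" using F by (auto simp: graded_def sp_def)
    then have "coeff R x = 0" unfolding R_def by (simp add: coeff_hsum_finite[OF F])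
    then show False using that by (simp add: in_sp)
  qed
  have "e \<notin> sp (T R)"
  proof
    assume "e \<in> sp (T R)"
    then obtain x y where xy: "e = x + y" "x \<in> sp R" "y \<in> Y" using T[of R] by (auto simp: set_plus_def)
    then obtain i where i: "N \<le> i" "x \<in> A + nsum S i" using R by blast
    then have "e \<in> (A + nsum S i) + Y" using xy by auto
    then show False using N i(1) by (simp add: add_ac)
  qed
  moreover have "T (hsum F) = (\<Sum>i<N. T (F i)) + T R"
    by (simp add: R_def add[symmetric] sumT[symmetric])
  moreover have "coeff (T (F i)) e = 0" if "N \<le> i" for i
    using TF N[OF that] by (auto simp: graded_def sp_def)
  ultimately show "coeff (T (hsum F)) e = coeff (hsum (\<lambda>i. T (F i))) e"
    using coeff_hsum_finite[OF TF, of N e] by (simp add: in_sp)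
qed

text \<open>Summation of a double series along its diagonals, needed both for the Cauchy product in
  \<open>comp_mult\<close> and for the composition law \<open>comp_comp\<close>.\<close>

lemma hsum_diag:
  assumes A: "wo A" "wo S" "\<forall>s\<in>S. 0 < s" and X: "\<And>i j. sp (X i j) \<subseteq> A + nsum S (i + j)"
  shows "hsum (\<lambda>i. hsum (X i)) = hsum (\<lambda>n. \<Sum>i\<le>n. X i (n - i))"
    and "graded A S (\<lambda>n. \<Sum>i\<le>n. X i (n - i))"
proof -
  have "sp (\<Sum>i\<le>n. X i (n - i)) \<subseteq> A + nsum S n" for n
    using sp_sum[of "\<lambda>i. X i (n - i)" "{..n}"] X by fastforce
  then show diag: "graded A S (\<lambda>n. \<Sum>i\<le>n. X i (n - i))" using A by (simp add: graded_def)
  show "hsum (\<lambda>i. hsum (X i)) = hsum (\<lambda>n. \<Sum>i\<le>n. X i (n - i))"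
  proof (rule hahn_eqI)
    fix e
    \<comment> \<open>Within a row or a column one of the two indices is absorbed into the base set,
      which stays well-ordered by Neumann's lemma.\<close>
    have sub: "A + nsum S (i + j) \<subseteq> (A + (\<Union>n. nsum S n)) + nsum S i" for i j
    proof
      fix x assume "x \<in> A + nsum S (i + j)"
      then obtain a t where x: "x = a + t" "a \<in> A" "t \<in> nsum S (i + j)" by (auto simp: set_plus_def)
      then obtain t1 t2 where "t = t1 + t2" "t1 \<in> nsum S i" "t2 \<in> nsum S j"
        using nsum_split by blast
      then have "x = (a + t2) + t1" using x by (simp add: add_ac)
      then show "x \<in> (A + (\<Union>n. nsum S n)) + nsum S i"
        using set_plus_intro[OF set_plus_intro[OF x(2), of t2 "\<Union>n. nsum S n"] \<open>t1 \<in> _\<close>] \<open>t2 \<in> _\<close>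
        by auto
    qed
    have woA: "wo (A + (\<Union>n. nsum S n))" using A wo_set_plus wo_Union_nsum by blast
    have row: "graded (A + (\<Union>n. nsum S n)) S (X i)" for i
      using X[of i] sub A woA by (fastforce simp: graded_def add.commute)
    have "sp (hsum (X i)) \<subseteq> (A + (\<Union>n. nsum S n)) + nsum S i" for i
      using sp_hsum[OF row] X sub by blast
    then have col: "graded (A + (\<Union>n. nsum S n)) S (\<lambda>i. hsum (X i))"
      using A woA by (auto simp: graded_def)
    obtain N where N: "\<And>i. N \<le> i \<Longrightarrow> e \<notin> A + nsum S i" using nsum_bound[OF A] by metis
    then have X0: "N \<le> i + j \<Longrightarrow> coeff (X i j) e = 0" for i j
      using X[of i j] by (auto simp: sp_def)
    have row_e: "coeff (hsum (X i)) e = (\<Sum>j<N - i. coeff (X i j) e)" for i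
      by (rule coeff_hsum_finite[OF row]) (use X0 in auto)
    have "coeff (hsum (\<lambda>i. hsum (X i))) e = (\<Sum>i<N. \<Sum>j<N - i. coeff (X i j) e)"
      by (subst coeff_hsum_finite[OF col, of N]) (auto simp: row_e)
    also have "\<dots> = (\<Sum>n<N. \<Sum>i\<le>n. coeff (X i (n - i)) e)"
      by (subst (1 2) sum.Sigma, simp, simp, simp, simp)
        (rule sum.reindex_bij_witness[of _ "\<lambda>(n, i). (i, n - i)" "\<lambda>(i, j). (i + j, i)"], auto)
    also have "\<dots> = coeff (hsum (\<lambda>n. \<Sum>i\<le>n. X i (n - i))) e"
      by (subst coeff_hsum_finite[OF diag, of N]) (auto intro!: sum.neutral simp: X0)
    finally show "coeff (hsum (\<lambda>i. hsum (X i))) e = coeff (hsum (\<lambda>n. \<Sum>i\<le>n. X i (n - i))) e" .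
  qed
qed

section \<open>Derivations and Taylor composition\<close>

lemma nsum_set_plus: "x \<in> nsum X n \<Longrightarrow> y \<in> nsum Y n \<Longrightarrow> x + y \<in> nsum (X + Y) n"
proof (induction n arbitrary: x y)
  case (Suc n)
  then obtain a t where a: "x = a + t" "a \<in> X" "t \<in> nsum X n" by (auto elim: set_plus_elim)
  from Suc obtain b s where b: "y = b + s" "b \<in> Y" "s \<in> nsum Y n" by (auto elim: set_plus_elim)
  have "x + y = (a + b) + (t + s)" using a b by (simp add: algebra_simps)
  also have "\<dots> \<in> (X + Y) + nsum (X + Y) n"
    using a b Suc.IH[of t s] by (intro set_plus_intro)
  finally show ?case by simp
qed simp

lemma nsum_mono: "X \<subseteq> Y \<Longrightarrow> nsum X n \<subseteq> nsum Y n"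
  by (induction n) (auto intro: set_plus_mono2[THEN subsetD])

lemma sp_power: "sp (g ^ n) \<subseteq> nsum (sp g) n"
proof (induction n)
  case (Suc n)
  have "sp (g ^ Suc n) \<subseteq> sp g + sp (g ^ n)" using sp_mult[of g "g ^ n"] by simp
  also have "\<dots> \<subseteq> nsum (sp g) (Suc n)" using Suc by (simp add: set_plus_mono2)
  finally show ?case .
qed simp

text \<open>\<open>Y\<close> bounds how far \<open>D\<close> moves exponents; \<open>n\<close>
  applications move them by elements of \<open>nsum Y n\<close>, which is what makes Taylor series
  graded.\<close>

locale hahn_derivation =
  fixes D :: "'a::linordered_ab_group_add hahn \<Rightarrow> 'a hahn" and Y :: "'a set"
  assumes D_add: "D (f + g) = D f + D g"
    and D_scaleR: "D (c *\<^sub>R f) = c *\<^sub>R D f"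
    and D_mult: "D (f * g) = D f * g + f * D g"
    and sp_D: "sp (D f) \<subseteq> sp f + Y"
    and wo_Y: "wo Y"
begin

text \<open>With divided derivatives the Leibniz rule becomes a plain convolution, and iteration
  produces exactly the binomial coefficients that the binomial theorem needs.\<close>

definition tay :: "nat \<Rightarrow> 'a hahn \<Rightarrow> 'a hahn" where
  "tay i f = (D ^^ i) f /\<^sub>R fact i"

text \<open>\<open>tcomp g f\<close> is the composition of \<open>f\<close> with identity plus \<open>g\<close>.\<close>

definition tcomp :: "'a hahn \<Rightarrow> 'a hahn \<Rightarrow> 'a hahn" where
  "tcomp g f = hsum (\<lambda>i. tay i f * g ^ i)"

text \<open>One more Taylor term means one more factor \<open>g\<close> and one more derivative,
  that is, a shift by an element of \<open>sp g + Y\<close>. Positivity of these shifts is the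
  hypothesis of Neumann's lemma.\<close>

definition small :: "'a hahn \<Rightarrow> bool" where
  "small g \<longleftrightarrow> (\<forall>s\<in>sp g + Y. 0 < s)"

lemma D_zero [simp]: "D 0 = 0"
  using D_scaleR[of 0 0] by simp

lemma D_sum: "D (sum F I) = (\<Sum>i\<in>I. D (F i))"
  by (induction I rule: infinite_finite_induct) (auto simp: D_add)

lemma D_one [simp]: "D 1 = 0"
  using D_mult[of 1 1] by simp

lemma D_power_add: "(D ^^ n) (f + g) = (D ^^ n) f + (D ^^ n) g"
  by (induction n) (auto simp: D_add)

lemma D_power_scaleR: "(D ^^ n) (c *\<^sub>R f) = c *\<^sub>R (D ^^ n) f"
  by (induction n) (auto simp: D_scaleR)

lemma tay_0 [simp]: "tay 0 f = f"
  by (simp add: tay_def)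

lemma tay_1 [simp]: "tay (Suc 0) f = D f"
  by (simp add: tay_def)

lemma tay_add: "tay i (f + g) = tay i f + tay i g"
  by (simp add: tay_def D_power_add scaleR_add_right)

lemma D_tay: "D (tay i f) = real (Suc i) *\<^sub>R tay (Suc i) f"
  by (simp add: tay_def D_scaleR del: of_nat_Suc)

lemma tay_tay: "tay j (tay i f) = of_nat ((i + j) choose i) * tay (i + j) f"
proof -
  have "tay j (tay i f) = (inverse (fact j) * inverse (fact i)) *\<^sub>R (D ^^ (i + j)) f"
    by (simp add: tay_def D_power_scaleR add.commute[of i j] funpow_add)
  moreover have "real ((i + j) choose i) = fact (i + j) / (fact i * fact j)"
    by (simp add: binomial_fact)
  moreover have "of_nat ((i + j) choose i) * tay (i + j) f = real ((i + j) choose i) *\<^sub>R tay (i + j) f"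
    by (simp add: scaleR_conv_of_real)
  ultimately show ?thesis by (simp add: tay_def field_simps)
qed

lemma tay_mult: "tay n (f * g) = (\<Sum>i\<le>n. tay i f * tay (n - i) g)"
proof (induction n)
  case (Suc n)
  define a where "a i = tay i f * tay (Suc n - i) g" for i
  have "D (\<Sum>i\<le>n. tay i f * tay (n - i) g) =
      (\<Sum>i\<le>n. real (Suc i) *\<^sub>R a (Suc i)) + (\<Sum>i\<le>n. real (Suc n - i) *\<^sub>R a i)"
    by (simp add: D_sum D_mult D_tay a_def sum.distrib Suc_diff_le)
  also have "(\<Sum>i\<le>n. real (Suc i) *\<^sub>R a (Suc i)) = (\<Sum>i\<le>Suc n. real i *\<^sub>R a i)"
    by (subst sum.atMost_Suc_shift) simp
  also have "(\<Sum>i\<le>n. real (Suc n - i) *\<^sub>R a i) = (\<Sum>i\<le>Suc n. real (Suc n - i) *\<^sub>R a i)"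
    by simp
  also have "(\<Sum>i\<le>Suc n. real i *\<^sub>R a i) + \<dots> = (\<Sum>i\<le>Suc n. real (Suc n) *\<^sub>R a i)"
    unfolding sum.distrib[symmetric]
    by (rule sum.cong) (auto simp: scaleR_add_left[symmetric] of_nat_diff simp del: of_nat_Suc)
  also have "\<dots> = real (Suc n) *\<^sub>R (\<Sum>i\<le>Suc n. a i)" by (rule scaleR_sum_right[symmetric])
  finally have "real (Suc n) *\<^sub>R tay (Suc n) (f * g) = real (Suc n) *\<^sub>R (\<Sum>i\<le>Suc n. a i)"
    using D_tay[of n "f * g"] Suc by simp
  then show ?case unfolding a_def by (subst (asm) scaleR_cancel_left) simp
qed simp

lemma sp_D_power: "sp ((D ^^ i) f) \<subseteq> sp f + nsum Y i"
proof (induction i)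
  case (Suc i)
  have "sp ((D ^^ Suc i) f) \<subseteq> sp ((D ^^ i) f) + Y" using sp_D by simp
  also have "\<dots> \<subseteq> (sp f + nsum Y i) + Y" using Suc by (simp add: set_plus_mono2)
  finally show ?case by (simp add: add_ac)
qed simp

lemma sp_tay: "sp (tay i f) \<subseteq> sp f + nsum Y i"
  using sp_D_power[of i f] sp_scaleR[of _ "(D ^^ i) f"] by (auto simp: tay_def)

lemma sp_tay_power: "sp (tay i f * g ^ i) \<subseteq> sp f + nsum (sp g + Y) i"
proof
  fix e assume "e \<in> sp (tay i f * g ^ i)"
  then obtain x y where e: "e = x + y" "x \<in> sp (tay i f)" "y \<in> sp (g ^ i)" by (rule sp_multE)
  then obtain a t where x: "x = a + t" "a \<in> sp f" "t \<in> nsum Y i"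
    using sp_tay[of i f] by (meson set_plus_elim subsetD)
  have "y + t \<in> nsum (sp g + Y) i" using e sp_power x nsum_set_plus by blast
  then show "e \<in> sp f + nsum (sp g + Y) i"
    using e x set_plus_intro[of a "sp f" "y + t" "nsum (sp g + Y) i"] by (simp add: algebra_simps)
qed

lemma wo_sp_plus_Y: "wo (sp g + Y)"
  by (simp add: wo_set_plus wo_Y)

lemma graded_comp: "small g \<Longrightarrow> graded (sp f) (sp g + Y) (\<lambda>i. tay i f * g ^ i)"
  unfolding graded_def small_def using sp_tay_power wo_sp_plus_Y by auto

section \<open>Composition from the right as a ring homomorphism\<close>

lemma comp_add:
  assumes "small g"
  shows "tcomp g (f1 + f2) = tcomp g f1 + tcomp g f2"
proof -
  have eq: "tay i (f1 + f2) * g ^ i = tay i f1 * g ^ i + tay i f2 * g ^ i" for i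
    by (simp add: tay_add algebra_simps)
  have "graded (sp (f1 + f2)) (sp g + Y) (\<lambda>i. tay i f1 * g ^ i + tay i f2 * g ^ i)"
    using graded_comp[OF assms, of "f1 + f2"] by (simp add: eq)
  from hsum_add[OF graded_comp[OF assms] graded_comp[OF assms] this]
  show ?thesis by (simp add: tcomp_def eq)
qed

lemma comp_zero [simp]: "small g \<Longrightarrow> tcomp g 0 = 0"
  using comp_add[of g 0 0] by simp

lemma comp_minus: "small g \<Longrightarrow> tcomp g (- f) = - tcomp g f"
  using comp_add[of g f "- f"] by (simp add: eq_neg_iff_add_eq_0 add.commute)

lemma comp_diff: "small g \<Longrightarrow> tcomp g (f1 - f2) = tcomp g f1 - tcomp g f2"
  using comp_add[of g f1 "- f2"] by (simp add: comp_minus)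

lemma sp_comp:
  assumes "small g"
  shows "sp (tcomp g f) \<subseteq> sp f + (\<Union>n. nsum (sp g + Y) n)"
proof
  fix e assume "e \<in> sp (tcomp g f)"
  then obtain i where "e \<in> sp (tay i f * g ^ i)"
    using sp_hsum[OF graded_comp[OF assms, of f]] by (auto simp: tcomp_def)
  then have "e \<in> sp f + nsum (sp g + Y) i" using sp_tay_power by blast
  then show "e \<in> sp f + (\<Union>n. nsum (sp g + Y) n)" by (auto simp: set_plus_def)
qed

lemma wo_Union_nsum_small: "small g \<Longrightarrow> wo (\<Union>n. nsum (sp g + Y) n)"
  by (rule wo_Union_nsum) (auto simp: wo_sp_plus_Y small_def)

text \<open>In the Cauchy product of the two Taylor series the powers of \<open>g\<close> on the
  \<open>n\<close>-th diagonal all combine to \<open>g ^ n\<close>, and \<open>tay_mult\<close> sums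
  up the remaining factors.\<close>

lemma comp_mult:
  assumes g: "small g"
  shows "tcomp g (f1 * f2) = tcomp g f1 * tcomp g f2"
proof -
  define F G where "F i = tay i f1 * g ^ i" and "G i = tay i f2 * g ^ i" for i
  have F: "graded (sp f1) (sp g + Y) F" and G: "graded (sp f2) (sp g + Y) G"
    unfolding F_def G_def using graded_comp[OF g] by blast+
  have "tcomp g f1 * tcomp g f2 = hsum (\<lambda>i. F i * hsum G)"
    using hsum_continuous[OF F wo_sp[of "hsum G"], of "\<lambda>f. f * hsum G", OF sp_mult]
    by (simp add: tcomp_def F_def[abs_def] G_def[abs_def] distrib_right)
  also have "(\<lambda>i. F i * hsum G) = (\<lambda>i. hsum (\<lambda>j. F i * G j))"
  proof
    show "F i * hsum G = hsum (\<lambda>j. F i * G j)" for i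
      using hsum_continuous[OF G wo_sp[of "F i"], of "\<lambda>f. f * F i", OF sp_mult distrib_right]
      by (simp add: mult.commute[of _ "F i"])
  qed
  also have "hsum \<dots> = hsum (\<lambda>n. \<Sum>i\<le>n. F i * G (n - i))"
  proof (rule hsum_diag[of "sp f1 + sp f2" "sp g + Y"])
    show "sp (F i * G j) \<subseteq> sp f1 + sp f2 + nsum (sp g + Y) (i + j)" for i j
    proof
      fix e assume "e \<in> sp (F i * G j)"
      then obtain x y where e: "e = x + y" "x \<in> sp (F i)" "y \<in> sp (G j)" by (rule sp_multE)
      from e(2) F obtain a s where a: "x = a + s" "a \<in> sp f1" "s \<in> nsum (sp g + Y) i"
        by (meson graded_def set_plus_elim subsetD)
      from e(3) G obtain b t where b: "y = b + t" "b \<in> sp f2" "t \<in> nsum (sp g + Y) j"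
        by (meson graded_def set_plus_elim subsetD)
      have "e = (a + b) + (s + t)" using a b e by (simp add: algebra_simps)
      then show "e \<in> sp f1 + sp f2 + nsum (sp g + Y) (i + j)"
        using a b nsum_add[OF a(3) b(3)] by (auto intro!: set_plus_intro)
    qed
  qed (use g wo_sp_plus_Y in \<open>auto simp: small_def wo_set_plus\<close>)
  also have "(\<lambda>n. \<Sum>i\<le>n. F i * G (n - i)) = (\<lambda>n. tay n (f1 * f2) * g ^ n)"
  proof
    fix n
    have "F i * G (n - i) = tay i f1 * tay (n - i) f2 * g ^ n" if "i \<le> n" for i
    proof -
      have "g ^ i * g ^ (n - i) = g ^ n" using that by (simp add: power_add[symmetric])
      moreover have "F i * G (n - i) = tay i f1 * tay (n - i) f2 * (g ^ i * g ^ (n - i))"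
        by (simp add: F_def G_def mult_ac)
      ultimately show ?thesis by simp
    qed
    then show "(\<Sum>i\<le>n. F i * G (n - i)) = tay n (f1 * f2) * g ^ n"
      by (simp add: tay_mult sum_distrib_right)
  qed
  finally show ?thesis by (simp add: tcomp_def)
qed

lemma tay_Suc_one [simp]: "tay (Suc i) 1 = 0"
  by (simp add: tay_def funpow_swap1) (induction i, auto)

lemma comp_one: "small g \<Longrightarrow> tcomp g 1 = 1"
proof -
  assume "small g"
  from graded_comp[OF this, of 1] have "coeff (hsum (\<lambda>i. tay i 1 * g ^ i)) e = (\<Sum>i<1. coeff (tay i 1 * g ^ i) e)" for e
  proof (rule coeff_hsum_finite)
    fix i :: nat assume "1 \<le> i"
    then show "coeff (tay i 1 * g ^ i) e = 0" by (cases i) auto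
  qed
  then show "tcomp g 1 = 1" by (auto simp: tcomp_def intro: hahn_eqI)
qed

lemma comp_power: "small g \<Longrightarrow> tcomp g (f ^ n) = tcomp g f ^ n"
  by (induction n) (auto simp: comp_one comp_mult)

lemma small_comp:
  assumes "small g" "small f"
  shows "small (tcomp g f)"
  unfolding small_def
proof
  fix s assume "s \<in> sp (tcomp g f) + Y"
  then obtain x y where x: "s = x + y" "x \<in> sp (tcomp g f)" "y \<in> Y" by (rule set_plus_elim)
  then obtain a t n where a: "x = a + t" "a \<in> sp f" "t \<in> nsum (sp g + Y) n"
    using sp_comp[OF assms(1), of f] by (auto simp: set_plus_def)
  have "0 \<le> t" using a assms(1) nsum_nonneg[of "sp g + Y" t n] by (auto simp: small_def)
  moreover have "0 < a + y" using assms(2) a x by (auto simp: small_def)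
  ultimately have "0 < (a + y) + t" by (rule add_pos_nonneg[rotated])
  then show "0 < s" using x a by (simp add: algebra_simps)
qed

text \<open>Composition with \<open>g2\<close> respects infinite sums and products, so it may be
  applied inside the Taylor series at \<open>g1\<close>. Expanding once more gives a double series
  in powers of \<open>g2\<close> and of \<open>c = tcomp g2 g1\<close>; by \<open>tay_tay\<close>
  and the binomial theorem its \<open>n\<close>-th diagonal is the Taylor term with
  \<open>(g2 + c) ^ n\<close>.\<close>

theorem comp_comp:
  assumes g1: "small g1" and g2: "small g2"
  shows "tcomp g2 (tcomp g1 f) = tcomp (g2 + tcomp g2 g1) f"
proof -
  define c where "c = tcomp g2 g1"
  have c: "small c" using small_comp[OF g2 g1] by (simp add: c_def)
  define S where "S = (sp g2 \<union> sp c) + Y"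
  have "S = (sp g2 + Y) \<union> (sp c + Y)" by (auto simp: S_def set_plus_def)
  then have S: "wo S" "\<forall>s\<in>S. 0 < s"
    using g2 c unfolding small_def by (auto intro: wo_Un wo_sp_plus_Y)
  define X where "X i j = tay j (tay i f) * g2 ^ j * c ^ i" for i j
  have T: "sp (tcomp g2 h) \<subseteq> sp h + (\<Union>n. nsum (sp g2 + Y) n)" for h by (rule sp_comp[OF g2])
  have "tcomp g2 (tcomp g1 f) = hsum (\<lambda>i. tcomp g2 (tay i f * g1 ^ i))"
    unfolding tcomp_def[of g1]
    by (rule hsum_continuous[OF graded_comp[OF g1] wo_Union_nsum_small[OF g2] T comp_add[OF g2]])
  also have "(\<lambda>i. tcomp g2 (tay i f * g1 ^ i)) = (\<lambda>i. hsum (X i))"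
  proof
    fix i
    have "tcomp g2 (tay i f * g1 ^ i) = tcomp g2 (tay i f) * c ^ i"
      by (simp add: comp_mult[OF g2] comp_power[OF g2] c_def)
    also have "\<dots> = hsum (\<lambda>j. tay j (tay i f) * g2 ^ j * c ^ i)"
      unfolding tcomp_def[of g2 "tay i f"]
      by (rule hsum_continuous[OF graded_comp[OF g2] wo_sp sp_mult]) (rule distrib_right)
    finally show "tcomp g2 (tay i f * g1 ^ i) = hsum (X i)" by (simp add: X_def[abs_def])
  qed
  also have "hsum (\<lambda>i. hsum (X i)) = hsum (\<lambda>n. \<Sum>i\<le>n. X i (n - i))"
  proof (rule hsum_diag[OF wo_sp[of f] S])
    show "sp (X i j) \<subseteq> sp f + nsum S (i + j)" for i j
    proof
      fix e assume "e \<in> sp (X i j)"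
      then obtain x y where e: "e = x + y" "x \<in> sp (tay j (tay i f) * g2 ^ j)" "y \<in> sp (c ^ i)"
        unfolding X_def by (rule sp_multE)
      from e(2) obtain v w where v: "x = v + w" "v \<in> sp (tay j (tay i f))" "w \<in> sp (g2 ^ j)"
        by (rule sp_multE)
      from v(2) obtain p q where p: "v = p + q" "p \<in> sp (tay i f)" "q \<in> nsum Y j"
        using sp_tay[of j "tay i f"] by (meson set_plus_elim subsetD)
      from p(2) obtain a r where a: "p = a + r" "a \<in> sp f" "r \<in> nsum Y i"
        using sp_tay[of i f] by (meson set_plus_elim subsetD)
      have "w \<in> nsum (sp g2 \<union> sp c) j" "y \<in> nsum (sp g2 \<union> sp c) i"
        using v(3) e(3) sp_power[of g2 j] sp_power[of c i] nsum_mono[of "sp g2" "sp g2 \<union> sp c" j]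
          nsum_mono[of "sp c" "sp g2 \<union> sp c" i] by blast+
      then have "(w + q) + (y + r) \<in> nsum S (j + i)"
        unfolding S_def using p(3) a(3) by (intro nsum_add nsum_set_plus)
      moreover have "e = a + ((w + q) + (y + r))" using e v p a by (simp add: algebra_simps)
      ultimately show "e \<in> sp f + nsum S (i + j)" using a(2) by (auto simp: add.commute[of i j])
    qed
  qed
  also have "(\<lambda>n. \<Sum>i\<le>n. X i (n - i)) = (\<lambda>n. tay n f * (g2 + c) ^ n)"
  proof
    fix n
    have "(\<Sum>i\<le>n. X i (n - i)) = (\<Sum>i\<le>n. tay n f * (of_nat (n choose i) * c ^ i * g2 ^ (n - i)))"
      by (rule sum.cong) (auto simp: X_def tay_tay mult_ac)
    also have "\<dots> = tay n f * (c + g2) ^ n"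
      by (simp add: binomial_ring sum_distrib_left)
    finally show "(\<Sum>i\<le>n. X i (n - i)) = tay n f * (g2 + c) ^ n" by (simp add: add.commute)
  qed
  finally show ?thesis by (simp add: tcomp_def[of "g2 + c"] c_def tcomp_def[of "g2 + tcomp g2 g1"])
qed

text \<open>Transfers any property common to the exponents of all late Taylor terms to the
  remainder; it is applied to lower bounds.\<close>

lemma sp_comp_remainder:
  assumes g: "small g" and P: "\<And>i x. N \<le> i \<Longrightarrow> x \<in> sp (tay i f * g ^ i) \<Longrightarrow> P x"
    and x: "x \<in> sp (tcomp g f - (\<Sum>i<N. tay i f * g ^ i))"
  shows "P x"
proof (rule ccontr)
  assume "\<not> P x"
  then have "coeff (tcomp g f) x = (\<Sum>i<N. coeff (tay i f * g ^ i) x)"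
    unfolding tcomp_def using P by (intro coeff_hsum_finite[OF graded_comp[OF g]]) (auto simp: in_sp)
  then show False using x by (simp add: in_sp)
qed

end

section \<open>Solving equations by transfinite successive approximation\<close>

text \<open>Candidates are extended one term at a time, each new term cancelling the leading term of
  the current error; Zorn's lemma replaces the transfinite recursion.\<close>

theorem hahn_approximation:
  fixes E :: "'a::linordered_ab_group_add hahn \<Rightarrow> 'a hahn"
    and S :: "'a set" and \<sigma> :: "'a \<Rightarrow> 'a" and M :: "'a \<Rightarrow> real"
  assumes mono: "\<And>s t. s \<in> S \<Longrightarrow> t \<in> S \<Longrightarrow> s < t \<Longrightarrow> \<sigma> s < \<sigma> t"
    and M: "\<And>s. s \<in> S \<Longrightarrow> M s \<noteq> 0"
    and incr: "\<And>\<psi> \<chi> s. sp \<psi> \<subseteq> S \<Longrightarrow> sp \<chi> \<subseteq> S \<Longrightarrow> s \<in> sp \<chi> \<Longrightarrow> (\<And>x. x \<in> sp \<chi> \<Longrightarrow> s \<le> x) \<Longrightarrow>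
      coeff (E (\<psi> + \<chi>) - E \<psi>) (\<sigma> s) = M s * coeff \<chi> s \<and> (\<forall>x\<in>sp (E (\<psi> + \<chi>) - E \<psi>). \<sigma> s \<le> x)"
  obtains \<psi> where "sp \<psi> \<subseteq> S"
    "\<And>t. t \<in> sp (E \<psi>) \<Longrightarrow> (\<And>x. x \<in> sp (E \<psi>) \<Longrightarrow> t \<le> x) \<Longrightarrow> t \<notin> \<sigma> ` S"
proof -
  \<comment> \<open>Demanding the bound for every truncation makes the property pass to unions of
    chains, since a truncation of the union is a truncation of some member.\<close>
  define F where "F \<psi> \<longleftrightarrow> sp \<psi> \<subseteq> S \<and> (\<forall>e\<in>sp \<psi>. \<forall>x\<in>sp (E (hrestrict {..e} \<psi>)). \<sigma> e < x)" for \<psi>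
  \<comment> \<open>End extension: new terms may occur only beyond all exponents of
    \<open>\<psi>\<close>.\<close>
  define P where "P \<psi> \<psi>' \<longleftrightarrow> (\<forall>x\<in>sp \<psi>. \<forall>y\<le>x. coeff \<psi>' y = coeff \<psi> y)" for \<psi> \<psi>' :: "'a hahn"
  define A where "A = {\<psi>. F \<psi>}"
  have refl: "P \<psi> \<psi>" for \<psi> by (simp add: P_def)
  have trans: "P \<psi> \<psi>''" if "P \<psi> \<psi>'" "P \<psi>' \<psi>''" for \<psi> \<psi>' \<psi>''
    unfolding P_def
  proof (intro ballI allI impI)
    fix x y assume x: "x \<in> sp \<psi>" and y: "y \<le> x"
    have "x \<in> sp \<psi>'" using that(1) x by (simp add: P_def in_sp)
    then show "coeff \<psi>'' y = coeff \<psi> y" using that x y by (simp add: P_def)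
  qed
  have antisym: "\<psi> = \<psi>'" if "P \<psi> \<psi>'" "P \<psi>' \<psi>" for \<psi> \<psi>'
  proof (rule hahn_eqI)
    fix x
    show "coeff \<psi> x = coeff \<psi>' x"
    proof (cases "x \<in> sp \<psi> \<or> x \<in> sp \<psi>'")
      case True
      then show ?thesis using that unfolding P_def by (metis order_refl)
    next
      case False
      then show ?thesis by (simp add: in_sp)
    qed
  qed
  have "\<exists>m\<in>A. \<forall>a\<in>A. P m a \<longrightarrow> a = m"
  proof (rule predicate_Zorn)
    show "partial_order_on A (relation_of P A)"
      using refl trans antisym by (intro partial_order_on_relation_ofI) blast+
  next
    fix C assume "C \<in> Chains (relation_of P A)"
    then have CA: "C \<subseteq> A"
      and chain: "\<And>\<psi> \<psi>'. \<psi> \<in> C \<Longrightarrow> \<psi>' \<in> C \<Longrightarrow> P \<psi> \<psi>' \<or> P \<psi>' \<psi>"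
      by (auto simp: Chains_def relation_of_def)
    define u where "u y = (if \<exists>\<psi>\<in>C. y \<in> sp \<psi> then coeff (SOME \<psi>. \<psi> \<in> C \<and> y \<in> sp \<psi>) y else 0)" for y
    have u: "u y = coeff \<psi> y" if "\<psi> \<in> C" "x \<in> sp \<psi>" "y \<le> x" for \<psi> x y
    proof (cases "\<exists>\<psi>\<in>C. y \<in> sp \<psi>")
      case True
      define \<psi>' where "\<psi>' = (SOME \<psi>. \<psi> \<in> C \<and> y \<in> sp \<psi>)"
      have \<psi>': "\<psi>' \<in> C \<and> y \<in> sp \<psi>'" unfolding \<psi>'_def by (rule someI_ex) (use True in blast)
      have "P \<psi> \<psi>' \<or> P \<psi>' \<psi>" using chain[OF that(1)] \<psi>' by blast
      then have "coeff \<psi>' y = coeff \<psi> y"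
      proof
        assume "P \<psi> \<psi>'"
        then show ?thesis using that by (simp add: P_def)
      next
        assume "P \<psi>' \<psi>"
        then have "coeff \<psi> y = coeff \<psi>' y" using \<psi>' unfolding P_def by blast
        then show ?thesis by simp
      qed
      then show ?thesis using True by (simp add: u_def \<psi>'_def)
    next
      case False
      then show ?thesis using that(1) by (auto simp: u_def in_sp)
    qed
    have uC: "\<exists>\<psi>\<in>C. y \<in> sp \<psi>" if "u y \<noteq> 0" for y using that by (auto simp: u_def split: if_splits)
    \<comment> \<open>Below any of its exponents the union coincides with a single member of the
      chain, so nonempty subsets have least elements.\<close>
    have wo: "wo {y. u y \<noteq> 0}"
      unfolding wo_def
    proof (intro allI impI)
      fix B assume B: "B \<subseteq> {y. u y \<noteq> 0}" "B \<noteq> {}"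
      then obtain b \<psi> where b: "b \<in> B" "\<psi> \<in> C" "b \<in> sp \<psi>" using uC by blast
      then have "B \<inter> {..b} \<subseteq> sp \<psi>" using u B by (fastforce simp: in_sp)
      from woD[OF wo_sp this] b(1) obtain m where "m \<in> B \<inter> {..b}" "\<forall>x\<in>B \<inter> {..b}. m \<le> x" by blast
      then show "\<exists>m\<in>B. \<forall>x\<in>B. m \<le> x"
        by (metis Int_iff atMost_iff linorder_linear order_trans)
    qed
    define U where "U = Hahn u"
    have U: "coeff U = u" using wo by (simp add: U_def coeff_Hahn)
    have PU: "P \<psi> U" if "\<psi> \<in> C" for \<psi> using that u by (simp add: P_def U)
    have restr: "\<exists>\<psi>\<in>C. e \<in> sp \<psi> \<and> hrestrict {..e} U = hrestrict {..e} \<psi>" if e: "e \<in> sp U" for e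
    proof -
      obtain \<psi> where \<psi>: "\<psi> \<in> C" "e \<in> sp \<psi>" using uC e by (auto simp: in_sp U)
      then have "hrestrict {..e} U = hrestrict {..e} \<psi>"
        using u by (auto intro!: hahn_eqI simp: coeff_restrict U)
      then show ?thesis using \<psi> by blast
    qed
    have "F U"
      unfolding F_def
    proof (intro conjI ballI subsetI)
      fix e assume "e \<in> sp U"
      then obtain \<psi> where "\<psi> \<in> C" "e \<in> sp \<psi>" using restr by blast
      then show "e \<in> S" using CA by (auto simp: A_def F_def)
    next
      fix e x assume e: "e \<in> sp U" and x: "x \<in> sp (E (hrestrict {..e} U))"
      obtain \<psi> where "\<psi> \<in> C" "e \<in> sp \<psi>" "hrestrict {..e} U = hrestrict {..e} \<psi>" using restr[OF e] by blast
      then show "\<sigma> e < x" using CA x by (auto simp: A_def F_def)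
    qed
    then show "\<exists>u\<in>A. \<forall>a\<in>C. P a u" using PU by (auto simp: A_def)
  qed
  then obtain \<psi> where F: "F \<psi>" and max: "\<And>\<psi>'. F \<psi>' \<Longrightarrow> P \<psi> \<psi>' \<Longrightarrow> \<psi>' = \<psi>" by (auto simp: A_def)
  have \<psi>S: "sp \<psi> \<subseteq> S" using F by (simp add: F_def)
  \<comment> \<open>The terms of \<open>\<psi>\<close> beyond \<open>e\<close> start at some
    \<open>s > e\<close> and change the error only from \<open>\<sigma> s\<close> on, so the bound
    known for the truncation survives.\<close>
  have above: "\<sigma> e < x" if e: "e \<in> sp \<psi>" and x: "x \<in> sp (E \<psi>)" for e x
  proof (cases "\<psi> - hrestrict {..e} \<psi> = 0")
    case True
    then show ?thesis using F e x by (auto simp: F_def)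
  next
    case False
    define \<chi> where "\<chi> = \<psi> - hrestrict {..e} \<psi>"
    have sp\<chi>: "x \<in> sp \<psi> \<and> e < x" if "x \<in> sp \<chi>" for x
      using that by (auto simp: \<chi>_def in_sp coeff_restrict split: if_splits)
    obtain s where s: "s \<in> sp \<chi>" "\<And>x. x \<in> sp \<chi> \<Longrightarrow> s \<le> x"
      using sp_least False by (metis \<chi>_def)
    have \<psi>: "hrestrict {..e} \<psi> + \<chi> = \<psi>" by (simp add: \<chi>_def)
    have diff: "\<sigma> s \<le> x" if "x \<in> sp (E \<psi> - E (hrestrict {..e} \<psi>))" for x
      using incr[of "hrestrict {..e} \<psi>" \<chi> s] s sp\<chi> \<psi>S that by (auto simp: \<psi>)
    have "\<sigma> e < \<sigma> s" using mono[of e s] e s sp\<chi> \<psi>S by blast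
    moreover have "x \<in> sp (E \<psi> - E (hrestrict {..e} \<psi>)) \<or> x \<in> sp (E (hrestrict {..e} \<psi>))"
      using x by (auto simp: in_sp)
    ultimately show ?thesis using diff F e by (fastforce simp: F_def)
  qed
  have "t \<notin> \<sigma> ` S" if t: "t \<in> sp (E \<psi>)" "\<And>x. x \<in> sp (E \<psi>) \<Longrightarrow> t \<le> x" for t
  proof
    assume "t \<in> \<sigma> ` S"
    then obtain s where s: "s \<in> S" "t = \<sigma> s" by blast
    have less: "e < s" if "e \<in> sp \<psi>" for e
    proof (rule ccontr)
      assume "\<not> e < s"
      moreover have "e \<in> S" using that \<psi>S by blast
      ultimately have "\<sigma> s \<le> \<sigma> e"
        using mono[OF s(1) \<open>e \<in> S\<close>] linorder_less_linear[of s e] by auto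
      then show False using above[OF that t(1)] s by simp
    qed
    \<comment> \<open>The value for which the increment of the error at
      \<open>t = \<sigma> s\<close> cancels its coefficient there.\<close>
    define c where "c = - coeff (E \<psi>) t / M s"
    have c: "c \<noteq> 0" using t(1) M[OF s(1)] by (simp add: c_def in_sp)
    define \<chi> where "\<chi> = c *\<^sub>R mon s"
    have \<chi>: "sp \<chi> = {s}" "coeff \<chi> s = c" using c by (auto simp: \<chi>_def sp_def coeff_mon)
    define \<psi>' where "\<psi>' = \<psi> + \<chi>"
    have inc: "coeff (E \<psi>' - E \<psi>) t = M s * c" "\<forall>x\<in>sp (E \<psi>' - E \<psi>). t \<le> x"
      using incr[of \<psi> \<chi> s] \<psi>S s \<chi> by (auto simp: \<psi>'_def)
    have new: "t < x" if "x \<in> sp (E \<psi>')" for x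
    proof -
      have "x \<in> sp (E \<psi>' - E \<psi>) \<or> x \<in> sp (E \<psi>)" using that by (auto simp: in_sp)
      then have "t \<le> x" using inc t by blast
      moreover have "coeff (E \<psi>') t = 0" using inc(1) M[OF s(1)] by (simp add: c_def)
      ultimately show ?thesis using that by (cases "x = t") (auto simp: in_sp)
    qed
    have s\<psi>: "s \<notin> sp \<psi>" using less by blast
    have \<psi>': "coeff \<psi>' x = (if x = s then c else coeff \<psi> x)" for x
      using s\<psi> by (auto simp: \<psi>'_def \<chi>_def coeff_mon in_sp)
    then have sp\<psi>': "sp \<psi>' = insert s (sp \<psi>)" using c by (auto simp: sp_def)
    have "F \<psi>'"
      unfolding F_def
    proof (intro conjI ballI)
      show "sp \<psi>' \<subseteq> S" using sp\<psi>' \<psi>S s by auto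
      fix e x assume e: "e \<in> sp \<psi>'" and x: "x \<in> sp (E (hrestrict {..e} \<psi>'))"
      show "\<sigma> e < x"
      proof (cases "e = s")
        case True
        have "coeff \<psi> x = 0" if "s < x" for x
          using less[of x] that by (metis in_sp less_asym)
        then have "hrestrict {..e} \<psi>' = \<psi>'"
          using True by (intro hahn_eqI) (auto simp: coeff_restrict \<psi>')
        then show ?thesis using new x s True by simp
      next
        case False
        then have e': "e \<in> sp \<psi>" using e sp\<psi>' by simp
        have "hrestrict {..e} \<psi>' = hrestrict {..e} \<psi>"
          using less[OF e'] by (intro hahn_eqI) (auto simp: coeff_restrict \<psi>')
        then show ?thesis using F x e' by (auto simp: F_def)
      qed
    qed
    moreover have "P \<psi> \<psi>'" using less by (fastforce simp: P_def \<psi>')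
    ultimately have "\<psi>' = \<psi>" by (rule max)
    then show False using sp\<psi>' s\<psi> by blast
  qed
  then show thesis using that \<psi>S by blast
qed

section \<open>Exponents\<close>

text \<open>Index 0 is the exponent of \<open>z\<close>, regarded as \<open>\<ell>(0)\<close>, so
  that \<open>z\<close> and the logarithms are treated alike.\<close>

definition cp :: "nat \<Rightarrow> expo \<Rightarrow> real" where
  "cp j e = (case j of 0 \<Rightarrow> fst e | Suc i \<Rightarrow> real_of_int (Poly_Mapping.lookup (snd e) i))"

text \<open>The exponent of \<open>\<ell>(1) \<cdots> \<ell>(j)\<close>, the factor that
  \<open>z d/dz\<close> puts in front of a nontrivial power of \<open>\<ell>(j)\<close>, up to a
  constant.\<close>

definition dl :: "nat \<Rightarrow> expo" where
  "dl j = (0, ones j)"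

text \<open>The index of the first nonzero entry; only meaningful for \<open>e \<noteq> 0\<close>.\<close>

definition ht :: "expo \<Rightarrow> nat" where
  "ht e = (LEAST j. cp j e \<noteq> 0)"

lemma cp_0: "cp 0 e = fst e" and cp_Suc: "cp (Suc i) e = real_of_int (Poly_Mapping.lookup (snd e) i)"
  by (simp_all add: cp_def)

lemma cp_add [simp]: "cp j (a + b) = cp j a + cp j b"
  and cp_minus [simp]: "cp j (- a) = - cp j a"
  and cp_diff [simp]: "cp j (a - b) = cp j a - cp j b"
  and cp_zero [simp]: "cp j 0 = 0"
  by (auto simp: cp_def lookup_add lookup_minus split: nat.split)

lemma expo_eqI: "(\<And>j. cp j a = cp j b) \<Longrightarrow> a = b"
proof -
  assume *: "\<And>j. cp j a = cp j b"
  have "fst a = fst b" using *[of 0] by (simp add: cp_0)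
  moreover have "snd a = snd b" using *[of "Suc _"] by (auto intro!: poly_mapping_eqI simp: cp_Suc)
  ultimately show "a = b" by (rule prod_eqI)
qed

lemma lookup_ones: "Poly_Mapping.lookup (ones j) i = (if i < j then 1 else 0)"
proof -
  have "Poly_Mapping.lookup (ones j) i = (\<Sum>m<j. if m = i then 1 else 0)"
    by (auto simp: ones_def lookup_sum lookup_single when_def intro!: sum.cong)
  then show ?thesis by simp
qed

lemma cp_dl: "cp i (dl j) = (if 1 \<le> i \<and> i \<le> j then 1 else 0)"
  by (cases i) (auto simp: cp_def dl_def lookup_ones)

lemma cp_pos_ge_1: "0 < cp j e \<Longrightarrow> 1 \<le> j \<Longrightarrow> 1 \<le> cp j e"
  by (cases j) (auto simp: cp_def)

lemma finite_cp: "\<exists>N. \<forall>j>N. cp j e = 0"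
proof -
  have "finite (Poly_Mapping.keys (snd e))" by simp
  then obtain N where "\<forall>i\<in>Poly_Mapping.keys (snd e). i < N" by (meson finite_nat_set_iff_bounded)
  then have "cp j e = 0" if "j > N" for j
  proof (cases j)
    case (Suc i)
    then have "i \<notin> Poly_Mapping.keys (snd e)" using \<open>\<forall>i\<in>_. i < N\<close> that by auto
    then show ?thesis using Suc by (simp add: cp_Suc in_keys_iff)
  qed (use that in auto)
  then show ?thesis by blast
qed

lemma expo_less_iff: "a < b \<longleftrightarrow> (\<exists>j. cp j a < cp j b \<and> (\<forall>i<j. cp i a = cp i b))"
proof
  assume "a < b"
  then consider "fst a < fst b" | "fst a = fst b" "snd a < snd b"
    by (auto simp: less_prod_def')
  then show "\<exists>j. cp j a < cp j b \<and> (\<forall>i<j. cp i a = cp i b)"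
  proof cases
    case 1
    then show ?thesis by (intro exI[of _ 0]) (simp add: cp_0)
  next
    case 2
    then obtain k where "Poly_Mapping.lookup (snd a) k < Poly_Mapping.lookup (snd b) k"
      "\<forall>i<k. Poly_Mapping.lookup (snd a) i = Poly_Mapping.lookup (snd b) i"
      by (auto simp: less_poly_mapping.rep_eq less_fun_def)
    then show ?thesis using 2 by (intro exI[of _ "Suc k"]) (auto simp: cp_def split: nat.split)
  qed
next
  assume "\<exists>j. cp j a < cp j b \<and> (\<forall>i<j. cp i a = cp i b)"
  then obtain j where j: "cp j a < cp j b" "\<And>i. i < j \<Longrightarrow> cp i a = cp i b" by blast
  show "a < b"
  proof (cases j)
    case 0
    then show ?thesis using j by (simp add: cp_0 less_prod_def')
  next
    case (Suc k)
    then have "Poly_Mapping.lookup (snd a) k < Poly_Mapping.lookup (snd b) k"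
      "\<And>i. i < k \<Longrightarrow> Poly_Mapping.lookup (snd a) i = Poly_Mapping.lookup (snd b) i"
      using j(1) j(2)[of "Suc _"] by (auto simp: cp_Suc)
    then have "snd a < snd b" by (auto simp: less_poly_mapping.rep_eq less_fun_def)
    moreover have "fst a = fst b" using j(2)[of 0] Suc by (simp add: cp_0)
    ultimately show ?thesis by (simp add: less_prod_def')
  qed
qed

lemma cp_below_ht: "i < ht e \<Longrightarrow> cp i e = 0"
  unfolding ht_def using not_less_Least by blast

lemma cp_ht: "e \<noteq> 0 \<Longrightarrow> cp (ht e) e \<noteq> 0"
  unfolding ht_def by (metis (mono_tags, lifting) LeastI cp_zero expo_eqI)

lemma ht_le: "cp j e \<noteq> 0 \<Longrightarrow> ht e \<le> j"
  unfolding ht_def by (rule Least_le)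

lemma ht_eqI: "cp j e \<noteq> 0 \<Longrightarrow> (\<And>i. i < j \<Longrightarrow> cp i e = 0) \<Longrightarrow> ht e = j"
  unfolding ht_def by (rule Least_equality) (auto simp: not_less[symmetric])

lemma ht_minus [simp]: "ht (- e) = ht e"
  by (simp add: ht_def)

lemma ht_diff_commute: "ht (a - b) = ht (b - a)"
  using ht_minus[of "a - b"] by simp

lemma ht_add: "a + b \<noteq> 0 \<Longrightarrow> min (ht a) (ht b) \<le> ht (a + b)"
  using cp_ht[of "a + b"] cp_below_ht[of "ht (a + b)" a] cp_below_ht[of "ht (a + b)" b]
  by (auto simp: min_def not_le[symmetric] intro: ccontr)

lemma ht_add_less: "a \<noteq> 0 \<Longrightarrow> ht a < ht b \<Longrightarrow> ht (a + b) = ht a"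
  by (rule ht_eqI) (auto simp: cp_ht cp_below_ht)

lemma cp_ht_pos: "0 < e \<Longrightarrow> 0 < cp (ht e) e"
proof -
  assume "0 < e"
  then obtain j where j: "0 < cp j e" "\<forall>i<j. cp i e = 0" by (auto simp: expo_less_iff)
  then have "ht e = j" by (intro ht_eqI) auto
  then show ?thesis using j by simp
qed

text \<open>Among positive exponents, one whose first nonzero entry comes earlier is larger;
  \<open>ht\<close> thus measures how infinitesimal an exponent is.\<close>

lemma ht_antimono: "0 < a \<Longrightarrow> a \<le> b \<Longrightarrow> ht b \<le> ht a"
proof (rule ccontr)
  assume a: "0 < a" "a \<le> b" "\<not> ht b \<le> ht a"
  have "b < a"
    unfolding expo_less_iff
    using a(3) cp_ht_pos[OF a(1)] by (intro exI[of _ "ht a"]) (auto simp: cp_below_ht)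
  then show False using a by simp
qed

lemma dl_strict_mono: "i < j \<Longrightarrow> dl i < dl j"
  unfolding expo_less_iff by (intro exI[of _ "Suc i"]) (auto simp: cp_dl)

lemma dl_mono: "i \<le> j \<Longrightarrow> dl i \<le> dl j"
  using dl_strict_mono[of i j] by (cases "i = j") auto

lemma dl_nonneg: "0 \<le> dl j"
  using dl_mono[of 0 j] by (simp add: dl_def ones_def zero_prod_def)

lemma dl_eq_iff: "dl i = dl j \<longleftrightarrow> i = j"
  using dl_strict_mono by (metis less_irrefl linorder_neqE_nat)

lemma dl_0 [simp]: "dl 0 = 0"
  by (simp add: dl_def ones_def zero_prod_def)

text \<open>The exponents with \<open>dl (ht e)\<close> form an asymptotic couple of H-type with small derivation:
  \<open>dl (ht e)\<close> is the order of the logarithmic derivative \<open>z f' / f\<close> of a monomial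
  \<open>f\<close> with exponent \<open>e \<noteq> 0\<close>.\<close>

lemma dl_less: "0 < e \<Longrightarrow> dl j < e + dl (ht e)"
proof -
  assume e: "0 < e"
  define m where "m = min (Suc j) (ht e)"
  have "cp m (dl j) < cp m (e + dl (ht e))"
  proof (cases "Suc j < ht e")
    case True
    then show ?thesis using cp_below_ht[of m e] by (simp add: m_def min_def cp_dl)
  next
    case False
    then show ?thesis
      using cp_ht_pos[OF e] cp_pos_ge_1[of "ht e" e] by (auto simp: m_def min_def cp_dl)
  qed
  moreover have "cp i (dl j) = cp i (e + dl (ht e))" if "i < m" for i
    using that cp_below_ht[of i e] by (auto simp: m_def cp_dl)
  ultimately show ?thesis unfolding expo_less_iff by blast
qed

text \<open>The order of a derivative increases with the order of the function. When
  \<open>dl (ht a)\<close> exceeds \<open>dl (ht b)\<close>, the loss is outweighed by the gain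
  \<open>b - a\<close>, by \<open>dl_less\<close> applied to that difference.\<close>

lemma add_dl_strict_mono:
  assumes "a < b" "a \<noteq> 0" "b \<noteq> 0"
  shows "a + dl (ht a) < b + dl (ht b)"
proof (cases "ht a \<le> ht b")
  case True
  then show ?thesis using assms dl_mono by (intro add_less_le_mono)
next
  case False
  have "min (ht a) (ht (b - a)) \<le> ht b" using ht_add[of a "b - a"] assms by simp
  then have "dl (ht (b - a)) \<le> dl (ht b)" using False by (intro dl_mono) auto
  moreover have "dl (ht a) < (b - a) + dl (ht (b - a))" using assms by (intro dl_less) simp
  ultimately have "dl (ht a) < (b - a) + dl (ht b)" by (meson add_left_mono less_le_trans)
  then show ?thesis by (simp add: algebra_simps)
qed

lemma add_dl_mono: "a \<le> b \<Longrightarrow> a \<noteq> 0 \<Longrightarrow> b \<noteq> 0 \<Longrightarrow> a + dl (ht a) \<le> b + dl (ht b)"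
  using add_dl_strict_mono[of a b] by (cases "a = b") (auto intro: less_imp_le)

text \<open>Asymptotic integration. Take the first \<open>j \<ge> 1\<close> at which the entry of
  \<open>y\<close> is not 1: subtracting \<open>dl j\<close> clears the entries before
  \<open>j\<close> and leaves a nonzero one at \<open>j\<close>. For \<open>y = dl k\<close> this
  gives \<open>j = k + 1\<close> with entry \<open>-1\<close>, an inverse power of the next
  logarithm.\<close>

lemma add_dl_surj: "\<exists>a. a \<noteq> 0 \<and> a + dl (ht a) = y"
proof (cases "cp 0 y = 0")
  case False
  then have "ht y = 0" by (intro ht_eqI) auto
  then show ?thesis using False by (intro exI[of _ y]) auto
next
  case True
  obtain N where "\<forall>j>N. cp j y = 0" using finite_cp by blast
  then have "1 \<le> Suc N \<and> cp (Suc N) y \<noteq> 1" by auto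
  then have ex: "\<exists>j. 1 \<le> j \<and> cp j y \<noteq> 1" by blast
  define j where "j = (LEAST j. 1 \<le> j \<and> cp j y \<noteq> 1)"
  have j: "1 \<le> j" "cp j y \<noteq> 1" using LeastI_ex[OF ex] by (auto simp: j_def)
  have below: "cp i y = 1" if "i < j" "1 \<le> i" for i
    using not_less_Least[of i "\<lambda>j. 1 \<le> j \<and> cp j y \<noteq> 1"] that by (auto simp: j_def)
  have "cp j (y - dl j) \<noteq> 0" using j by (simp add: cp_dl)
  moreover have "cp i (y - dl j) = 0" if "i < j" for i
    using that True below[of i] by (cases i) (auto simp: cp_dl)
  ultimately have "ht (y - dl j) = j" by (intro ht_eqI) auto
  then show ?thesis using \<open>cp j (y - dl j) \<noteq> 0\<close> by (intro exI[of _ "y - dl j"]) auto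
qed

text \<open>Off the diagonal the expression is \<open>y + y\<close> plus
  \<open>(x - y) + dl (ht (x - y))\<close>, hence strictly increasing in \<open>x\<close> and by
  symmetry in \<open>y\<close>. It will be the order of the Wronskian of two monomials, up to the
  shift by \<open>uu\<close>.\<close>

lemma pair_dl_mono:
  assumes "c \<le> x" "b \<le> y" "x \<noteq> y" "c \<noteq> b"
  shows "c + b + dl (ht (c - b)) \<le> x + y + dl (ht (x - y))"
    and "c + b + dl (ht (c - b)) = x + y + dl (ht (x - y)) \<Longrightarrow> x = c \<and> y = b"
proof -
  define F where "F x y = x + y + dl (ht (x - y))" for x y
  have comm: "F x y = F y x" for x y by (simp add: F_def add.commute ht_diff_commute)
  have X: "F c y < F x y" if "c < x" "c \<noteq> y" "x \<noteq> y" for c x y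
  proof -
    have "y + y + (c - y + dl (ht (c - y))) < y + y + (x - y + dl (ht (x - y)))"
      using that by (intro add_strict_left_mono add_dl_strict_mono) auto
    then show ?thesis by (simp add: F_def algebra_simps)
  qed
  have Y: "F x b < F x y" if "b < y" "b \<noteq> x" "x \<noteq> y" for b x y
    using X[of b y x] that comm by simp
  have "F c b \<le> F x y \<and> (F c b = F x y \<longrightarrow> x = c \<and> y = b)"
  proof (cases "c = y")
    case False
    have "b = y \<or> F c b < F c y"
      using Y[of b y c] assms False by (auto simp: order.order_iff_strict)
    moreover have "c = x \<or> F c y < F x y"
      using X[of c x y] assms False by (auto simp: order.order_iff_strict)
    ultimately show ?thesis by (auto intro: less_imp_le dest: less_trans)
  next
    case True
    then have "c < x" "b < y" "b \<noteq> x" using assms by auto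
    then have "F c b < F x b" "F x b < F x y" using X[of c x b] Y[of b y x] assms by auto
    then show ?thesis by auto
  qed
  then show "c + b + dl (ht (c - b)) \<le> x + y + dl (ht (x - y))"
    and "c + b + dl (ht (c - b)) = x + y + dl (ht (x - y)) \<Longrightarrow> x = c \<and> y = b"
    by (auto simp: F_def)
qed

section \<open>The derivation on series of bounded depth\<close>

text \<open>The Euler operator of the variable \<open>\<ell>(j)\<close>, with
  \<open>\<ell>(0) = z\<close>.\<close>

lift_definition kap :: "nat \<Rightarrow> expo hahn \<Rightarrow> expo hahn" is "\<lambda>j f e. cp j e * f e"
  by (erule wo_subset) auto

lemma coeff_kap: "coeff (kap j f) e = cp j e * coeff f e"
  by (rule kap.rep_eq[THEN fun_cong])

lemma in_sp_kap: "e \<in> sp (kap j f) \<longleftrightarrow> e \<in> sp f \<and> cp j e \<noteq> 0"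
  by (auto simp: in_sp coeff_kap)

lemma kap_mult: "kap j (f * g) = kap j f * g + f * kap j g"
proof (rule hahn_eqI)
  fix e
  have [simp]: "sp (kap j f) \<subseteq> sp f" for f by (auto simp: in_sp_kap)
  have wo: "wo (sp f)" "wo (sp g)" by auto
  show "coeff (kap j (f * g)) e = coeff (kap j f * g + f * kap j g) e"
    unfolding coeff_kap coeff_simps
    by (subst (1 2 3) coeff_times_superset[OF wo])
      (auto simp: coeff_kap sum_distrib_left sum.distrib[symmetric] algebra_simps intro!: sum.cong)
qed

definition uu :: expo where "uu = (1, 0)"

text \<open>This is \<open>d/dz\<close> with all logarithms beyond \<open>\<ell>(K)\<close> treated
  as constants. It is therefore a derivation on all Hahn series, and agrees with the given one on
  series of depth at most \<open>K\<close>.\<close>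

definition der :: "nat \<Rightarrow> expo hahn \<Rightarrow> expo hahn" where
  "der K f = (\<Sum>j\<le>K. mon (dl j - uu) * kap j f)"

definition dshift :: "nat \<Rightarrow> expo set" where
  "dshift K = (\<lambda>j. dl j - uu) ` {..K}"

lemma coeff_der: "coeff (der K f) e = (\<Sum>j\<le>K. cp j (e - (dl j - uu)) * coeff f (e - (dl j - uu)))"
  by (simp add: der_def coeff_times_mon coeff_kap)

lemma sp_derE:
  assumes "x \<in> sp (der K f)"
  obtains e j where "e \<in> sp f" "j \<le> K" "cp j e \<noteq> 0" "x = e + dl j - uu"
proof -
  from assms obtain j where j: "j \<le> K" "cp j (x - (dl j - uu)) * coeff f (x - (dl j - uu)) \<noteq> 0"
    unfolding in_sp coeff_der by (meson atMost_iff sum.not_neutral_contains_not_neutral)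
  show thesis by (rule that[of "x - (dl j - uu)" j]) (use j in \<open>auto simp: in_sp\<close>)
qed

interpretation der: hahn_derivation "der K" "dshift K" for K
proof
  fix f g :: "expo hahn" and c :: real
  show "der K (f + g) = der K f + der K g"
    by (rule hahn_eqI) (simp add: coeff_der sum.distrib distrib_left)
  show "der K (c *\<^sub>R f) = c *\<^sub>R der K f"
    by (rule hahn_eqI) (simp add: coeff_der sum_distrib_left mult_ac)
  show "der K (f * g) = der K f * g + f * der K g"
    by (simp add: der_def kap_mult sum_distrib_left sum_distrib_right distrib_left sum.distrib mult_ac)
  show "sp (der K f) \<subseteq> sp f + dshift K"
  proof
    fix x assume "x \<in> sp (der K f)"
    then obtain e j where "e \<in> sp f" "j \<le> K" "x = e + (dl j - uu)" by (auto elim!: sp_derE)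
    then show "x \<in> sp f + dshift K" by (auto simp: dshift_def)
  qed
  show "wo (dshift K)" by (auto simp: dshift_def intro: wo_finite)
qed

abbreviation tcomp :: "nat \<Rightarrow> expo hahn \<Rightarrow> expo hahn \<Rightarrow> expo hahn" where
  "tcomp K \<equiv> der.tcomp K"

text \<open>Of the shifts in \<open>dshift K\<close> the least is \<open>- uu\<close>, because
  \<open>dl 0 = 0\<close> is the least of the \<open>dl j\<close>.\<close>

lemma small_iff: "der.small K g \<longleftrightarrow> (\<forall>x\<in>sp g. uu < x)"
proof
  assume *: "der.small K g"
  show "\<forall>x\<in>sp g. uu < x"
  proof
    fix x assume "x \<in> sp g"
    moreover have "- uu \<in> dshift K" by (auto simp: dshift_def intro!: image_eqI[of _ _ 0])
    ultimately have "x + - uu \<in> sp g + dshift K" by (rule set_plus_intro)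
    then have "0 < x + - uu" using * by (auto simp: der.small_def)
    then show "uu < x" by simp
  qed
next
  assume *: "\<forall>x\<in>sp g. uu < x"
  have "0 < x + (dl j - uu)" if "x \<in> sp g" for x j
  proof -
    have "0 < (x - uu) + dl j" using * that dl_nonneg by (intro add_pos_nonneg) auto
    then show ?thesis by (simp add: algebra_simps)
  qed
  then show "der.small K g" by (auto simp: der.small_def) (auto simp: dshift_def elim!: set_plus_elim)
qed

definition zz :: "expo hahn" where "zz = mon uu"

lemma cp_uu: "cp j uu = (if j = 0 then 1 else 0)"
  by (auto simp: cp_def uu_def split: nat.split)

lemma der_zz [simp]: "der K zz = 1"
proof (rule hahn_eqI)
  fix e
  have "coeff (der K zz) e = (\<Sum>j\<le>K. if j = 0 then (if e = 0 then 1 else 0) else 0)"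
    unfolding coeff_der by (rule sum.cong) (auto simp: zz_def coeff_mon cp_uu)
  then show "coeff (der K zz) e = coeff 1 e" by (simp add: one_hahn_def coeff_mon)
qed

lemma comp_zz: "der.small K g \<Longrightarrow> tcomp K g zz = zz + g"
proof -
  assume "der.small K g"
  from der.graded_comp[OF this, of zz]
  have "coeff (hsum (\<lambda>i. der.tay K i zz * g ^ i)) e = (\<Sum>i<2. coeff (der.tay K i zz * g ^ i) e)" for e
  proof (rule coeff_hsum_finite)
    fix i :: nat assume "2 \<le> i"
    then obtain n where "i = Suc (Suc n)" by (metis Suc_diff_Suc Suc_le_D add_2_eq_Suc le_add_diff_inverse)
    moreover have "(der K ^^ Suc (Suc n)) zz = 0"
      by (induction n) auto
    ultimately show "coeff (der.tay K i zz * g ^ i) e = 0" by (simp add: der.tay_def del: funpow.simps)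
  qed
  then show "tcomp K g zz = zz + g"
    by (auto simp: der.tcomp_def numeral_2_eq_2 intro: hahn_eqI)
qed

lemma comp_zz_plus: "der.small K g \<Longrightarrow> tcomp K g (zz + f) = zz + (g + tcomp K g f)"
  by (simp add: der.comp_add comp_zz add.assoc)

section \<open>Order estimates\<close>

text \<open>Lower bounds are used in place of orders because they hold vacuously for the zero series
  and survive cancellation.\<close>

definition lb :: "'a::linorder hahn \<Rightarrow> 'a \<Rightarrow> bool" where
  "lb f c \<longleftrightarrow> (\<forall>x\<in>sp f. c \<le> x)"

definition slb :: "'a::linorder hahn \<Rightarrow> 'a \<Rightarrow> bool" where
  "slb f c \<longleftrightarrow> (\<forall>x\<in>sp f. c < x)"

lemma slb_imp_lb: "slb f c \<Longrightarrow> lb f c"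
  by (auto simp: lb_def slb_def less_imp_le)

lemma lb_mono: "lb f c \<Longrightarrow> b \<le> c \<Longrightarrow> lb f b"
  and slb_mono: "slb f c \<Longrightarrow> b \<le> c \<Longrightarrow> slb f b"
  and slb_lb_mono: "lb f c \<Longrightarrow> b < c \<Longrightarrow> slb f b"
  by (force simp: lb_def slb_def)+

lemma lb_add: "lb f c \<Longrightarrow> lb g c \<Longrightarrow> lb (f + g) c"
  and slb_add: "slb f c \<Longrightarrow> slb g c \<Longrightarrow> slb (f + g) c" and slb_diff: "slb f c \<Longrightarrow> slb g c \<Longrightarrow> slb (f - g) c"
  using sp_add[of f g] sp_diff[of f g] by (auto simp: lb_def slb_def)

lemma lb_scaleR: "lb f c \<Longrightarrow> lb (a *\<^sub>R f) c"
  using sp_scaleR[of a f] by (auto simp: lb_def)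

lemma lb_sum: "(\<And>i. i \<in> I \<Longrightarrow> lb (F i) c) \<Longrightarrow> lb (sum F I) c"
  and slb_sum: "(\<And>i. i \<in> I \<Longrightarrow> slb (F i) c) \<Longrightarrow> slb (sum F I) c"
  using sp_sum[of F I] by (fastforce simp: lb_def slb_def)+

lemma lb_mult: "lb f a \<Longrightarrow> lb g b \<Longrightarrow> lb (f * g) (a + b)"
  and slb_lb_mult: "slb f a \<Longrightarrow> lb g b \<Longrightarrow> slb (f * g) (a + b)"
  and lb_slb_mult: "lb f a \<Longrightarrow> slb g b \<Longrightarrow> slb (f * g) (a + b)"
  for f :: "'a::linordered_ab_group_add hahn"
  by (auto simp: lb_def slb_def elim!: sp_multE intro: add_mono add_less_le_mono add_le_less_mono)

lemma coeff_below: "slb f c \<Longrightarrow> coeff f c = 0"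
  by (auto simp: slb_def in_sp)

definition nu :: "nat \<Rightarrow> expo" where "nu n = (real n, 0)"

lemma nu_0 [simp]: "nu 0 = 0" and nu_Suc: "nu (Suc n) = uu + nu n" and nu_add: "nu (m + n) = nu m + nu n"
  by (auto simp: nu_def uu_def zero_prod_def)

lemma lb_power: "lb g uu \<Longrightarrow> lb (g ^ n) (nu n)"
proof (induction n)
  case (Suc n)
  then show ?case using lb_mult[of g uu "g ^ n" "nu n"] by (simp add: nu_Suc)
qed (simp add: lb_def)

lemma lb_der: "lb f c \<Longrightarrow> lb (der K f) (c - uu)"
  unfolding lb_def
proof
  fix x assume *: "\<forall>x\<in>sp f. c \<le> x" "x \<in> sp (der K f)"
  then obtain e j where e: "e \<in> sp f" "x = e + dl j - uu" by (auto elim!: sp_derE)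
  then have "c + 0 \<le> e + dl j" using * dl_nonneg by (intro add_mono) auto
  then show "c - uu \<le> x" using e by simp
qed

lemma lb_der_power: "lb f c \<Longrightarrow> lb ((der K ^^ n) f) (c - nu n)"
proof (induction n)
  case (Suc n)
  then show ?case using lb_der[of "(der K ^^ n) f" "c - nu n" K] by (simp add: nu_Suc diff_diff_eq add.commute)
qed simp

text \<open>A term at \<open>e\<close> contributes to the derivative only for indices
  \<open>j \<ge> ht e\<close>, so its contributions start at \<open>e + dl (ht e) - uu\<close> or
  later, and this is monotone in \<open>e\<close>.\<close>

lemma lb_der_pos:
  assumes "lb P q" "0 < q"
  shows "lb (der K P) (q + dl (ht q) - uu)"
  unfolding lb_def
proof
  fix x assume "x \<in> sp (der K P)"
  then obtain e j where e: "e \<in> sp P" "x = e + dl j - uu" "cp j e \<noteq> 0" by (auto elim!: sp_derE)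
  have "q \<le> e" using assms e by (auto simp: lb_def)
  then have "q + dl (ht q) \<le> e + dl (ht e)" using assms by (intro add_dl_mono) auto
  also have "\<dots> \<le> e + dl j" using e by (intro add_left_mono dl_mono ht_le)
  finally show "q + dl (ht q) - uu \<le> x" using e by simp
qed

text \<open>Since \<open>z\<close> has vanishing second derivative, the estimate improves on \<open>lb_der_power\<close> by the
  order of the logarithmic derivative of \<open>z^q\<close>.\<close>

lemma lb_tay_ge2:
  assumes f: "lb f (uu + q)" and q: "0 < q" and n: "2 \<le> n"
  shows "lb (der.tay K n f) (uu + q - nu n + dl (ht q))"
proof -
  define P where "P = mon (- uu) * f"
  have P: "lb P q" using lb_mult[of "mon (- uu)" "- uu" f "uu + q"] f by (simp add: P_def lb_def)
  have f_eq: "f = zz * P" by (simp add: P_def zz_def mult.assoc[symmetric] mon_mult one_hahn_def[symmetric] del: add_uminus_conv_diff)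
  define c where "c = q + dl (ht q) - uu"
  have dP: "lb (der K P) c" unfolding c_def by (rule lb_der_pos[OF P q])
  have "der K (der K f) = der K P + der K P + zz * der K (der K P)"
    by (simp add: f_eq der.D_mult der.D_add)
  moreover have "lb (zz * der K (der K P)) (uu + (c - uu))"
    by (intro lb_mult lb_der dP) (simp add: lb_def zz_def)
  then have "lb (zz * der K (der K P)) c" by simp
  ultimately have 2: "lb (der K (der K f)) c" using dP by (metis lb_add)
  obtain m where m: "n = m + 2" using n by (metis add.commute le_Suc_ex)
  have "lb ((der K ^^ m) (der K (der K f))) (c - nu m)" by (rule lb_der_power[OF 2])
  moreover have "(der K ^^ n) f = (der K ^^ m) (der K (der K f))"
    unfolding m funpow_add by (simp add: numeral_2_eq_2)
  moreover have "c - nu m = uu + q - nu n + dl (ht q)"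
    by (simp add: c_def m nu_add numeral_2_eq_2 nu_Suc)
  ultimately show ?thesis by (simp add: der.tay_def lb_scaleR)
qed

lemma lb_power_ge2:
  assumes g: "lb g (uu + B)" and B: "0 \<le> B" and n: "2 \<le> n"
  shows "lb (g ^ n) (nu n + B + B)"
proof -
  obtain m where m: "n = Suc (Suc m)" using n by (metis Suc_diff_Suc Suc_le_D add_2_eq_Suc le_add_diff_inverse)
  have "lb g uu" using g by (rule lb_mono) (use B in simp)
  then have "lb (g * (g * g ^ m)) ((uu + B) + ((uu + B) + nu m))" by (intro lb_mult g lb_power)
  then show ?thesis by (simp add: m nu_Suc algebra_simps)
qed

lemma lb_comp: "slb g uu \<Longrightarrow> lb f c \<Longrightarrow> lb (tcomp K g f) c"
  unfolding lb_def
proof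
  fix e assume g: "slb g uu" and f: "\<forall>x\<in>sp f. c \<le> x" and e: "e \<in> sp (tcomp K g f)"
  have sm: "der.small K g" using g by (simp add: small_iff slb_def)
  obtain a t n where a: "e = a + t" "a \<in> sp f" "t \<in> nsum (sp g + dshift K) n"
    using der.sp_comp[OF sm, of f] e by (auto simp: set_plus_def)
  have "0 \<le> t" using a sm nsum_nonneg[of "sp g + dshift K" t n] by (auto simp: der.small_def)
  then show "c \<le> e" using a f add_mono[of c a 0 t] by simp
qed

text \<open>Taylor terms from the second on contain at least two factors \<open>g\<close>, whence
  \<open>B\<close> twice, and a second derivative of \<open>f\<close>, whence
  \<open>dl (ht q)\<close> by \<open>lb_tay_ge2\<close>.\<close>

lemma comp_expand:
  assumes g: "slb g uu" "lb g (uu + B)" and B: "0 \<le> B" and f: "lb f (uu + q)" and q: "0 < q"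
  shows "lb (tcomp K g f - f - der K f * g) (uu + q + dl (ht q) + B + B)"
  unfolding lb_def
proof
  fix x assume "x \<in> sp (tcomp K g f - f - der K f * g)"
  then have x: "x \<in> sp (tcomp K g f - (\<Sum>i<2. der.tay K i f * g ^ i))"
    by (simp add: numeral_2_eq_2 algebra_simps)
  have sm: "der.small K g" using g by (simp add: small_iff slb_def)
  show "uu + q + dl (ht q) + B + B \<le> x"
  proof (rule der.sp_comp_remainder[OF sm _ x, where P = "\<lambda>x. uu + q + dl (ht q) + B + B \<le> x"])
    fix i x assume i: "2 \<le> i" and x: "x \<in> sp (der.tay K i f * g ^ i)"
    have "lb (der.tay K i f * g ^ i) ((uu + q - nu i + dl (ht q)) + (nu i + B + B))"
      by (intro lb_mult lb_tay_ge2 lb_power_ge2 f q i g B)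
    then show "uu + q + dl (ht q) + B + B \<le> x" using x by (simp add: lb_def algebra_simps)
  qed
qed

section \<open>Dependence of a composition on its inner series\<close>

lemma (in hahn_derivation) sp_comp_diff_remainder:
  assumes g: "small g" and h: "small h"
    and P: "\<And>i x. N \<le> i \<Longrightarrow> x \<in> sp (tay i f * (g ^ i - h ^ i)) \<Longrightarrow> P x"
    and x: "x \<in> sp (tcomp g f - tcomp h f - (\<Sum>i<N. tay i f * (g ^ i - h ^ i)))"
  shows "P x"
proof (rule ccontr)
  assume nP: "\<not> P x"
  obtain M1 where M1: "\<And>i. M1 \<le> i \<Longrightarrow> coeff (tay i f * g ^ i) x = 0"
    using graded_bound[OF graded_comp[OF g]] by metis
  obtain M2 where M2: "\<And>i. M2 \<le> i \<Longrightarrow> coeff (tay i f * h ^ i) x = 0"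
    using graded_bound[OF graded_comp[OF h]] by metis
  define M where "M = max N (max M1 M2)"
  have "coeff (tcomp g f) x - coeff (tcomp h f) x = (\<Sum>i<M. coeff (tay i f * (g ^ i - h ^ i)) x)"
    unfolding tcomp_def
    by (subst coeff_hsum_finite[OF graded_comp[OF g], of M], simp add: M_def M1,
        subst coeff_hsum_finite[OF graded_comp[OF h], of M], simp add: M_def M2)
      (simp add: sum_subtractf algebra_simps)
  also have "\<dots> = (\<Sum>i<N. coeff (tay i f * (g ^ i - h ^ i)) x)"
  proof (rule sum.mono_neutral_right)
    show "\<forall>i\<in>{..<M} - {..<N}. coeff (tay i f * (g ^ i - h ^ i)) x = 0"
      using P nP by (metis DiffD2 in_sp lessThan_iff not_less)
  qed (auto simp: M_def)
  finally show False using x by (simp add: in_sp)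
qed

lemma slb_power_mult:
  assumes a: "lb a uu" "slb a (uu + \<rho>)" and b: "lb b uu" "slb b (uu + \<rho>)" and mn: "1 \<le> m + n"
  shows "slb (a ^ m * b ^ n) (nu (m + n) + \<rho>)"
proof (cases m)
  case 0
  then obtain n' where "n = Suc n'" using mn by (cases n) auto
  then show ?thesis
    using slb_lb_mult[OF b(2) lb_power[OF b(1), of n']] 0 by (simp add: nu_Suc algebra_simps)
next
  case (Suc m')
  then show ?thesis
    using slb_lb_mult[OF a(2) lb_mult[OF lb_power[OF a(1), of m'] lb_power[OF b(1), of n]]]
    by (simp add: nu_Suc nu_add algebra_simps)
qed

text \<open>Beyond the linear term, \<open>(\<psi> + \<chi>) ^ i - \<psi> ^ i\<close> is
  \<open>\<chi>\<close> times a sum of products with at least one further factor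
  \<open>\<psi>\<close> or \<open>\<psi> + \<chi>\<close>, which contributes the gain
  \<open>\<rho>\<close>. The value of \<open>\<rho>\<close> may be negative.\<close>

lemma comp_increment_inner:
  assumes \<psi>: "slb \<psi> uu" "slb \<psi> (uu + \<rho>)" and \<chi>: "slb \<chi> uu" "slb \<chi> (uu + \<rho>)" "lb \<chi> c"
    and f: "lb f (uu + B)" and B: "0 < B"
  shows "slb (tcomp K (\<psi> + \<chi>) f - tcomp K \<psi> f - der K f * \<chi>) (c + B + dl (ht B) + \<rho>)"
  unfolding slb_def
proof
  fix x assume "x \<in> sp (tcomp K (\<psi> + \<chi>) f - tcomp K \<psi> f - der K f * \<chi>)"
  then have x: "x \<in> sp (tcomp K (\<psi> + \<chi>) f - tcomp K \<psi> f
      - (\<Sum>i<2. der.tay K i f * ((\<psi> + \<chi>) ^ i - \<psi> ^ i)))"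
    by (simp add: numeral_2_eq_2)
  have s: "slb (\<psi> + \<chi>) uu" "slb (\<psi> + \<chi>) (uu + \<rho>)" using \<psi> \<chi> by (auto intro: slb_add)
  have sm: "der.small K (\<psi> + \<chi>)" "der.small K \<psi>" using \<psi> s by (simp_all add: small_iff slb_def)
  show "c + B + dl (ht B) + \<rho> < x"
  proof (rule der.sp_comp_diff_remainder[OF sm _ x, where P = "\<lambda>x. c + B + dl (ht B) + \<rho> < x"])
    fix i x assume i: "2 \<le> i" and x: "x \<in> sp (der.tay K i f * ((\<psi> + \<chi>) ^ i - \<psi> ^ i))"
    obtain n where n: "i = Suc n" "1 \<le> n" using i by (cases i) auto
    have "(\<psi> + \<chi>) ^ i - \<psi> ^ i = \<chi> * (\<Sum>p<Suc n. (\<psi> + \<chi>) ^ p * \<psi> ^ (n - p))"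
      using diff_power_eq_sum[of "\<psi> + \<chi>" n \<psi>] by (simp add: n)
    moreover have "slb (\<Sum>p<Suc n. (\<psi> + \<chi>) ^ p * \<psi> ^ (n - p)) (nu n + \<rho>)"
    proof (rule slb_sum)
      fix p assume "p \<in> {..<Suc n}"
      then show "slb ((\<psi> + \<chi>) ^ p * \<psi> ^ (n - p)) (nu n + \<rho>)"
        using slb_power_mult[of "\<psi> + \<chi>" \<rho> \<psi> p "n - p"] s \<psi> n by (auto simp: slb_imp_lb)
    qed
    ultimately have "slb ((\<psi> + \<chi>) ^ i - \<psi> ^ i) (c + (nu n + \<rho>))" using \<chi>(3) by (simp add: lb_slb_mult)
    then have "slb (der.tay K i f * ((\<psi> + \<chi>) ^ i - \<psi> ^ i)) ((uu + B - nu i + dl (ht B)) + (c + (nu n + \<rho>)))"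
      by (intro lb_slb_mult lb_tay_ge2 f B i)
    then show "c + B + dl (ht B) + \<rho> < x" using x by (simp add: slb_def n nu_Suc algebra_simps)
  qed
qed

text \<open>For monomials at \<open>x\<close> and \<open>y\<close> the Wronskian has the
  coefficients \<open>cp j (x - y)\<close> at \<open>x + y + dl j - uu\<close>. It vanishes for
  \<open>x = y\<close> and otherwise starts with \<open>j = ht (x - y)\<close>; by
  \<open>pair_dl_mono\<close> the pair \<open>(c, b)\<close> wins against all others.\<close>

lemma wronskian:
  assumes f: "lb f c" and g: "lb g b" and cb: "c \<noteq> b" and K: "ht (c - b) \<le> K"
  defines "t \<equiv> c + b + dl (ht (c - b)) - uu"
  shows "lb (der K f * g - f * der K g) t"
    and "coeff (der K f * g - f * der K g) t = cp (ht (c - b)) (c - b) * (coeff f c * coeff g b)"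
proof -
  define h where "h = ht (c - b)"
  define Z where "Z j = kap j f * g - f * kap j g" for j
  have W: "der K f * g - f * der K g = (\<Sum>j\<le>K. mon (dl j - uu) * Z j)"
    by (simp add: der_def Z_def sum_distrib_left sum_distrib_right sum_subtractf algebra_simps)
  have wo: "wo (sp f)" "wo (sp g)" by auto
  have Zsp: "\<exists>x\<in>sp f. \<exists>y\<in>sp g. e = x + y \<and> cp j (x - y) \<noteq> 0" if "e \<in> sp (Z j)" for e j
  proof -
    have eq: "coeff (Z j) e = (\<Sum>x\<in>{x\<in>sp f. e - x \<in> sp g}. cp j (x - (e - x)) * (coeff f x * coeff g (e - x)))"
      unfolding Z_def coeff_simps
      by (subst (1 2) coeff_times_superset[OF wo])
        (auto simp: in_sp_kap coeff_kap sum_subtractf[symmetric] algebra_simps intro!: sum.cong)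
    have "coeff (Z j) e \<noteq> 0" by (rule that[unfolded in_sp])
    then obtain x where x: "x \<in> {x\<in>sp f. e - x \<in> sp g}"
      "cp j (x - (e - x)) * (coeff f x * coeff g (e - x)) \<noteq> 0"
      unfolding eq by (rule sum.not_neutral_contains_not_neutral)
    then have "x \<in> sp f" "e - x \<in> sp g" "cp j (x - (e - x)) \<noteq> 0" by auto
    then show ?thesis by (intro bexI[of _ x] bexI[of _ "e - x"]) auto
  qed
  have key: "c + b + dl h \<le> e + dl j \<and> (c + b + dl h = e + dl j \<longrightarrow> e = c + b)" if e: "e \<in> sp (Z j)" for e j
  proof -
    obtain x y where xy: "x \<in> sp f" "y \<in> sp g" "e = x + y" "cp j (x - y) \<noteq> 0" using Zsp[OF e] by blast
    then have "x \<noteq> y" "c \<le> x" "b \<le> y" using f g by (auto simp: lb_def)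
    note mono = pair_dl_mono[OF this(2,3,1) cb]
    have le: "x + y + dl (ht (x - y)) \<le> e + dl j" using xy by (auto intro!: dl_mono ht_le)
    have "c + b + dl h \<le> e + dl j" using order_trans[OF mono(1) le] by (simp add: h_def)
    moreover have "e = c + b" if "c + b + dl h = e + dl j"
    proof -
      have "c + b + dl (ht (c - b)) = x + y + dl (ht (x - y))"
        using that mono(1) le by (simp add: h_def)
      then show ?thesis using mono(2) xy(3) by simp
    qed
    ultimately show ?thesis by blast
  qed
  show "lb (der K f * g - f * der K g) t"
    unfolding W
  proof (rule lb_sum)
    fix j
    show "lb (mon (dl j - uu) * Z j) t"
      unfolding lb_def
    proof
      fix x assume "x \<in> sp (mon (dl j - uu) * Z j)"
      then obtain d e where "d \<in> sp (mon (dl j - uu))" "e \<in> sp (Z j)" "x = d + e" by (rule sp_multE)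
      then have "e \<in> sp (Z j)" "x = dl j - uu + e" by simp_all
      then show "t \<le> x" using key[of e j] by (simp add: t_def h_def algebra_simps)
    qed
  qed
  have "coeff (mon (dl j - uu) * Z j) t = (if j = h then cp h (c - b) * (coeff f c * coeff g b) else 0)" for j
  proof -
    have 1: "coeff (mon (dl j - uu) * Z j) t = coeff (Z j) (c + b + dl h - dl j)"
      unfolding coeff_times_mon by (rule arg_cong[of _ _ "coeff (Z j)"]) (simp add: t_def h_def)
    show ?thesis
    proof (cases "j = h")
      case True
      have kap: "sp (kap h f) \<subseteq> sp f" "sp (kap h g) \<subseteq> sp g" by (auto simp: in_sp_kap)
      have "coeff (Z h) (c + b) = coeff (kap h f) c * coeff g b - coeff f c * coeff (kap h g) b"
        unfolding Z_def coeff_simps using f g kap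
        by (subst coeff_times_least, force simp: lb_def, force simp: lb_def,
            subst coeff_times_least, force simp: lb_def, force simp: lb_def, simp)
      then show ?thesis using 1 True by (simp add: coeff_kap algebra_simps)
    next
      case False
      have "c + b + dl h - dl j \<notin> sp (Z j)"
      proof
        assume "c + b + dl h - dl j \<in> sp (Z j)"
        from key[OF this] have "dl h = dl j" by (simp add: algebra_simps)
        then show False using False by (simp add: dl_eq_iff)
      qed
      then show ?thesis using 1 False by (simp add: in_sp)
    qed
  qed
  then have "coeff (der K f * g - f * der K g) t = (\<Sum>j\<le>K. if j = h then cp h (c - b) * (coeff f c * coeff g b) else 0)"
    unfolding W coeff_sum by simp
  then show "coeff (der K f * g - f * der K g) t = cp (ht (c - b)) (c - b) * (coeff f c * coeff g b)"
    using K by (simp add: h_def)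
qed

section \<open>Composition of parabolic series\<close>

text \<open>The closure properties of a support set that make the series over it stable under
  products, derivatives and hence composition.\<close>

definition der_closed :: "expo set \<Rightarrow> bool" where
  "der_closed X \<longleftrightarrow> 0 \<in> X \<and> (\<forall>x\<in>X. \<forall>y\<in>X. x + y \<in> X) \<and> (\<forall>x\<in>X. \<forall>j. cp j x \<noteq> 0 \<longrightarrow> x + dl j - uu \<in> X)"

definition Lv :: "nat \<Rightarrow> expo set" where
  "Lv k = {e. \<forall>i>k. cp i e = 0}"

text \<open>Series with support in \<open>Acl k\<close> involve only nonpositive powers of \<open>\<ell>(k+1)\<close>, and they
  are stable under integration: only positive powers would produce \<open>\<ell>(k+2)\<close>.\<close>

definition Acl :: "nat \<Rightarrow> expo set" where
  "Acl k = {e. cp (Suc k) e \<le> 0 \<and> (\<forall>i>Suc k. cp i e = 0)}"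

lemma closed_Lv: "der_closed (Lv k)"
  unfolding der_closed_def
proof (intro conjI ballI allI impI)
  fix x j assume "x \<in> Lv k" "cp j x \<noteq> 0"
  then have "j \<le> k" by (auto simp: Lv_def not_less[symmetric])
  then show "x + dl j - uu \<in> Lv k" using \<open>x \<in> Lv k\<close> by (auto simp: Lv_def cp_dl cp_uu)
qed (auto simp: Lv_def)

text \<open>Only differentiating the power of \<open>\<ell>(k+1)\<close> itself raises its exponent,
  by one, and this happens only if the exponent is nonzero, hence at most \<open>-1\<close> since it
  is an integer.\<close>

lemma closed_Acl: "der_closed (Acl k)"
  unfolding der_closed_def
proof (intro conjI ballI allI impI)
  fix x j assume x: "x \<in> Acl k" "cp j x \<noteq> 0"
  then have "j \<le> Suc k" by (auto simp: Acl_def not_less[symmetric])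
  moreover have "cp (Suc k) x \<le> -1" if "j = Suc k"
    using x that cp_pos_ge_1[of "Suc k" "- x"] by (auto simp: Acl_def)
  ultimately show "x + dl j - uu \<in> Acl k" using x by (auto simp: Acl_def cp_dl cp_uu)
qed (auto simp: Acl_def add_nonpos_nonpos)

lemma Lv_subset_Acl: "Lv k \<subseteq> Acl k" and Acl_subset_Lv: "Acl k \<subseteq> Lv (Suc k)"
  by (auto simp: Lv_def Acl_def)

lemma Lv_mono: "k \<le> l \<Longrightarrow> Lv k \<subseteq> Lv l"
  by (auto simp: Lv_def)

lemma Acl_add_Lv: "y \<in> Lv k \<Longrightarrow> x + y \<in> Acl k \<longleftrightarrow> x \<in> Acl k"
  by (auto simp: Lv_def Acl_def)

lemma Lv_add: "x \<in> Lv k \<Longrightarrow> y \<in> Lv k \<Longrightarrow> x + y \<in> Lv k"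
  and Lv_diff: "x \<in> Lv k \<Longrightarrow> y \<in> Lv k \<Longrightarrow> x - y \<in> Lv k"
  and Lv_minus: "x \<in> Lv k \<Longrightarrow> - x \<in> Lv k"
  and uu_Lv: "uu \<in> Lv k" and dl_Lv: "j \<le> k \<Longrightarrow> dl j \<in> Lv k"
  by (auto simp: Lv_def cp_uu cp_dl)

lemma ht_Lv: "x \<in> Lv k \<Longrightarrow> x \<noteq> 0 \<Longrightarrow> ht x \<le> k"
  using cp_ht[of x] by (auto simp: Lv_def not_less[symmetric])

text \<open>If \<open>ht a > k\<close>, then \<open>dl (ht a)\<close> has entry 1 at
  \<open>k + 1\<close>, so \<open>a\<close> has an entry at most \<open>-1\<close> there. That entry
  is already the first nonzero one, so no deeper logarithm is involved.\<close>

lemma Acl_of_add_dl: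
  assumes "a \<noteq> 0" "a + dl (ht a) \<in> Acl k"
  shows "a \<in> Acl k"
proof (cases "ht a \<le> k")
  case True
  then show ?thesis using assms by (simp add: Acl_add_Lv dl_Lv)
next
  case False
  then have "cp (Suc k) a \<le> -1" using assms(2) by (auto simp: Acl_def cp_dl)
  then have "ht a \<le> Suc k" by (intro ht_le) auto
  then show ?thesis using assms(2) \<open>cp (Suc k) a \<le> -1\<close> by (auto simp: Acl_def cp_dl)
qed

lemma sp_der_closed: "der_closed X \<Longrightarrow> sp f \<subseteq> X \<Longrightarrow> sp (der K f) \<subseteq> X"
proof
  fix x assume "der_closed X" "sp f \<subseteq> X" "x \<in> sp (der K f)"
  then show "x \<in> X" by (elim sp_derE) (auto simp: der_closed_def)
qed

lemma sp_mult_closed: "der_closed X \<Longrightarrow> sp f \<subseteq> X \<Longrightarrow> sp g \<subseteq> X \<Longrightarrow> sp (f * g) \<subseteq> X"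
proof
  fix e assume *: "der_closed X" "sp f \<subseteq> X" "sp g \<subseteq> X" "e \<in> sp (f * g)"
  from *(4) obtain x y where "x \<in> sp f" "y \<in> sp g" "e = x + y" by (rule sp_multE)
  then show "e \<in> X" using * by (auto simp: der_closed_def)
qed

lemma sp_power_closed: "der_closed X \<Longrightarrow> sp g \<subseteq> X \<Longrightarrow> sp (g ^ n) \<subseteq> X"
  by (induction n) (auto simp: der_closed_def intro: sp_mult_closed[unfolded der_closed_def, THEN subsetD])

lemma sp_tay_closed: "der_closed X \<Longrightarrow> sp f \<subseteq> X \<Longrightarrow> sp (der.tay K n f) \<subseteq> X"
proof -
  assume X: "der_closed X" and f: "sp f \<subseteq> X"
  have "sp ((der K ^^ n) f) \<subseteq> X"
    by (induction n) (auto simp: f intro: sp_der_closed[OF X, THEN subsetD])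
  then show ?thesis using sp_scaleR[of "inverse (fact n)" "(der K ^^ n) f"] by (simp add: der.tay_def)
qed

lemma sp_comp_closed:
  assumes "der_closed X" "sp f \<subseteq> X" "sp g \<subseteq> X" "slb g uu"
  shows "sp (tcomp K g f) \<subseteq> X"
proof -
  have "der.small K g" using assms by (simp add: small_iff slb_def)
  then have "sp (tcomp K g f) \<subseteq> (\<Union>i. sp (der.tay K i f * g ^ i))"
    unfolding der.tcomp_def by (rule sp_hsum[OF der.graded_comp])
  also have "\<dots> \<subseteq> X"
    using assms by (intro UN_least sp_mult_closed sp_tay_closed sp_power_closed)
  finally show ?thesis .
qed

text \<open>A parabolic series \<open>z + g\<close> is represented by \<open>g\<close>; then \<open>pcomp\<close> is composition.\<close>

definition Par :: "expo set \<Rightarrow> expo hahn set" where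
  "Par X = {g. sp g \<subseteq> X \<and> slb g uu}"

definition pcomp :: "nat \<Rightarrow> expo hahn \<Rightarrow> expo hahn \<Rightarrow> expo hahn" where
  "pcomp K g h = h + tcomp K h g"

lemma slb_small: "slb g uu \<Longrightarrow> der.small K g"
  by (simp add: small_iff slb_def)

lemma slb_comp:
  assumes g: "slb g uu" and f: "slb f c"
  shows "slb (tcomp K g f) c"
proof (cases "f = 0")
  case True
  then show ?thesis using g by (simp add: slb_small slb_def)
next
  case False
  then obtain m where m: "m \<in> sp f" "\<And>x. x \<in> sp f \<Longrightarrow> m \<le> x" using sp_least by blast
  then have "lb (tcomp K g f) m" by (intro lb_comp g) (simp add: lb_def)
  moreover have "c < m" using f m by (simp add: slb_def)
  ultimately show ?thesis by (rule slb_lb_mono)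
qed

lemma slb_zero [simp]: "slb 0 c"
  by (simp add: slb_def)

lemma slb_pcomp: "slb g uu \<Longrightarrow> slb h uu \<Longrightarrow> slb (pcomp K g h) uu"
  by (simp add: pcomp_def slb_add slb_comp)

lemma pcomp_Par: "der_closed X \<Longrightarrow> g \<in> Par X \<Longrightarrow> h \<in> Par X \<Longrightarrow> pcomp K g h \<in> Par X"
proof -
  assume X: "der_closed X" "g \<in> Par X" "h \<in> Par X"
  then have "sp (tcomp K h g) \<subseteq> X" "sp h \<subseteq> X" by (auto simp: Par_def intro: sp_comp_closed[THEN subsetD])
  then have "sp (pcomp K g h) \<subseteq> X" using sp_add[of h "tcomp K h g"] by (auto simp: pcomp_def)
  then show ?thesis using X by (simp add: Par_def slb_pcomp)
qed

lemma comp_0: "tcomp K 0 f = f"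
proof (rule hahn_eqI)
  fix e
  have "coeff (hsum (\<lambda>i. der.tay K i f * 0 ^ i)) e = (\<Sum>i<1. coeff (der.tay K i f * 0 ^ i) e)"
    by (rule coeff_hsum_finite[OF der.graded_comp]) (auto simp: slb_small power_0_left)
  then show "coeff (tcomp K 0 f) e = coeff f e" by (simp add: der.tcomp_def)
qed

lemma pcomp_0_right [simp]: "pcomp K g 0 = g"
  by (simp add: pcomp_def comp_0)

lemma pcomp_0_left [simp]: "slb g uu \<Longrightarrow> pcomp K 0 g = g"
  by (simp add: pcomp_def slb_small)

lemma pcomp_assoc: "slb b uu \<Longrightarrow> slb c uu \<Longrightarrow> pcomp K (pcomp K a b) c = pcomp K a (pcomp K b c)"
  by (simp add: pcomp_def der.comp_add der.comp_comp slb_small add.assoc)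

lemma tcomp_pcomp: "slb a uu \<Longrightarrow> slb b uu \<Longrightarrow> tcomp K b (tcomp K a f) = tcomp K (pcomp K a b) f"
  by (simp add: pcomp_def der.comp_comp slb_small)

text \<open>Changing \<open>\<psi>\<close> by \<open>\<chi>\<close> changes
  \<open>tcomp K \<psi> g\<close> only by terms beyond the leading exponent of
  \<open>\<chi>\<close>. Successive approximation therefore applies with the identity as
  \<open>\<sigma>\<close> and constant factor 1, and every exponent the error could have is
  attainable.\<close>

lemma pcomp_right_inverse:
  assumes X: "der_closed X" and g: "g \<in> Par X"
  obtains h where "h \<in> Par X" "pcomp K g h = 0"
proof -
  define S where "S = {x\<in>X. uu < x}"
  have S: "sp f \<subseteq> S \<longleftrightarrow> f \<in> Par X" for f by (auto simp: S_def Par_def slb_def)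
  have incr: "coeff (pcomp K g (\<psi> + \<chi>) - pcomp K g \<psi>) s = 1 * coeff \<chi> s
      \<and> (\<forall>x\<in>sp (pcomp K g (\<psi> + \<chi>) - pcomp K g \<psi>). s \<le> x)"
    if \<psi>: "sp \<psi> \<subseteq> S" and \<chi>: "sp \<chi> \<subseteq> S" and s: "\<And>x. x \<in> sp \<chi> \<Longrightarrow> s \<le> x" for \<psi> \<chi> s
  proof -
    have p: "slb \<psi> uu" "slb \<chi> uu" using \<psi> \<chi> S by (auto simp: Par_def)
    have lb: "lb \<chi> s" using s by (simp add: lb_def)
    have R: "slb (tcomp K (\<psi> + \<chi>) g - tcomp K \<psi> g) s"
    proof (cases "g = 0")
      case True
      then show ?thesis using p by (simp add: slb_small slb_add)
    next
      case False
      then obtain m where m: "m \<in> sp g" "\<And>x. x \<in> sp g \<Longrightarrow> m \<le> x" using sp_least by blast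
      define B where "B = m - uu"
      have B: "0 < B" using g m by (simp add: B_def Par_def slb_def)
      have gB: "lb g (uu + B)" using m by (simp add: lb_def B_def)
      have "slb (tcomp K (\<psi> + \<chi>) g - tcomp K \<psi> g - der K g * \<chi>) (s + B + dl (ht B) + 0)"
        by (rule comp_increment_inner) (use p lb gB B in auto)
      moreover have "s + 0 \<le> s + (B + dl (ht B))"
        using B dl_nonneg[of "ht B"] by (intro add_left_mono add_nonneg_nonneg) auto
      ultimately have 1: "slb (tcomp K (\<psi> + \<chi>) g - tcomp K \<psi> g - der K g * \<chi>) s"
        by (intro slb_mono[where b = s]) (auto simp: add.assoc)
      have "lb (der K g * \<chi>) (uu + B - uu + s)" by (intro lb_mult lb_der gB lb)
      then have "slb (der K g * \<chi>) s" by (rule slb_lb_mono) (use B in simp)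
      with 1 have "slb (tcomp K (\<psi> + \<chi>) g - tcomp K \<psi> g - der K g * \<chi> + der K g * \<chi>) s" by (rule slb_add)
      then show ?thesis by simp
    qed
    have eq: "pcomp K g (\<psi> + \<chi>) - pcomp K g \<psi> = \<chi> + (tcomp K (\<psi> + \<chi>) g - tcomp K \<psi> g)"
      by (simp add: pcomp_def)
    have "lb (pcomp K g (\<psi> + \<chi>) - pcomp K g \<psi>) s" unfolding eq by (rule lb_add[OF lb slb_imp_lb[OF R]])
    moreover have "coeff (pcomp K g (\<psi> + \<chi>) - pcomp K g \<psi>) s = coeff \<chi> s"
      unfolding eq using coeff_below[OF R] by simp
    ultimately show ?thesis by (simp add: lb_def)
  qed
  obtain h where h: "sp h \<subseteq> S"
    "\<And>t. t \<in> sp (pcomp K g h) \<Longrightarrow> (\<And>x. x \<in> sp (pcomp K g h) \<Longrightarrow> t \<le> x) \<Longrightarrow> t \<notin> (\<lambda>x. x) ` S"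
  proof (rule hahn_approximation[of S "\<lambda>x. x" "\<lambda>_. 1" "pcomp K g"], goal_cases)
    case (3 \<psi> \<chi> s)
    then show ?case using incr by blast
  next
    case (4 \<psi>)
    then show ?case using that by blast
  qed simp_all
  have hP: "h \<in> Par X" using h S by simp
  have "pcomp K g h = 0"
  proof (rule ccontr)
    assume "pcomp K g h \<noteq> 0"
    then obtain t where t: "t \<in> sp (pcomp K g h)" "\<And>x. x \<in> sp (pcomp K g h) \<Longrightarrow> t \<le> x" using sp_least by blast
    have "sp (pcomp K g h) \<subseteq> S" using pcomp_Par[OF X g hP] S by simp
    then show False using h(2)[OF t] t(1) by auto
  qed
  then show thesis using that hP by blast
qed

text \<open>The right inverse of \<open>h\<close> coincides with \<open>g\<close> by associativity,
  so right inverses are two-sided.\<close>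

lemma pcomp_inverse:
  assumes X: "der_closed X" and g: "g \<in> Par X"
  obtains h where "h \<in> Par X" "pcomp K g h = 0" "pcomp K h g = 0"
proof -
  obtain h where h: "h \<in> Par X" "pcomp K g h = 0" using pcomp_right_inverse[OF X g] by metis
  obtain g' where g': "g' \<in> Par X" "pcomp K h g' = 0" using pcomp_right_inverse[OF X h(1)] by metis
  have s: "slb g uu" "slb h uu" "slb g' uu" using g h g' by (auto simp: Par_def)
  have "g = pcomp K g (pcomp K h g')" using g' by simp
  also have "\<dots> = g'" using pcomp_assoc[of h g' K g] s h by simp
  finally show thesis using that h g' by simp
qed

section \<open>The conjugacy equation\<close>

text \<open>If \<open>ht B < ht q\<close>, the difference keeps the height of \<open>B\<close> and
  \<open>q\<close> is pure gain; otherwise \<open>q\<close> itself outweighs any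
  \<open>dl j\<close>. Used in both orders of \<open>q\<close> and \<open>B\<close> to make the
  nonlinear remainders negligible.\<close>

lemma dl_ht_diff_less:
  assumes "0 < q" "0 < B" "q \<noteq> B"
  shows "dl (ht (q - B)) < q + dl (ht B)"
proof (cases "ht q \<le> ht B")
  case True
  have "dl (ht (q - B)) < q + dl (ht q)" using assms by (intro dl_less)
  also have "\<dots> \<le> q + dl (ht B)" using True by (intro add_left_mono dl_mono)
  finally show ?thesis .
next
  case False
  then have "ht (- B + q) = ht (- B)" using assms by (intro ht_add_less) auto
  then show ?thesis using assms by (simp add: add.commute[of "- B"])
qed

text \<open>The error of \<open>\<psi>\<close> as a solution of \<open>(z + \<psi>) \<circ> (z + g) = (z + g0) \<circ> (z + \<psi>)\<close>.\<close>

definition err :: "nat \<Rightarrow> expo hahn \<Rightarrow> expo hahn \<Rightarrow> expo hahn \<Rightarrow> expo hahn" where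
  "err K g g0 \<psi> = pcomp K \<psi> g - pcomp K g0 \<psi>"

lemma err_increment:
  assumes B: "0 < B" and g0: "lb g0 (uu + B)"
    and diff: "slb (g - g0) (uu + B + dl (ht (q - B)))"
    and \<psi>: "slb \<psi> uu" "slb \<psi> (uu + (dl (ht (q - B)) - dl (ht B)))"
    and q: "0 < q" "q \<noteq> B" and \<chi>: "lb \<chi> (uu + q)" and K: "ht (q - B) \<le> K"
  defines "t \<equiv> uu + q + B + dl (ht (q - B))"
  shows "lb (err K g g0 (\<psi> + \<chi>) - err K g g0 \<psi>) t"
    and "coeff (err K g g0 (\<psi> + \<chi>) - err K g g0 \<psi>) t
      = cp (ht (q - B)) (q - B) * coeff g0 (uu + B) * coeff \<chi> (uu + q)"
proof -
  define \<theta> where "\<theta> = dl (ht (q - B))"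
  \<comment> \<open>With this gain the bound for \<open>R2\<close> from
    \<open>comp_increment_inner\<close> is exactly \<open>t\<close>. It is positive only when
    \<open>q\<close> and \<open>B\<close> share their first nonzero entry, so that
    \<open>ht (q - B)\<close> exceeds \<open>ht B\<close>.\<close>
  define \<rho> where "\<rho> = \<theta> - dl (ht B)"
  have \<theta>0: "0 \<le> \<theta>" by (simp add: \<theta>_def dl_nonneg)
  have "slb (g - g0) (uu + B)" using diff by (rule slb_mono) (use \<theta>0 in \<open>simp add: \<theta>_def\<close>)
  then have "lb (g - g0 + g0) (uu + B)" by (rule lb_add[OF slb_imp_lb g0])
  then have g: "lb g (uu + B)" by simp
  have slb: "slb g uu" "slb \<chi> uu" using g \<chi> B q by (auto intro: slb_lb_mono)
  have \<rho>q: "\<rho> < q" using dl_ht_diff_less[OF q(1) B q(2)] by (simp add: \<rho>_def \<theta>_def algebra_simps)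
  have W: "lb (der K \<chi> * g0 - \<chi> * der K g0) t"
    "coeff (der K \<chi> * g0 - \<chi> * der K g0) t = cp (ht (q - B)) (q - B) * (coeff \<chi> (uu + q) * coeff g0 (uu + B))"
    using wronskian[OF \<chi> g0, of K] q K by (auto simp: t_def algebra_simps)
  define R1 where "R1 = tcomp K g \<chi> - \<chi> - der K \<chi> * g"
  define R2 where "R2 = tcomp K (\<psi> + \<chi>) g0 - tcomp K \<psi> g0 - der K g0 * \<chi>"
  have "lb R1 (uu + q + dl (ht q) + B + B)"
    unfolding R1_def by (rule comp_expand) (use slb g B \<chi> q in auto)
  moreover have "\<theta> < B + dl (ht q)"
    using dl_ht_diff_less[OF B q(1)] q by (simp add: \<theta>_def ht_diff_commute)
  then have "t < uu + q + dl (ht q) + B + B"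
    using add_strict_left_mono[of \<theta> "B + dl (ht q)" "uu + q + B"] by (simp add: t_def \<theta>_def algebra_simps)
  ultimately have R1: "slb R1 t" by (rule slb_lb_mono)
  have "slb \<chi> (uu + \<rho>)" using \<chi> by (rule slb_lb_mono) (use \<rho>q in simp)
  then have "slb R2 (uu + q + B + dl (ht B) + \<rho>)"
    unfolding R2_def using \<psi> slb(2) \<chi> g0 B by (intro comp_increment_inner) (auto simp: \<rho>_def \<theta>_def)
  then have R2: "slb R2 t" by (simp add: \<rho>_def \<theta>_def t_def algebra_simps)
  have "slb (der K \<chi> * (g - g0)) (uu + q - uu + (uu + B + \<theta>))"
    by (intro lb_slb_mult lb_der \<chi>) (use diff in \<open>simp add: \<theta>_def\<close>)
  then have R3: "slb (der K \<chi> * (g - g0)) t" by (simp add: t_def \<theta>_def algebra_simps)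
  have rest: "slb (der K \<chi> * (g - g0) + R1 - R2) t" using R1 R2 R3 by (intro slb_add slb_diff)
  have eq: "err K g g0 (\<psi> + \<chi>) - err K g g0 \<psi>
      = (der K \<chi> * g0 - \<chi> * der K g0) + (der K \<chi> * (g - g0) + R1 - R2)"
    using slb_small[OF slb(1), of K]
    by (simp add: err_def pcomp_def R1_def R2_def der.comp_add algebra_simps)
  show "lb (err K g g0 (\<psi> + \<chi>) - err K g g0 \<psi>) t"
    unfolding eq by (rule lb_add[OF W(1) slb_imp_lb[OF rest]])
  show "coeff (err K g g0 (\<psi> + \<chi>) - err K g g0 \<psi>) t
      = cp (ht (q - B)) (q - B) * coeff g0 (uu + B) * coeff \<chi> (uu + q)"
    unfolding eq coeff_simps(2) W(2) coeff_below[OF rest] by simp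
qed

text \<open>\<open>uu + B + dl (ht B)\<close> is the last exponent kept in the normal form.
  \<open>K\<close> stays free above \<open>k\<close> because conjugating series of every depth have
  to be examined.\<close>

locale conjugacy =
  fixes K k :: nat and g g0 :: "expo hahn" and B :: expo
  assumes B: "0 < B" "B \<in> Lv k" and K: "Suc k \<le> K"
    and g: "g \<in> Par (Lv k)" and g0: "g0 \<in> Par (Lv k)"
    and lb_g0: "lb g0 (uu + B)" and lead: "coeff g0 (uu + B) \<noteq> 0"
    and diff: "slb (g - g0) (uu + B + dl (ht B))"
begin

text \<open>The order of the Wronskian of the monomial at \<open>c\<close> with the leading term of
  \<open>g0\<close>, hence the place where a term at \<open>c\<close> acts on the error.\<close>

definition \<sigma> :: "expo \<Rightarrow> expo" where
  "\<sigma> c = c + B + dl (ht (c - uu - B))"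

definition res :: "expo \<Rightarrow> expo" where
  "res t = t - (uu + B) - dl (ht B)"

text \<open>The excess \<open>res t\<close> over the normal form is not infinitesimal compared with
  \<open>B\<close>. By \<open>dl_less\<close>, such series lie beyond \<open>uu + B + dl j\<close>
  for every \<open>j\<close>.\<close>

definition far :: "expo hahn \<Rightarrow> bool" where
  "far h \<longleftrightarrow> (\<forall>t\<in>sp h. 0 < res t \<and> ht (res t) \<le> ht B)"

lemma Acl_Lv_K: "Acl k \<subseteq> Lv K"
  using Acl_subset_Lv Lv_mono[OF K] by blast

lemma ht_B: "ht B \<le> k"
  using B by (intro ht_Lv) auto

lemma res_in_Acl: "res t \<in> Acl k \<longleftrightarrow> t \<in> Acl k"
proof -
  have "- ((uu + B) + dl (ht B)) \<in> Lv k"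
    using B ht_B by (intro Lv_minus Lv_add uu_Lv dl_Lv)
  from Acl_add_Lv[OF this, of t] show ?thesis by (simp add: res_def algebra_simps)
qed

lemma far_least:
  assumes "lb h t" "0 < res t" "ht (res t) \<le> ht B"
  shows "far h"
  unfolding far_def
proof
  fix x assume "x \<in> sp h"
  then have "t \<le> x" using assms by (simp add: lb_def)
  then have "res t \<le> res x" by (simp add: res_def)
  then show "0 < res x \<and> ht (res x) \<le> ht B"
    using assms ht_antimono[of "res t" "res x"] by auto
qed

lemma far_comp:
  assumes "slb h uu" "far f"
  shows "far (tcomp K h f)"
proof (cases "f = 0")
  case True
  then show ?thesis using assms by (simp add: slb_small far_def)
next
  case False
  then obtain t where t: "t \<in> sp f" "\<And>x. x \<in> sp f \<Longrightarrow> t \<le> x" using sp_least by blast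
  then have "lb (tcomp K h f) t" using assms by (intro lb_comp) (auto simp: lb_def)
  then show ?thesis using assms t by (intro far_least) (auto simp: far_def)
qed

lemma far_add: "far f \<Longrightarrow> far h \<Longrightarrow> far (f + h)"
  using sp_add[of f h] by (auto simp: far_def)

lemma sigma_strict_mono: "c < d \<Longrightarrow> c \<noteq> uu + B \<Longrightarrow> d \<noteq> uu + B \<Longrightarrow> \<sigma> c < \<sigma> d"
proof -
  assume *: "c < d" "c \<noteq> uu + B" "d \<noteq> uu + B"
  then have "c - uu - B + dl (ht (c - uu - B)) < d - uu - B + dl (ht (d - uu - B))"
    by (intro add_dl_strict_mono) (auto simp: algebra_simps)
  from add_strict_left_mono[OF this, of "uu + B + B"] show ?thesis by (simp add: \<sigma>_def algebra_simps)
qed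

lemma sigma_inj: "\<sigma> c = \<sigma> d \<Longrightarrow> c \<noteq> uu + B \<Longrightarrow> d \<noteq> uu + B \<Longrightarrow> c = d"
  using sigma_strict_mono[of c d] sigma_strict_mono[of d c] by (cases c d rule: linorder_cases) auto

lemma res_sigma: "res (\<sigma> c) = c - uu + dl (ht (c - uu - B)) - dl (ht B)"
  by (simp add: \<sigma>_def res_def)

lemma sigma_high: "ht B < ht q \<Longrightarrow> \<sigma> (uu + q) = uu + q + B + dl (ht B)"
  using B ht_add_less[of "- B" q] by (simp add: \<sigma>_def add.commute[of "- B"])

lemma ht_high_neq: "ht B < ht q \<Longrightarrow> uu + q \<noteq> uu + B"
  by auto

text \<open>The boundary \<open>uu + B + dl (ht B)\<close> is the value of \<open>\<sigma>\<close>
  at \<open>uu\<close>, so the claim is strict monotonicity compared with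
  \<open>q = 0\<close>.\<close>

lemma res_sigma_pos: "0 < q \<Longrightarrow> q \<noteq> B \<Longrightarrow> 0 < res (\<sigma> (uu + q))"
proof -
  assume q: "0 < q" "q \<noteq> B"
  show ?thesis
  proof (cases "ht B < ht q")
    case True
    then show ?thesis using q by (simp add: sigma_high res_def)
  next
    case False
    have "dl (ht B) < q + dl (ht (q - B))"
    proof -
      have "- B + dl (ht (- B)) < q - B + dl (ht (q - B))"
        using q B by (intro add_dl_strict_mono) auto
      from add_strict_left_mono[OF this, of B] show ?thesis by (simp add: algebra_simps)
    qed
    then show ?thesis by (simp add: res_sigma)
  qed
qed

text \<open>If the excess \<open>p\<close> were of greater height than \<open>B\<close>, then
  \<open>\<sigma> (uu + p)\<close> would be the same value, by \<open>sigma_high\<close>;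
  injectivity of \<open>\<sigma>\<close> forces \<open>p = q\<close>.\<close>

lemma ht_res_sigma: "0 < q \<Longrightarrow> q \<noteq> B \<Longrightarrow> ht q \<le> ht B \<Longrightarrow> ht (res (\<sigma> (uu + q))) \<le> ht B"
proof (rule ccontr)
  assume q: "0 < q" "q \<noteq> B" "ht q \<le> ht B" "\<not> ht (res (\<sigma> (uu + q))) \<le> ht B"
  define p where "p = res (\<sigma> (uu + q))"
  have p: "ht B < ht p" using q by (simp add: p_def)
  have "\<sigma> (uu + p) = \<sigma> (uu + q)" by (simp add: sigma_high[OF p]) (simp add: p_def res_def)
  from sigma_inj[OF this ht_high_neq[OF p]] q(2) have "p = q" by simp
  then show False using p q(3) by simp
qed

text \<open>With \<open>a = q - B\<close> the equation becomes the asymptotic integration problem of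
  \<open>add_dl_surj\<close>. Comparison of \<open>a\<close> with \<open>- B\<close> yields
  \<open>q > 0\<close>, and \<open>Acl_of_add_dl\<close> keeps the solution inside
  \<open>Acl k\<close>.\<close>

lemma sigma_surj:
  assumes t: "0 < res t" "t \<in> Acl k"
  obtains q where "0 < q" "q \<noteq> B" "uu + q \<in> Acl k" "\<sigma> (uu + q) = t" "ht B < ht q \<Longrightarrow> res t = q"
proof -
  obtain a where a: "a \<noteq> 0" "a + dl (ht a) = t - uu - B - B" using add_dl_surj by blast
  define q where "q = a + B"
  have ne: "q \<noteq> B" using a by (simp add: q_def)
  have sig: "\<sigma> (uu + q) = t" using a by (simp add: \<sigma>_def q_def algebra_simps)
  have "- (uu + B + B) \<in> Lv k" using B by (intro Lv_minus Lv_add uu_Lv)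
  from Acl_add_Lv[OF this, of t] have "t - (uu + B + B) \<in> Acl k"
    using t by (simp only: add_uminus_conv_diff)
  then have "a + dl (ht a) \<in> Acl k" unfolding a(2) by (simp add: diff_diff_eq)
  then have "a \<in> Acl k" using Acl_of_add_dl a by blast
  then have X: "uu + q \<in> Acl k"
    using Acl_add_Lv[OF Lv_add[OF uu_Lv B(2)], of a] by (simp add: q_def algebra_simps)
  have "0 < q"
  proof (rule ccontr)
    assume "\<not> 0 < q"
    then have "a \<le> - B" by (simp add: q_def) (metis add.commute minus_le_iff neg_le_iff_le le_minus_iff not_less add_le_cancel_right add.left_inverse)
    then have "a + dl (ht a) \<le> - B + dl (ht (- B))" using a B by (intro add_dl_mono) auto
    from add_left_mono[OF this, of B] have "B + (a + dl (ht a)) \<le> dl (ht B)" by simp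
    then show False using t a by (simp add: res_def algebra_simps)
  qed
  moreover have "res t = q" if "ht B < ht q" using sigma_high[OF that] sig by (simp add: res_def)
  ultimately show thesis using that ne X sig by blast
qed

section \<open>Cancelling the error in two stages\<close>

lemma err_incr:
  assumes diff: "slb (g' - g0) (uu + B + dl (ht (q - B)))"
    and \<psi>: "slb \<psi> uu" "slb \<psi> (uu + (dl (ht (q - B)) - dl (ht B)))"
    and q: "0 < q" "q \<noteq> B" "uu + q \<in> Lv K" and \<chi>: "lb \<chi> (uu + q)"
  shows "lb (err K g' g0 (\<psi> + \<chi>) - err K g' g0 \<psi>) (\<sigma> (uu + q))"
    and "coeff (err K g' g0 (\<psi> + \<chi>) - err K g' g0 \<psi>) (\<sigma> (uu + q))
      = cp (ht (q - B)) (q - B) * coeff g0 (uu + B) * coeff \<chi> (uu + q)"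
proof -
  have "q \<in> Lv K" using Lv_diff[OF q(3) uu_Lv] by simp
  moreover have "B \<in> Lv K" using B Lv_mono[of k K] K by auto
  ultimately have "q - B \<in> Lv K" by (intro Lv_diff)
  then have "ht (q - B) \<le> K" using q by (intro ht_Lv) auto
  from err_increment[OF B(1) lb_g0 diff \<psi> q(1,2) \<chi> this]
  show "lb (err K g' g0 (\<psi> + \<chi>) - err K g' g0 \<psi>) (\<sigma> (uu + q))"
    and "coeff (err K g' g0 (\<psi> + \<chi>) - err K g' g0 \<psi>) (\<sigma> (uu + q))
      = cp (ht (q - B)) (q - B) * coeff g0 (uu + B) * coeff \<chi> (uu + q)"
    by (simp_all add: \<sigma>_def add.assoc)
qed

lemma err_0: "slb g' uu \<Longrightarrow> err K g' g0 0 = g' - g0"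
  by (simp add: err_def)

lemma err_closed: "g' \<in> Par (Acl k) \<Longrightarrow> \<psi> \<in> Par (Acl k) \<Longrightarrow> sp (err K g' g0 \<psi>) \<subseteq> Acl k"
proof -
  assume *: "g' \<in> Par (Acl k)" "\<psi> \<in> Par (Acl k)"
  have "g0 \<in> Par (Acl k)" using g0 Lv_subset_Acl by (auto simp: Par_def)
  then have "sp (pcomp K \<psi> g') \<subseteq> Acl k" "sp (pcomp K g0 \<psi>) \<subseteq> Acl k"
    using pcomp_Par[OF closed_Acl] * by (auto simp: Par_def)
  then show ?thesis using sp_diff[of "pcomp K \<psi> g'" "pcomp K g0 \<psi>"] by (auto simp: err_def)
qed

lemma stage:
  assumes g': "g' \<in> Par (Acl k)" and S: "S \<subseteq> Acl k"
    and S1: "\<And>c. c \<in> S \<Longrightarrow> uu < c \<and> c \<noteq> uu + B \<and> slb (g' - g0) (uu + B + dl (ht (c - uu - B)))"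
    and S2: "\<And>c d. c \<in> S \<Longrightarrow> d \<in> S \<Longrightarrow> dl (ht (c - uu - B)) < d - uu + dl (ht B)"
  obtains \<psi> where "\<psi> \<in> Par (Acl k)"
    "\<psi> = 0 \<or> (\<exists>c\<in>S. lb (err K g' g0 \<psi> - (g' - g0)) (\<sigma> c))"
    "\<And>t. t \<in> sp (err K g' g0 \<psi>) \<Longrightarrow> (\<And>x. x \<in> sp (err K g' g0 \<psi>) \<Longrightarrow> t \<le> x) \<Longrightarrow> t \<notin> \<sigma> ` S"
proof -
  define M where "M c = cp (ht (c - uu - B)) (c - uu - B) * coeff g0 (uu + B)" for c
  have inc: "lb (err K g' g0 (\<psi> + \<chi>) - err K g' g0 \<psi>) (\<sigma> s) \<and>
      coeff (err K g' g0 (\<psi> + \<chi>) - err K g' g0 \<psi>) (\<sigma> s) = M s * coeff \<chi> s"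
    if \<psi>: "sp \<psi> \<subseteq> S" and s: "s \<in> S" and \<chi>: "lb \<chi> s" for \<psi> \<chi> s
  proof -
    define q where "q = s - uu"
    have seq: "s = uu + q" by (simp add: q_def)
    have slb: "slb \<psi> uu" using \<psi> S1 by (auto simp: slb_def)
    have slb': "slb \<psi> (uu + (dl (ht (q - B)) - dl (ht B)))"
      unfolding slb_def
    proof
      fix x assume "x \<in> sp \<psi>"
      then have "x \<in> S" using \<psi> by blast
      from S2[OF s this] have "dl (ht (q - B)) < x - uu + dl (ht B)" by (simp add: q_def)
      from add_strict_left_mono[OF this, of "uu - dl (ht B)"]
      show "uu + (dl (ht (q - B)) - dl (ht B)) < x" by (simp add: algebra_simps)
    qed
    have q: "0 < q" "q \<noteq> B" "slb (g' - g0) (uu + B + dl (ht (q - B)))"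
      using S1[OF s] by (auto simp: q_def)
    have "uu + q \<in> Lv K" using s S Acl_Lv_K seq by auto
    from err_incr[OF q(3) slb slb' q(1,2) this] \<chi>
    show ?thesis by (auto simp: seq M_def)
  qed
  obtain \<psi> where \<psi>: "sp \<psi> \<subseteq> S"
    "\<And>t. t \<in> sp (err K g' g0 \<psi>) \<Longrightarrow> (\<And>x. x \<in> sp (err K g' g0 \<psi>) \<Longrightarrow> t \<le> x) \<Longrightarrow> t \<notin> \<sigma> ` S"
  proof (rule hahn_approximation[of S \<sigma> M "err K g' g0"], goal_cases)
    case (1 s t)
    then show ?case using S1 by (intro sigma_strict_mono) auto
  next
    case (2 s)
    then have "s - uu - B \<noteq> 0" using S1[of s] by (auto simp: algebra_simps)
    then show ?case using lead cp_ht[of "s - uu - B"] by (auto simp: M_def)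
  next
    case (3 \<psi> \<chi> s)
    then have "sp \<psi> \<subseteq> S" "s \<in> S" "lb \<chi> s" unfolding lb_def by blast+
    from inc[OF this] show ?case unfolding lb_def by blast
  next
    case (4 \<psi>)
    then show ?case using that by blast
  qed
  have P: "\<psi> \<in> Par (Acl k)" using \<psi>(1) S S1 by (auto simp: Par_def slb_def)
  have "\<psi> = 0 \<or> (\<exists>c\<in>S. lb (err K g' g0 \<psi> - (g' - g0)) (\<sigma> c))"
  proof (cases "\<psi> = 0")
    case False
    then obtain c where c: "c \<in> sp \<psi>" "\<And>x. x \<in> sp \<psi> \<Longrightarrow> c \<le> x" using sp_least by blast
    then have "lb (err K g' g0 (0 + \<psi>) - err K g' g0 0) (\<sigma> c)"
      using inc[of 0 c \<psi>] \<psi>(1) by (auto simp: lb_def)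
    then show ?thesis using c \<psi>(1) g' by (auto simp: err_0 Par_def)
  qed simp
  then show thesis using that P \<psi>(2) by blast
qed

text \<open>The first stage removes the terms of infinitesimal relative size; without it the
  linearisation of the conjugacy equation in the second stage would depend on the unknown.\<close>

lemma first_stage:
  obtains \<psi> g1 where "\<psi> \<in> Par (Acl k)" "g1 \<in> Par (Acl k)" "pcomp K \<psi> g = pcomp K g1 \<psi>" "far (g1 - g0)"
proof -
  \<comment> \<open>For these \<open>c\<close> the shift \<open>dl (ht (c - uu - B))\<close> is
    constantly \<open>dl (ht B)\<close>, so the required gain is 0 and the bound \<open>diff\<close>
    suffices.\<close>
  define S where "S = {c\<in>Acl k. uu < c \<and> ht B < ht (c - uu)}"
  have gA: "g \<in> Par (Acl k)" using g Lv_subset_Acl by (auto simp: Par_def)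
  have high: "dl (ht (c - uu - B)) = dl (ht B)" if "c \<in> S" for c
    using that sigma_high[of "c - uu"] by (simp add: S_def \<sigma>_def)
  obtain \<psi> where \<psi>: "\<psi> \<in> Par (Acl k)"
    "\<psi> = 0 \<or> (\<exists>c\<in>S. lb (err K g g0 \<psi> - (g - g0)) (\<sigma> c))"
    "\<And>t. t \<in> sp (err K g g0 \<psi>) \<Longrightarrow> (\<And>x. x \<in> sp (err K g g0 \<psi>) \<Longrightarrow> t \<le> x) \<Longrightarrow> t \<notin> \<sigma> ` S"
  proof (rule stage[OF gA, of S], goal_cases)
    case (2 c)
    then show ?case using high diff ht_high_neq[of "c - uu"] by (auto simp: S_def)
  next
    case (3 c d)
    then show ?case using high[of c] by (auto simp: S_def)
  next
    case (4 \<psi>)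
    then show ?case using that by blast
  qed (auto simp: S_def)
  have slb\<psi>: "slb \<psi> uu" "slb g uu" using \<psi> g by (auto simp: Par_def)
  define E where "E = err K g g0 \<psi>"
  have base: "slb (g - g0) (uu + B + dl (ht B))" by (rule diff)
  have "slb (E - (g - g0)) (uu + B + dl (ht B))"
  proof (cases "\<psi> = 0")
    case True
    then show ?thesis using slb\<psi> by (simp add: E_def err_0)
  next
    case False
    then obtain c where c: "c \<in> S" "lb (E - (g - g0)) (\<sigma> c)" using \<psi>(2) by (auto simp: E_def)
    have "0 < res (\<sigma> c)"
      using res_sigma_pos[of "c - uu"] c(1) ht_high_neq[of "c - uu"] by (auto simp: S_def)
    then have "uu + B + dl (ht B) < \<sigma> c" by (simp add: res_def algebra_simps)
    with c(2) show ?thesis by (rule slb_lb_mono)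
  qed
  then have slbE: "slb E (uu + B + dl (ht B))" using slb_add[OF _ base] by fastforce
  have farE: "far E"
  proof (cases "E = 0")
    case False
    then obtain t where t: "t \<in> sp E" "\<And>x. x \<in> sp E \<Longrightarrow> t \<le> x" using sp_least by blast
    have tA: "t \<in> Acl k" using err_closed[OF gA \<psi>(1)] t by (auto simp: E_def)
    have pos: "0 < res t" using slbE t by (auto simp: slb_def res_def algebra_simps)
    have "ht (res t) \<le> ht B"
    proof (rule ccontr)
      assume high: "\<not> ht (res t) \<le> ht B"
      have "uu + res t \<in> Acl k"
        using tA res_in_Acl[of t] Acl_add_Lv[OF uu_Lv, of "res t"] by (simp add: add.commute)
      then have "uu + res t \<in> S" using pos high by (simp add: S_def)
      moreover have "\<sigma> (uu + res t) = t" using sigma_high[of "res t"] high by (simp add: res_def)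
      moreover have "t \<notin> \<sigma> ` S" using \<psi>(3) t unfolding E_def by blast
      ultimately show False by (metis image_eqI)
    qed
    then show ?thesis using t pos by (intro far_least[of E t]) (auto simp: lb_def)
  qed (simp add: far_def)
  obtain \<psi>' where \<psi>': "\<psi>' \<in> Par (Acl k)" "pcomp K \<psi> \<psi>' = 0" "pcomp K \<psi>' \<psi> = 0"
    using pcomp_inverse[OF closed_Acl \<psi>(1)] by metis
  have slb': "slb \<psi>' uu" using \<psi>' by (simp add: Par_def)
  define g1 where "g1 = pcomp K (pcomp K \<psi> g) \<psi>'"
  have g1: "g1 \<in> Par (Acl k)" unfolding g1_def by (intro pcomp_Par closed_Acl \<psi> \<psi>' gA)
  have conj: "pcomp K \<psi> g = pcomp K g1 \<psi>"
    using pcomp_assoc[of \<psi>' \<psi> K "pcomp K \<psi> g"] slb\<psi> slb' \<psi>' by (simp add: g1_def)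
  \<comment> \<open>The error is the deviation of the new series from \<open>g0\<close>, composed
    with \<open>z + \<psi>\<close>; composing with the inverse carries the bound back to
    \<open>g1 - g0\<close>.\<close>
  have "tcomp K \<psi> (g1 - g0) = E"
    by (simp add: E_def err_def conj) (simp add: pcomp_def der.comp_diff slb_small slb\<psi>)
  then have "g1 - g0 = tcomp K \<psi>' E"
    using tcomp_pcomp[of \<psi> \<psi>' K "g1 - g0"] slb\<psi> slb' \<psi>' by (simp add: comp_0)
  then have "far (g1 - g0)" using far_comp[OF slb' farE] by simp
  then show thesis using that \<psi>(1) g1 conj by blast
qed

lemma far_slb: "far h \<Longrightarrow> slb h (uu + B + dl (ht (q - B)))"
  unfolding slb_def
proof
  fix x assume "far h" "x \<in> sp h"
  then have x: "0 < res x" "ht (res x) \<le> ht B" by (auto simp: far_def)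
  have "dl (ht (q - B)) < res x + dl (ht (res x))" using x by (intro dl_less)
  also have "\<dots> \<le> res x + dl (ht B)" using x by (intro add_left_mono dl_mono)
  finally show "uu + B + dl (ht (q - B)) < x" by (simp add: res_def algebra_simps)
qed

lemma dl_less_low:
  assumes "0 < p" "ht p \<le> ht B"
  shows "dl j < p + dl (ht B)"
proof -
  have "dl j < p + dl (ht p)" using assms by (intro dl_less)
  also have "\<dots> \<le> p + dl (ht B)" using assms by (intro add_left_mono dl_mono)
  finally show ?thesis .
qed

lemma second_stage:
  assumes g1: "g1 \<in> Par (Acl k)" and far: "far (g1 - g0)"
  obtains \<psi> where "\<psi> \<in> Par (Acl k)" "pcomp K \<psi> g1 = pcomp K g0 \<psi>"
proof -
  \<comment> \<open>The complementary exponents. For them \<open>c - uu + dl (ht B)\<close> exceeds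
    every \<open>dl j\<close>, so any gain the remainder may demand is available.\<close>
  define S where "S = {c\<in>Acl k. uu < c \<and> c \<noteq> uu + B \<and> ht (c - uu) \<le> ht B}"
  obtain \<psi> where \<psi>: "\<psi> \<in> Par (Acl k)"
    "\<psi> = 0 \<or> (\<exists>c\<in>S. lb (err K g1 g0 \<psi> - (g1 - g0)) (\<sigma> c))"
    "\<And>t. t \<in> sp (err K g1 g0 \<psi>) \<Longrightarrow> (\<And>x. x \<in> sp (err K g1 g0 \<psi>) \<Longrightarrow> t \<le> x) \<Longrightarrow> t \<notin> \<sigma> ` S"
  proof (rule stage[OF g1, of S], goal_cases)
    case (2 c)
    then show ?case using far_slb[OF far] by (auto simp: S_def)
  next
    case (3 c d)
    then show ?case by (intro dl_less_low) (auto simp: S_def)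
  next
    case (4 \<psi>)
    then show ?case using that by blast
  qed (auto simp: S_def)
  define E where "E = err K g1 g0 \<psi>"
  have "far (E - (g1 - g0))"
  proof (cases "\<psi> = 0")
    case True
    then show ?thesis using g1 by (simp add: E_def err_0 Par_def far_def)
  next
    case False
    then obtain c where c: "c \<in> S" "lb (E - (g1 - g0)) (\<sigma> c)" using \<psi>(2) by (auto simp: E_def)
    have "0 < res (\<sigma> c)" "ht (res (\<sigma> c)) \<le> ht B"
      using res_sigma_pos[of "c - uu"] ht_res_sigma[of "c - uu"] c(1)
      by (auto simp: S_def diff_eq_eq add.commute[of B])
    with c(2) show ?thesis by (rule far_least)
  qed
  from far_add[OF this far] have farE: "far E" by simp
  have "E = 0"
  proof (rule ccontr)
    assume "E \<noteq> 0"
    then obtain t where t: "t \<in> sp E" "\<And>x. x \<in> sp E \<Longrightarrow> t \<le> x" using sp_least by blast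
    have tA: "t \<in> Acl k" using err_closed[OF g1 \<psi>(1)] t by (auto simp: E_def)
    have pos: "0 < res t" "ht (res t) \<le> ht B" using farE t by (auto simp: far_def)
    obtain q where q: "0 < q" "q \<noteq> B" "uu + q \<in> Acl k" "\<sigma> (uu + q) = t" "ht B < ht q \<Longrightarrow> res t = q"
      using sigma_surj[OF pos(1) tA] by metis
    \<comment> \<open>Otherwise \<open>res t = q\<close> would have height above
      \<open>ht B\<close>, although the error is \<open>far\<close>.\<close>
    have "ht q \<le> ht B" using q(5) pos(2) by fastforce
    then have "uu + q \<in> S" using q by (simp add: S_def)
    moreover have "t \<notin> \<sigma> ` S" using \<psi>(3) t unfolding E_def by blast
    ultimately show False using q(4) by (metis image_eqI)
  qed
  then show thesis using that \<psi>(1) by (simp add: E_def err_def)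
qed

section \<open>Existence of a conjugation, and the depth of all of them\<close>

theorem conjugation_exists:
  obtains \<phi> where "\<phi> \<in> Par (Acl k)" "pcomp K \<phi> g = pcomp K g0 \<phi>"
proof -
  obtain \<psi> g1 where 1: "\<psi> \<in> Par (Acl k)" "g1 \<in> Par (Acl k)" "pcomp K \<psi> g = pcomp K g1 \<psi>" "far (g1 - g0)"
    using first_stage by metis
  obtain \<omega> where 2: "\<omega> \<in> Par (Acl k)" "pcomp K \<omega> g1 = pcomp K g0 \<omega>" using second_stage[OF 1(2,4)] by metis
  have s: "slb \<psi> uu" "slb g1 uu" "slb \<omega> uu" "slb g uu" using 1 2 g by (auto simp: Par_def)
  have "pcomp K (pcomp K \<omega> \<psi>) g = pcomp K \<omega> (pcomp K g1 \<psi>)" using s 1 by (simp add: pcomp_assoc)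
  also have "\<dots> = pcomp K (pcomp K \<omega> g1) \<psi>" using s by (simp add: pcomp_assoc)
  also have "\<dots> = pcomp K g0 (pcomp K \<omega> \<psi>)" using s 2 by (simp add: pcomp_assoc)
  finally show thesis using that pcomp_Par[OF closed_Acl 2(1) 1(1)] by blast
qed

theorem conjugation_in_Acl:
  assumes \<phi>: "\<phi> \<in> Par (Lv K)" and conj: "pcomp K \<phi> g = pcomp K g0 \<phi>"
  shows "\<phi> \<in> Par (Acl k)"
proof -
  obtain \<psi> g1 where 1: "\<psi> \<in> Par (Acl k)" "g1 \<in> Par (Acl k)" "pcomp K \<psi> g = pcomp K g1 \<psi>" "far (g1 - g0)"
    using first_stage by metis
  obtain \<psi>' where \<psi>': "\<psi>' \<in> Par (Acl k)" "pcomp K \<psi> \<psi>' = 0" "pcomp K \<psi>' \<psi> = 0"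
    using pcomp_inverse[OF closed_Acl 1(1)] by metis
  have s: "slb \<psi> uu" "slb g1 uu" "slb \<psi>' uu" "slb g uu" "slb \<phi> uu" "slb g0 uu"
    using 1 \<psi>' \<phi> g g0 by (auto simp: Par_def)
  \<comment> \<open>Any conjugation is divided by the first-stage one; the quotient takes
    \<open>g1\<close> to \<open>g0\<close>, and since \<open>g1 - g0\<close> is \<open>far\<close>,
    the linearisation is available for it.\<close>
  define \<omega> where "\<omega> = pcomp K \<phi> \<psi>'"
  have \<omega>\<psi>: "pcomp K \<omega> \<psi> = \<phi>" using s \<psi>' by (simp add: \<omega>_def pcomp_assoc)
  have "\<psi>' \<in> Par (Lv K)" using \<psi>' Acl_Lv_K by (auto simp: Par_def)
  then have \<omega>L: "\<omega> \<in> Par (Lv K)" unfolding \<omega>_def by (intro pcomp_Par closed_Lv \<phi>)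
  then have s\<omega>: "slb \<omega> uu" by (simp add: Par_def)
  have "pcomp K \<psi>' g1 = pcomp K \<psi>' (pcomp K (pcomp K g1 \<psi>) \<psi>')" using s \<psi>' by (simp add: pcomp_assoc)
  also have "\<dots> = pcomp K \<psi>' (pcomp K \<psi> (pcomp K g \<psi>'))" using s by (simp add: 1(3)[symmetric] pcomp_assoc)
  also have "\<dots> = pcomp K (pcomp K \<psi>' \<psi>) (pcomp K g \<psi>')" using s by (simp add: pcomp_assoc slb_pcomp)
  also have "\<dots> = pcomp K g \<psi>'" using s \<psi>' by (simp add: slb_pcomp)
  finally have "pcomp K \<omega> g1 = pcomp K (pcomp K \<phi> g) \<psi>'" using s by (simp add: \<omega>_def pcomp_assoc)
  also have "\<dots> = pcomp K g0 \<omega>" using s by (simp add: conj pcomp_assoc \<omega>_def)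
  finally have err\<omega>: "err K g1 g0 \<omega> = 0" by (simp add: err_def)
  \<comment> \<open>A leading term of greater height would change the error at an exponent with
    excess \<open>q\<close>, from \<open>g1 - g0\<close> to 0. Then \<open>g1 - g0\<close> would
    have a term with that excess, which \<open>far\<close> excludes.\<close>
  have low: "ht (c - uu) \<le> ht B" if c: "c \<in> sp \<omega>" for c
  proof -
    obtain m where m: "m \<in> sp \<omega>" "\<And>x. x \<in> sp \<omega> \<Longrightarrow> m \<le> x"
      using sp_least[of \<omega>] c by (metis empty_iff sp_zero)
    define q where "q = m - uu"
    have meq: "m = uu + q" by (simp add: q_def)
    have q: "0 < q" using m s\<omega> by (simp add: q_def slb_def)
    have "ht q \<le> ht B"
    proof (rule ccontr)
      assume high: "\<not> ht q \<le> ht B"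
      then have qB: "q \<noteq> B" by auto
      have \<theta>: "dl (ht (q - B)) = dl (ht B)" using sigma_high[of q] high by (simp add: \<sigma>_def)
      have inL: "uu + q \<in> Lv K" using m \<omega>L meq by (auto simp: Par_def)
      have lb\<omega>: "lb \<omega> (uu + q)" using m by (simp add: lb_def meq)
      have "coeff (err K g1 g0 (0 + \<omega>) - err K g1 g0 0) (\<sigma> (uu + q))
          = cp (ht (q - B)) (q - B) * coeff g0 (uu + B) * coeff \<omega> (uu + q)"
        by (rule err_incr(2)[OF far_slb[OF 1(4)] _ _ q qB inL lb\<omega>]) (simp_all add: \<theta>)
      moreover have "cp (ht (q - B)) (q - B) \<noteq> 0" using qB by (intro cp_ht) simp
      moreover have "coeff \<omega> (uu + q) \<noteq> 0" using m by (simp add: meq in_sp)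
      ultimately have "coeff (err K g1 g0 (0 + \<omega>) - err K g1 g0 0) (\<sigma> (uu + q)) \<noteq> 0" using lead by simp
      moreover have "err K g1 g0 (0 + \<omega>) - err K g1 g0 0 = - (g1 - g0)"
        using s by (simp add: err\<omega> err_0)
      ultimately have "coeff (- (g1 - g0)) (\<sigma> (uu + q)) \<noteq> 0" by metis
      then have "ht (res (\<sigma> (uu + q))) \<le> ht B" using 1(4) by (auto simp: far_def in_sp)
      then show False using high sigma_high[of q] by (simp add: res_def)
    qed
    moreover have "q \<le> c - uu" using m c by (simp add: q_def)
    ultimately show ?thesis using ht_antimono[OF q, of "c - uu"] by simp
  qed
  have "sp \<omega> \<subseteq> Acl k"
  proof (rule ccontr)
    assume "\<not> sp \<omega> \<subseteq> Acl k"
    \<comment> \<open>The part of \<open>\<omega>\<close> outside \<open>Acl k\<close>. As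
      \<open>\<omega>\<close> leaves no error, the leading term of the increment due to
      \<open>\<chi>\<close> must occur in the error of \<open>\<alpha>\<close>, hence inside
      \<open>Acl k\<close>; the preimage under \<open>\<sigma>\<close> would then lie in
      \<open>Acl k\<close> too.\<close>
    define \<chi> where "\<chi> = hrestrict (- Acl k) \<omega>"
    define \<alpha> where "\<alpha> = hrestrict (Acl k) \<omega>"
    have split: "\<alpha> + \<chi> = \<omega>" by (rule hahn_eqI) (simp add: \<alpha>_def \<chi>_def coeff_restrict)
    have "\<chi> \<noteq> 0" using \<open>\<not> sp \<omega> \<subseteq> Acl k\<close> unfolding sp_eq_empty_iff[symmetric] \<chi>_def by auto
    then obtain m where m: "m \<in> sp \<chi>" "\<And>x. x \<in> sp \<chi> \<Longrightarrow> m \<le> x" using sp_least by blast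
    define q where "q = m - uu"
    have meq: "m = uu + q" by (simp add: q_def)
    have m\<omega>: "m \<in> sp \<omega>" "m \<notin> Acl k" using m by (auto simp: \<chi>_def)
    have q: "0 < q" using m\<omega> s\<omega> by (simp add: q_def slb_def)
    have "uu + B \<in> Acl k" using Lv_add[OF uu_Lv B(2)] Lv_subset_Acl by auto
    then have qB: "q \<noteq> B" using m\<omega> meq by auto
    have inL: "uu + q \<in> Lv K" using m\<omega> \<omega>L meq by (auto simp: Par_def)
    have \<alpha>: "slb \<alpha> uu" using s\<omega> by (simp add: \<alpha>_def slb_def)
    have \<alpha>': "slb \<alpha> (uu + (dl (ht (q - B)) - dl (ht B)))"
      unfolding slb_def
    proof
      fix x assume "x \<in> sp \<alpha>"
      then have x: "x \<in> sp \<omega>" by (simp add: \<alpha>_def)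
      have "dl (ht (q - B)) < x - uu + dl (ht B)"
        using low[OF x] x s\<omega> by (intro dl_less_low) (auto simp: slb_def)
      from add_strict_left_mono[OF this, of "uu - dl (ht B)"]
      show "uu + (dl (ht (q - B)) - dl (ht B)) < x" by (simp add: algebra_simps)
    qed
    have "lb \<chi> (uu + q)" using m by (simp add: lb_def meq)
    then have "coeff (err K g1 g0 (\<alpha> + \<chi>) - err K g1 g0 \<alpha>) (\<sigma> (uu + q))
        = cp (ht (q - B)) (q - B) * coeff g0 (uu + B) * coeff \<chi> (uu + q)"
      by (rule err_incr(2)[OF far_slb[OF 1(4)] \<alpha> \<alpha>' q qB inL])
    moreover have "cp (ht (q - B)) (q - B) \<noteq> 0" using qB by (intro cp_ht) simp
    moreover have "coeff \<chi> (uu + q) \<noteq> 0" using m by (simp add: meq in_sp)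
    ultimately have "coeff (err K g1 g0 (\<alpha> + \<chi>) - err K g1 g0 \<alpha>) (\<sigma> (uu + q)) \<noteq> 0" using lead by simp
    then have "\<sigma> (uu + q) \<in> sp (err K g1 g0 \<alpha>)" by (simp add: split err\<omega> in_sp)
    moreover have "\<alpha> \<in> Par (Acl k)" using \<alpha> by (simp add: \<alpha>_def Par_def)
    ultimately have tA: "\<sigma> (uu + q) \<in> Acl k" using err_closed[OF 1(2)] by blast
    define a where "a = q - B"
    have a0: "a \<noteq> 0" using qB by (simp add: a_def)
    have "- (uu + B + B) \<in> Lv k" using B by (intro Lv_minus Lv_add uu_Lv)
    from Acl_add_Lv[OF this, of "\<sigma> (uu + q)"] have "a + dl (ht a) \<in> Acl k"
      using tA by (simp add: \<sigma>_def a_def algebra_simps)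
    then have "a \<in> Acl k" using Acl_of_add_dl a0 by blast
    then have "uu + q \<in> Acl k"
      using Acl_add_Lv[OF Lv_add[OF uu_Lv B(2)], of a] by (simp add: a_def algebra_simps)
    then show False using m\<omega> meq by simp
  qed
  then have "\<omega> \<in> Par (Acl k)" using s\<omega> by (simp add: Par_def)
  then have "pcomp K \<omega> \<psi> \<in> Par (Acl k)" by (intro pcomp_Par closed_Acl 1(1))
  then show ?thesis by (simp add: \<omega>\<psi>)
qed

end

text \<open>The least exponent \<open>t\<close> of \<open>g0 - h\<close> is at most
  \<open>uu + B + dl (ht B)\<close>. But the conjugacy equation expresses \<open>g0 - h\<close> by
  \<open>der K h * \<psi> - der K \<psi> * g0\<close> and quadratic remainders, all of which lie
  strictly beyond \<open>t\<close>.\<close>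

lemma normal_form_rigid:
  assumes B: "0 < B" and g0: "lb g0 (uu + B)" "\<And>x. x \<in> sp g0 \<Longrightarrow> x \<le> uu + B + dl (ht B)"
    and \<psi>: "slb \<psi> uu" and h: "sp h \<subseteq> sp g0" and conj: "pcomp K \<psi> g0 = pcomp K h \<psi>"
  shows "h = g0"
proof (rule ccontr)
  assume "h \<noteq> g0"
  then have "g0 - h \<noteq> 0" by simp
  then obtain t where t: "t \<in> sp (g0 - h)" "\<And>x. x \<in> sp (g0 - h) \<Longrightarrow> t \<le> x" using sp_least by blast
  have lbd: "lb (g0 - h) t" using t by (simp add: lb_def)
  have "t \<in> sp g0" using t(1) sp_diff[of g0 h] h by blast
  then have tle: "t \<le> uu + B + dl (ht B)" by (rule g0(2))
  have lbh: "lb h (uu + B)" using g0(1) h by (auto simp: lb_def)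
  have slbg0: "slb g0 uu" by (rule slb_lb_mono[OF g0(1)]) (use B in simp)
  have eq: "g0 - h = (tcomp K \<psi> h - h) - (tcomp K g0 \<psi> - \<psi>)"
    using conj by (simp add: pcomp_def algebra_simps)
  have "slb (g0 - h) t"
  proof (cases "\<psi> = 0")
    case True
    then have "g0 - h = 0" using eq slbg0 by (simp add: comp_0 slb_small)
    then show ?thesis by simp
  next
    case False
    then obtain m where m: "m \<in> sp \<psi>" "\<And>x. x \<in> sp \<psi> \<Longrightarrow> m \<le> x" using sp_least by blast
    define q where "q = m - uu"
    have q: "0 < q" using m \<psi> by (simp add: q_def slb_def)
    have lb\<psi>: "lb \<psi> (uu + q)" using m by (simp add: lb_def q_def)
    have dlq: "dl (ht B) < q + dl (ht q)" by (rule dl_less[OF q])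
    define R1 where "R1 = tcomp K \<psi> h - h - der K h * \<psi>"
    define R2 where "R2 = tcomp K g0 \<psi> - \<psi> - der K \<psi> * g0"
    have "lb R1 (uu + B + dl (ht B) + q + q)"
      unfolding R1_def by (rule comp_expand) (use \<psi> lb\<psi> q lbh B in auto)
    then have R1: "slb R1 t"
    proof (rule slb_lb_mono)
      have "t + 0 < (uu + B + dl (ht B)) + (q + q)" using tle q by (intro add_le_less_mono add_pos_pos)
      then show "t < uu + B + dl (ht B) + q + q" by (simp add: add.assoc)
    qed
    have "lb R2 (uu + q + dl (ht q) + B + B)"
      unfolding R2_def by (rule comp_expand) (use slbg0 lb\<psi> q g0 B in auto)
    then have R2: "slb R2 t"
    proof (rule slb_lb_mono)
      have "t < (uu + B) + (q + dl (ht q))"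
        by (rule le_less_trans[OF tle]) (use dlq in simp)
      then have "t + 0 < (uu + B) + (q + dl (ht q)) + B" using B by (intro add_strict_mono)
      then show "t < uu + q + dl (ht q) + B + B" by (simp add: algebra_simps)
    qed
    \<comment> \<open>After division by \<open>z\<close> the two products without a logarithmic
      derivative combine to \<open>- (P * (g0 - h))\<close>, which lies beyond \<open>t\<close>
      because \<open>P\<close> has positive order. The other two contain a derivative of
      \<open>H\<close> or \<open>P\<close> and gain \<open>dl (ht B)\<close> or
      \<open>dl (ht q)\<close>.\<close>
    define P G0 H where "P = mon (- uu) * \<psi>" and "G0 = mon (- uu) * g0" and "H = mon (- uu) * h"
    have zm: "zz * mon (- uu) = 1" by (simp add: zz_def mon_mult one_hahn_def)
    have z: "\<psi> = zz * P" "g0 = zz * G0" "h = zz * H"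
      by (simp_all add: P_def G0_def H_def mult.assoc[symmetric] zm)
    have lbz: "lb zz uu" and lbm: "lb (mon (- uu)) (- uu)" by (simp_all add: lb_def zz_def)
    have lP: "lb P q" using lb_mult[OF lbm lb\<psi>] by (simp add: P_def)
    have lG: "lb G0 B" using lb_mult[OF lbm g0(1)] by (simp add: G0_def)
    have lH: "lb H B" using lb_mult[OF lbm lbh] by (simp add: H_def)
    have main: "der K h * \<psi> - der K \<psi> * g0
        = - (P * (g0 - h)) + zz * (zz * (der K H * P)) - zz * (zz * (der K P * G0))"
      by (simp add: z der.D_mult algebra_simps)
    have "lb (P * (g0 - h)) (q + t)" by (rule lb_mult[OF lP lbd])
    then have M1: "slb (P * (g0 - h)) t" by (rule slb_lb_mono) (use q in simp)
    have "lb (zz * (zz * (der K H * P))) (uu + (uu + (B + dl (ht B) - uu + q)))"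
      by (intro lb_mult lbz lb_der_pos lH B lP)
    then have M2: "slb (zz * (zz * (der K H * P))) t"
    proof (rule slb_lb_mono)
      have "t + 0 < (uu + B + dl (ht B)) + q" using tle q by (intro add_le_less_mono)
      then show "t < uu + (uu + (B + dl (ht B) - uu + q))" by (simp add: algebra_simps)
    qed
    have "lb (zz * (zz * (der K P * G0))) (uu + (uu + (q + dl (ht q) - uu + B)))"
      by (intro lb_mult lbz lb_der_pos lP q lG)
    then have M3: "slb (zz * (zz * (der K P * G0))) t"
    proof (rule slb_lb_mono)
      have "t < (uu + B) + (q + dl (ht q))"
        by (rule le_less_trans[OF tle]) (use dlq in simp)
      then show "t < uu + (uu + (q + dl (ht q) - uu + B))" by (simp add: algebra_simps)
    qed
    have "slb (- (P * (g0 - h))) t" using M1 by (simp add: slb_def)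
    then have "slb (der K h * \<psi> - der K \<psi> * g0) t"
      unfolding main using M2 M3 by (intro slb_add slb_diff)
    from slb_add[OF this slb_diff[OF R1 R2]]
    have "slb (der K h * \<psi> - der K \<psi> * g0 + (R1 - R2)) t" .
    moreover have "g0 - h = der K h * \<psi> - der K \<psi> * g0 + (R1 - R2)"
      unfolding eq R1_def R2_def by simp
    ultimately show ?thesis by simp
  qed
  then show False using t(1) by (auto simp: slb_def)
qed

section \<open>Transfer to the given definitions\<close>

lemma supp_coeff: "supp (coeff F) = sp F"
  by (simp add: supp_def sp_def)

lemma ts_add_coeff: "ts_add (coeff F) (coeff G) = coeff (F + G)"
  by (simp add: ts_add_def fun_eq_iff)

lemma ts_diff_coeff: "ts_diff (coeff F) (coeff G) = coeff (F - G)"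
  by (simp add: ts_diff_def fun_eq_iff)

lemma monom_coeff: "monom e = coeff (mon e)"
  by (simp add: monom_def fun_eq_iff coeff_mon)

lemma ts_id_coeff: "ts_id = coeff zz"
  by (simp add: ts_id_def monom_coeff zz_def uu_def)

lemma ts_mult_coeff: "ts_mult (coeff F) (coeff G) = coeff (F * G)"
  by (simp add: ts_mult_def fun_eq_iff coeff_times)

lemma ts_power_coeff: "ts_power (coeff G) i = coeff (G ^ i)"
  unfolding ts_power_def
proof (induction i)
  case 0
  show ?case by (simp add: monom_coeff one_hahn_def zero_prod_def)
qed (simp add: ts_mult_coeff)

text \<open>The bounds agree because \<open>cp\<close> counts \<open>z\<close> as entry 0: entry
  \<open>Suc i\<close> is the exponent stored at index \<open>i\<close>.\<close>

lemma in_Lv_iff: "e \<in> UNIV \<times> zvec k \<longleftrightarrow> e \<in> Lv k"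
proof
  assume e: "e \<in> UNIV \<times> zvec k"
  show "e \<in> Lv k"
    unfolding Lv_def
  proof (intro CollectI allI impI)
    fix i assume "k < i"
    then obtain j where "i = Suc j" "k \<le> j" by (cases i) auto
    then show "cp i e = 0" using e by (auto simp: zvec_def cp_Suc in_keys_iff)
  qed
next
  assume e: "e \<in> Lv k"
  have "i < k" if "i \<in> Poly_Mapping.keys (snd e)" for i
    using that e by (auto simp: Lv_def cp_Suc in_keys_iff dest!: spec[of _ "Suc i"])
  then show "e \<in> UNIV \<times> zvec k" by (auto simp: zvec_def mem_Times_iff)
qed

lemma monom_deriv_eq:
  assumes "x \<in> Lv K"
  shows "monom_deriv x e = (\<Sum>j\<le>K. cp j x * (if x = e - (dl j - uu) then 1 else 0))"
proof -
  obtain \<alpha> n where x: "x = (\<alpha>, n)" by (cases x)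
  have keys: "Poly_Mapping.keys n \<subseteq> {..<K}" using assms by (auto simp: x in_Lv_iff[symmetric] zvec_def)
  have eq: "(x = e - (dl j - uu)) \<longleftrightarrow> (e = (\<alpha> - 1, n + ones j))" for j
    by (cases e) (auto simp: x dl_def uu_def)
  have "(\<Sum>i\<in>Poly_Mapping.keys n. of_int (Poly_Mapping.lookup n i) * monom (\<alpha> - 1, n + ones (Suc i)) e)
      = (\<Sum>i<K. cp (Suc i) x * (if x = e - (dl (Suc i) - uu) then 1 else 0))"
    unfolding eq using keys
    by (intro sum.mono_neutral_cong_left) (auto simp: in_keys_iff cp_Suc x monom_def)
  moreover have "cp 0 x * (if x = e - (dl 0 - uu) then 1 else 0) = \<alpha> * monom (\<alpha> - 1, n) e"
    unfolding eq by (auto simp: x cp_0 monom_def ones_def)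
  ultimately show ?thesis
    by (simp add: x monom_deriv_def ts_add_def ts_scale_def lessThan_Suc_atMost[symmetric]
        sum.lessThan_Suc_shift del: sum.lessThan_Suc)
qed

lemma ts_deriv_coeff:
  assumes F: "sp F \<subseteq> Lv K"
  shows "ts_deriv (coeff F) = coeff (der K F)"
proof
  fix e
  define X where "X = (\<lambda>j. e - (dl j - uu)) ` {..K}"
  have summand: "coeff F x * monom_deriv x e
      = (\<Sum>j\<le>K. if x = e - (dl j - uu) then cp j x * coeff F x else 0)" for x
  proof (cases "x \<in> sp F")
    case True
    then have "x \<in> Lv K" using F by blast
    then show ?thesis by (simp add: monom_deriv_eq sum_distrib_left if_distrib mult_ac cong: if_cong)
  next
    case False
    then have "(if x = y then cp j x * coeff F x else 0) = 0" for j y by (auto simp: in_sp)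
    then show ?thesis using False by (simp add: in_sp)
  qed
  have "ts_deriv (coeff F) e = (\<Sum>x\<in>X. coeff F x * monom_deriv x e)"
    unfolding ts_deriv_def
  proof (rule Sum_any.expand_superset)
    show "{x. coeff F x * monom_deriv x e \<noteq> 0} \<subseteq> X"
    proof
      fix x assume "x \<in> {x. coeff F x * monom_deriv x e \<noteq> 0}"
      then have "(\<Sum>j\<le>K. if x = e - (dl j - uu) then cp j x * coeff F x else 0) \<noteq> 0" by (simp add: summand)
      then obtain j where "j \<in> {..K}" "(if x = e - (dl j - uu) then cp j x * coeff F x else 0) \<noteq> 0"
        by (rule sum.not_neutral_contains_not_neutral)
      then show "x \<in> X" by (auto simp: X_def split: if_splits)
    qed
  qed (simp add: X_def)
  also have "\<dots> = (\<Sum>j\<le>K. \<Sum>x\<in>X. if x = e - (dl j - uu) then cp j x * coeff F x else 0)"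
    unfolding summand by (rule sum.swap)
  also have "\<dots> = (\<Sum>j\<le>K. cp j (e - (dl j - uu)) * coeff F (e - (dl j - uu)))"
  proof (rule sum.cong)
    fix j assume "j \<in> {..K}"
    then have "e - (dl j - uu) \<in> X" by (auto simp: X_def)
    then show "(\<Sum>x\<in>X. if x = e - (dl j - uu) then cp j x * coeff F x else 0)
        = cp j (e - (dl j - uu)) * coeff F (e - (dl j - uu))"
      by (subst sum.delta) (auto simp: X_def)
  qed simp
  finally show "ts_deriv (coeff F) e = coeff (der K F) e" by (simp add: coeff_der)
qed

lemma ts_deriv_power_coeff:
  assumes F: "sp F \<subseteq> Lv K"
  shows "(ts_deriv ^^ i) (coeff F) = coeff ((der K ^^ i) F) \<and> sp ((der K ^^ i) F) \<subseteq> Lv K"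
proof (induction i)
  case (Suc i)
  then show ?case
    using ts_deriv_coeff[of "(der K ^^ i) F" K] sp_der_closed[OF closed_Lv, of "(der K ^^ i) F" K K] by simp
qed (simp add: F)

text \<open>At a fixed exponent all but finitely many Taylor terms vanish, so \<open>suminf\<close>
  is a finite sum; the summand \<open>f\<close> of \<open>ts_comp\<close> is the Taylor term with
  index 0.\<close>

lemma ts_comp_coeff:
  assumes F: "sp F \<subseteq> Lv K" and G: "slb G uu"
  shows "ts_comp (coeff F) (coeff (zz + G)) = coeff (tcomp K G F)"
proof
  fix e
  define c where "c i = coeff (der.tay K i F * G ^ i) e" for i
  have graded: "graded (sp F) (sp G + dshift K) (\<lambda>i. der.tay K i F * G ^ i)"
    using G by (intro der.graded_comp slb_small)
  then obtain N where N: "\<And>i. N \<le> i \<Longrightarrow> c i = 0" using graded_bound[of _ _ _ e] unfolding c_def by blast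
  have summand: "ts_mult ((ts_deriv ^^ i) (coeff F)) (ts_power (coeff G) i) e / fact i = c i" for i
    using ts_deriv_power_coeff[OF F, of i]
    by (simp add: ts_power_coeff ts_mult_coeff c_def der.tay_def divide_inverse mult.commute)
  have "ts_diff (coeff (zz + G)) ts_id = coeff G" by (simp add: ts_id_coeff ts_diff_coeff)
  then have "ts_comp (coeff F) (coeff (zz + G)) e = coeff F e + suminf (\<lambda>j. c (Suc j))"
    by (simp only: ts_comp_def Let_def summand)
  also have "suminf (\<lambda>j. c (Suc j)) = (\<Sum>j<N. c (Suc j))"
    by (rule suminf_finite) (auto intro: N)
  also have "coeff F e + \<dots> = (\<Sum>i<Suc N. c i)"
    by (simp add: sum.lessThan_Suc_shift c_def del: sum.lessThan_Suc)
  also have "\<dots> = coeff (tcomp K G F) e"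
    unfolding der.tcomp_def c_def
    by (rule coeff_hsum_finite[OF graded, symmetric]) (use N in \<open>auto simp: c_def\<close>)
  finally show "ts_comp (coeff F) (coeff (zz + G)) e = coeff (tcomp K G F) e" .
qed

lemma well_order_on_iff_wo:
  fixes A :: "'a::linorder set"
  shows "well_order_on A {(x, y) \<in> A \<times> A. x \<le> y} \<longleftrightarrow> wo A"
proof
  define r where "r = {(x, y) \<in> A \<times> A. x \<le> y}"
  assume "well_order_on A {(x, y) \<in> A \<times> A. x \<le> y}"
  then have wf: "wf (r - Id)" by (simp add: well_order_on_def r_def)
  show "wo A"
    unfolding wo_def
  proof (intro allI impI)
    fix B assume B: "B \<subseteq> A" "B \<noteq> {}"
    then obtain m where "m \<in> B" "\<And>y. (y, m) \<in> r - Id \<Longrightarrow> y \<notin> B"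
      using wfE_min[OF wf] by (metis ex_in_conv)
    then have "\<forall>x\<in>B. m \<le> x" using B by (fastforce simp: r_def not_le[symmetric])
    then show "\<exists>m\<in>B. \<forall>x\<in>B. m \<le> x" using \<open>m \<in> B\<close> by blast
  qed
next
  define r where "r = {(x, y) \<in> A \<times> A. x \<le> y}"
  assume wo: "wo A"
  have "wf (r - Id)"
  proof (rule wfI_min)
    fix x Q assume x: "x \<in> (Q :: 'a set)"
    show "\<exists>z\<in>Q. \<forall>y. (y, z) \<in> r - Id \<longrightarrow> y \<notin> Q"
    proof (cases "Q \<inter> A = {}")
      case True
      then show ?thesis using x by (auto simp: r_def)
    next
      case False
      then obtain m where m: "m \<in> Q" "\<And>x. x \<in> Q \<Longrightarrow> x \<in> A \<Longrightarrow> m \<le> x"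
        using woD[OF wo, of "Q \<inter> A"] by auto
      have "y \<notin> Q" if "(y, m) \<in> r - Id" for y
        using that m(2)[of y] by (auto simp: r_def)
      then show ?thesis using m(1) by blast
    qed
  qed
  moreover have "linear_order_on A r"
    unfolding linear_order_on_def partial_order_on_def preorder_on_def
    by (auto simp: r_def refl_on_def trans_def antisym_def total_on_def)
  ultimately show "well_order_on A {(x, y) \<in> A \<times> A. x \<le> y}"
    by (simp add: well_order_on_def r_def)
qed

lemma Linf_iff: "f \<in> Linf k \<longleftrightarrow> (\<exists>F. f = coeff F \<and> sp F \<subseteq> Lv k)"
proof
  assume "f \<in> Linf k"
  then have f: "supp f \<subseteq> Lv k" "wo (supp f)"
    unfolding Linf_def well_order_on_iff_wo using in_Lv_iff by blast+
  then have "coeff (Hahn f) = f" by (simp add: coeff_Hahn supp_def)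
  then show "\<exists>F. f = coeff F \<and> sp F \<subseteq> Lv k" using f by (metis supp_coeff)
next
  assume "\<exists>F. f = coeff F \<and> sp F \<subseteq> Lv k"
  then obtain F where "f = coeff F" "sp F \<subseteq> Lv k" by blast
  then show "f \<in> Linf k"
    unfolding Linf_def well_order_on_iff_wo using in_Lv_iff supp_coeff[of F] wo_sp[of F] by auto
qed

lemma ts_ord_coeff:
  assumes "F \<noteq> 0"
  shows "ts_ord (coeff F) \<in> sp F" "\<And>x. x \<in> sp F \<Longrightarrow> ts_ord (coeff F) \<le> x"
proof -
  obtain m where m: "m \<in> sp F" "\<And>x. x \<in> sp F \<Longrightarrow> m \<le> x" using sp_least[OF assms] by blast
  then have "ts_ord (coeff F) = m" unfolding ts_ord_def supp_coeff by (intro Least_equality) auto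
  then show "ts_ord (coeff F) \<in> sp F" "\<And>x. x \<in> sp F \<Longrightarrow> ts_ord (coeff F) \<le> x" using m by auto
qed

lemma L0_iff: "f \<in> L0 k \<longleftrightarrow> (\<exists>g\<in>Par (Lv k). f = coeff (zz + g))"
proof -
  have "(supp (coeff F) \<noteq> {} \<longrightarrow> ts_ord (coeff F) > (1, 0)) \<longleftrightarrow> slb F uu" for F
  proof (cases "F = 0")
    case False
    then show ?thesis
      using ts_ord_coeff[OF False]
      by (auto simp: supp_coeff slb_def uu_def[symmetric] simp del: split_paired_All intro: less_le_trans)
  qed (simp add: supp_coeff)
  note ord = this
  show ?thesis
  proof
    assume "f \<in> L0 k"
    then obtain F where F: "f = ts_add ts_id (coeff F)" "sp F \<subseteq> Lv k"
      "supp (coeff F) \<noteq> {} \<longrightarrow> ts_ord (coeff F) > (1, 0)"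
      unfolding L0_def Linf_iff by blast
    then have "f = coeff (zz + F)" "slb F uu" using ord by (simp_all add: ts_id_coeff ts_add_coeff)
    then show "\<exists>g\<in>Par (Lv k). f = coeff (zz + g)" using F(2) by (auto simp: Par_def)
  next
    assume "\<exists>g\<in>Par (Lv k). f = coeff (zz + g)"
    then obtain F where F: "sp F \<subseteq> Lv k" "slb F uu" "f = coeff (zz + F)" by (auto simp: Par_def)
    then show "f \<in> L0 k"
      unfolding L0_def using ord[of F]
      by (intro CollectI exI[of _ "coeff F"]) (auto simp: ts_id_coeff ts_add_coeff Linf_iff)
  qed
qed

lemma Par_mono: "X \<subseteq> Y \<Longrightarrow> Par X \<subseteq> Par Y"
  by (auto simp: Par_def)

lemma Par_Lv_mono: "j \<le> k \<Longrightarrow> g \<in> Par (Lv j) \<Longrightarrow> g \<in> Par (Lv k)"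
  using Par_mono[OF Lv_mono] by blast

lemma zero_Par: "0 \<in> Par X"
  by (simp add: Par_def)

lemma frakL0_iff: "f \<in> frakL0 \<longleftrightarrow> (\<exists>k. \<exists>g\<in>Par (Lv k). f = coeff (zz + g))"
  by (simp add: frakL0_def L0_iff)

lemma ts_comp_Par:
  assumes "a \<in> Par (Lv K)" "b \<in> Par (Lv K)"
  shows "ts_comp (coeff (zz + a)) (coeff (zz + b)) = coeff (zz + pcomp K a b)"
proof -
  have "sp (zz + a) \<subseteq> Lv K" using assms uu_Lv sp_add[of zz a] by (auto simp: Par_def zz_def)
  then show ?thesis
    using assms by (simp add: ts_comp_coeff Par_def comp_zz_plus slb_small pcomp_def)
qed

section \<open>The composition group and its conjugation\<close>

lemma group_grpL0: "group grpL0"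
proof (rule groupI)
  show "\<one>\<^bsub>grpL0\<^esub> \<in> carrier grpL0"
    unfolding grpL0_def by (simp add: frakL0_iff ts_id_coeff) (metis add.right_neutral zero_Par)
next
  fix x y assume "x \<in> carrier grpL0" "y \<in> carrier grpL0"
  then obtain i j a b where "a \<in> Par (Lv i)" "b \<in> Par (Lv j)" and xy: "x = coeff (zz + a)" "y = coeff (zz + b)"
    by (auto simp: grpL0_def frakL0_iff)
  then have ab: "a \<in> Par (Lv (max i j))" "b \<in> Par (Lv (max i j))"
    by (auto intro: Par_Lv_mono[rotated])
  show "x \<otimes>\<^bsub>grpL0\<^esub> y \<in> carrier grpL0"
    using ts_comp_Par[OF ab] pcomp_Par[OF closed_Lv ab] xy by (auto simp: grpL0_def frakL0_iff)
next
  fix x y z assume "x \<in> carrier grpL0" "y \<in> carrier grpL0" "z \<in> carrier grpL0"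
  then obtain i j l a b c where *: "a \<in> Par (Lv i)" "b \<in> Par (Lv j)" "c \<in> Par (Lv l)"
    and xyz: "x = coeff (zz + a)" "y = coeff (zz + b)" "z = coeff (zz + c)"
    by (auto simp: grpL0_def frakL0_iff)
  define K where "K = max i (max j l)"
  have abc: "a \<in> Par (Lv K)" "b \<in> Par (Lv K)" "c \<in> Par (Lv K)"
    using * by (auto simp: K_def intro: Par_Lv_mono[rotated])
  have ops: "pcomp K a b \<in> Par (Lv K)" "pcomp K b c \<in> Par (Lv K)" using abc by (auto intro: pcomp_Par closed_Lv)
  show "x \<otimes>\<^bsub>grpL0\<^esub> y \<otimes>\<^bsub>grpL0\<^esub> z = x \<otimes>\<^bsub>grpL0\<^esub> (y \<otimes>\<^bsub>grpL0\<^esub> z)"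
    using abc ops pcomp_assoc[of b c K a] by (simp add: grpL0_def xyz ts_comp_Par) (simp add: Par_def)
next
  fix x assume "x \<in> carrier grpL0"
  then obtain k g where g: "g \<in> Par (Lv k)" and x: "x = coeff (zz + g)" by (auto simp: grpL0_def frakL0_iff)
  note 0 = zero_Par[of "Lv k"]
  show "\<one>\<^bsub>grpL0\<^esub> \<otimes>\<^bsub>grpL0\<^esub> x = x"
    using ts_comp_Par[OF 0 g] g by (simp add: grpL0_def ts_id_coeff x Par_def)
  obtain h where h: "h \<in> Par (Lv k)" "pcomp k h g = 0" using pcomp_inverse[OF closed_Lv g, of k] by metis
  then show "\<exists>y\<in>carrier grpL0. y \<otimes>\<^bsub>grpL0\<^esub> x = \<one>\<^bsub>grpL0\<^esub>"
    using ts_comp_Par[OF h(1) g] frakL0_iff[of "coeff (zz + h)"]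
    by (auto simp: grpL0_def ts_id_coeff x intro!: bexI[of _ "coeff (zz + h)"])
qed

lemma ts_conj_eq_iff:
  assumes "\<phi> \<in> frakL0" "f \<in> frakL0" "h \<in> frakL0"
  shows "ts_conj \<phi> f = h \<longleftrightarrow> ts_comp \<phi> f = ts_comp h \<phi>"
proof -
  interpret group grpL0 by (rule group_grpL0)
  have carr: "\<phi> \<in> carrier grpL0" "f \<in> carrier grpL0" "h \<in> carrier grpL0" using assms by (auto simp: grpL0_def)
  then have "ts_conj \<phi> f = h \<longleftrightarrow> \<phi> \<otimes>\<^bsub>grpL0\<^esub> f = h \<otimes>\<^bsub>grpL0\<^esub> \<phi>"
    unfolding ts_conj_def by (metis inv_closed inv_solve_right m_closed)
  then show ?thesis by (simp add: grpL0_def)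
qed

lemma ts_conj_closed: "\<phi> \<in> frakL0 \<Longrightarrow> f \<in> frakL0 \<Longrightarrow> ts_conj \<phi> f \<in> frakL0"
proof -
  interpret group grpL0 by (rule group_grpL0)
  assume "\<phi> \<in> frakL0" "f \<in> frakL0"
  then have "ts_conj \<phi> f \<in> carrier grpL0" unfolding ts_conj_def by (intro m_closed inv_closed) (simp_all add: grpL0_def)
  then show ?thesis by (simp add: grpL0_def)
qed

lemma ts_conj_Par_iff:
  assumes "p \<in> Par (Lv K)" "a \<in> Par (Lv K)" "c \<in> Par (Lv K)"
  shows "ts_conj (coeff (zz + p)) (coeff (zz + a)) = coeff (zz + c) \<longleftrightarrow> pcomp K p a = pcomp K c p"
proof -
  have "coeff (zz + x) \<in> frakL0" if "x \<in> Par (Lv K)" for x using that by (auto simp: frakL0_iff)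
  then show ?thesis using assms by (simp add: ts_conj_eq_iff ts_comp_Par coeff_inject)
qed

theorem corollary2p4:
  fixes f L f\<^sub>0 :: series
    and k v :: nat
    and \<beta> :: real
    and n n' :: "nat \<Rightarrow>\<^sub>0 int"
    and a :: "(nat \<Rightarrow>\<^sub>0 int) \<Rightarrow> real"
  assumes "f \<in> frakL0" and "f \<noteq> ts_id"
    and "k = (LEAST k. f \<in> L0 k)"
    and "(\<beta>, n) = ts_ord (ts_diff f ts_id)"
    and "\<And>m. m \<in> zvec k \<Longrightarrow> m \<ge> n \<Longrightarrow> a m = f (\<beta>, m)"
    and "\<beta> > 1 \<Longrightarrow> L = ts_scale (a n) (monom (0, n))"
    and "\<beta> = 1 \<Longrightarrow> v = Suc (LEAST i. Poly_Mapping.lookup n i \<noteq> 0)"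
    and "\<beta> = 1 \<Longrightarrow> n' = n + ones v"
    and "\<beta> = 1 \<Longrightarrow>
           L = (\<lambda>(\<alpha>, m). if \<alpha> = 0 \<and> m \<in> zvec k \<and> n \<le> m \<and> m \<le> n' then a m else 0)"
    and "f\<^sub>0 = ts_add ts_id (ts_mult (monom (\<beta>, 0)) L)"
  shows "(\<exists>\<phi>\<in>frakL0. ts_conj \<phi> f = f\<^sub>0)
       \<and> (\<forall>\<phi>\<in>frakL0. ts_conj \<phi> f = f\<^sub>0 \<longrightarrow> \<phi> \<in> L0 (k + 1))
       \<and> (\<forall>\<phi>\<in>frakL0. \<forall>h. h = ts_conj \<phi> f\<^sub>0 \<and> supp h \<subseteq> supp f\<^sub>0 \<longrightarrow> h = f\<^sub>0)"
proof -
  have "f \<in> L0 k" unfolding assms(3) using assms(1) by (auto simp: frakL0_def intro: LeastI)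
  then obtain g where g: "g \<in> Par (Lv k)" and f: "f = coeff (zz + g)" by (auto simp: L0_iff)
  have g0: "g \<noteq> 0" using assms(2) by (auto simp: f ts_id_coeff)
  define b where "b = ts_ord (coeff g)"
  have b: "b \<in> sp g" "\<And>x. x \<in> sp g \<Longrightarrow> b \<le> x" using ts_ord_coeff[OF g0] by (auto simp: b_def)
  have b_eq: "b = (\<beta>, n)" using assms(4) by (simp add: b_def f ts_id_coeff ts_diff_coeff)
  define B where "B = b - uu"
  have uB: "uu + B = b" by (simp add: B_def)
  have B: "0 < B" using g b by (simp add: B_def Par_def slb_def)
  have BL: "B \<in> Lv k" using g b unfolding B_def by (intro Lv_diff uu_Lv) (auto simp: Par_def)
  \<comment> \<open>One cut serves both cases: for \<open>\<beta> > 1\<close> the height of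
    \<open>B\<close> is 0 and only the leading term remains, for \<open>\<beta> = 1\<close> the
    bound is \<open>(1, n')\<close>.\<close>
  define g0 where "g0 = hrestrict {..uu + B + dl (ht B)} g"
  have b_le: "b \<le> uu + B + dl (ht B)" using dl_nonneg[of "ht B"] by (simp add: uB)
  have fg: "f x = coeff g x" if "uu < x" for x using that by (simp add: f zz_def coeff_mon)
  have nz: "n \<in> zvec k" using b g b_eq in_Lv_iff[of b k] by (auto simp: Par_def)
  have shift: "ts_mult (monom (\<beta>, 0)) (coeff M) x = coeff M (x - (\<beta>, 0))" for M x
    by (simp add: monom_coeff ts_mult_coeff coeff_times_mon)
  have "\<beta> \<ge> 1" using B b_eq by (auto simp: B_def uu_def less_prod_def' zero_prod_def)
  have "ts_mult (monom (\<beta>, 0)) L = coeff g0"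
  proof (cases "\<beta> = 1")
    case False
    then have \<beta>: "\<beta> > 1" using \<open>\<beta> \<ge> 1\<close> by simp
    then have "cp 0 B \<noteq> 0" by (simp add: B_def b_eq uu_def cp_0)
    then have "ht B = 0" by (intro ht_eqI) auto
    then have dlB: "dl (ht B) = 0" by simp
    then have g0_eq: "coeff g0 x = (if x = b then coeff g b else 0)" for x
    proof (cases "x \<in> sp g")
      case True
      then show ?thesis using b(2)[OF True] by (auto simp: g0_def coeff_restrict uB dlB)
    next
      case False
      then show ?thesis using b(1) by (auto simp: g0_def coeff_restrict uB dlB in_sp)
    qed
    have "a n = coeff g b" using assms(5)[OF nz] fg[of b] B by (simp add: b_eq B_def)
    then have L: "L = coeff (coeff g b *\<^sub>R mon (0, n))"
      using assms(6)[OF \<beta>] by (simp add: ts_scale_def monom_coeff fun_eq_iff)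
    show ?thesis
      unfolding L by (rule ext) (auto simp: shift g0_eq coeff_mon b_eq diff_eq_eq)
  next
    case True
    have nB: "B = (0, n)" by (simp add: B_def b_eq uu_def True)
    \<comment> \<open>Both counts start at 1 for \<open>\<ell>(1)\<close>: \<open>ht\<close> because
      entry 0 belongs to \<open>z\<close>, \<open>v\<close> because of its
      \<open>Suc\<close>.\<close>
    have htB: "ht B = v"
    proof -
      have "n \<noteq> 0" using B nB by (auto simp: zero_prod_def)
      then obtain i where i: "Poly_Mapping.lookup n i \<noteq> 0" using poly_mapping_eqI[of n 0] by auto
      define l where "l = (LEAST i. Poly_Mapping.lookup n i \<noteq> 0)"
      have l: "Poly_Mapping.lookup n l \<noteq> 0" unfolding l_def using i by (rule LeastI)
      have below: "Poly_Mapping.lookup n i = 0" if "i < l" for i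
        using not_less_Least[of i "\<lambda>i. Poly_Mapping.lookup n i \<noteq> 0"] that by (simp add: l_def)
      have "ht B = Suc l"
      proof (rule ht_eqI)
        show "cp (Suc l) B \<noteq> 0" using l by (simp add: nB cp_Suc)
        show "cp i B = 0" if "i < Suc l" for i
          using that below by (cases i) (simp_all add: nB cp_0 cp_Suc)
      qed
      then show ?thesis by (simp add: assms(7)[OF True] l_def)
    qed
    have top: "uu + B + dl (ht B) = (1, n')"
      unfolding htB by (simp add: nB uu_def dl_def assms(8)[OF True])
    define M where "M = mon (-1, 0) * g0"
    have "L = coeff M"
    proof
      fix x :: expo
      obtain \<alpha> m where x: "x = (\<alpha>, m)" by (cases x)
      have M: "coeff M x = (if (\<alpha> + 1, m) \<le> (1, n') then coeff g (\<alpha> + 1, m) else 0)"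
        by (simp add: M_def coeff_times_mon g0_def coeff_restrict top x)
      show "L x = coeff M x"
      proof (cases "\<alpha> = 0 \<and> m \<in> zvec k \<and> n \<le> m \<and> m \<le> n'")
        case True
        then have "uu < (1, m)" using B nB \<open>\<beta> = 1\<close> by (auto simp: uu_def less_prod_def' zero_prod_def)
        then have "a m = coeff g (1, m)" using assms(5)[of m] True \<open>\<beta> = 1\<close> fg[of "(1, m)"] by simp
        then show ?thesis unfolding M using True assms(9)[OF \<open>\<beta> = 1\<close>] by (simp add: x)
      next
        case False
        have "coeff g (\<alpha> + 1, m) = 0" if "(\<alpha> + 1, m) \<le> (1, n')"
        proof (rule ccontr)
          assume "coeff g (\<alpha> + 1, m) \<noteq> 0"
          then have sp: "(\<alpha> + 1, m) \<in> sp g" by (simp add: in_sp)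
          have "(1, n) \<le> (\<alpha> + 1, m)" using b(2)[OF sp] by (simp only: b_eq \<open>\<beta> = 1\<close>)
          then have "\<alpha> = 0" "n \<le> m" "m \<le> n'" using that by (auto simp: less_eq_prod_def)
          moreover have "m \<in> zvec k" using sp g in_Lv_iff[of "(\<alpha> + 1, m)" k] by (auto simp: Par_def)
          ultimately show False using False by simp
        qed
        then show ?thesis unfolding M using False assms(9)[OF \<open>\<beta> = 1\<close>] by (auto simp: x)
      qed
    qed
    show ?thesis
    proof
      fix x
      have "ts_mult (monom (\<beta>, 0)) L x = coeff M (x - (\<beta>, 0))" unfolding \<open>L = coeff M\<close> by (rule shift)
      also have "\<dots> = coeff g0 x" by (cases x) (simp add: M_def coeff_times_mon True)
      finally show "ts_mult (monom (\<beta>, 0)) L x = coeff g0 x" .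
    qed
  qed
  then have f0: "f\<^sub>0 = coeff (zz + g0)" using assms(10) by (simp add: ts_id_coeff ts_add_coeff)
  have g0P: "g0 \<in> Par (Lv k)" using g by (auto simp: g0_def Par_def slb_def)
  have lbg0: "lb g0 (uu + B)" using b by (simp add: lb_def g0_def uB)
  have lead: "coeff g0 (uu + B) \<noteq> 0" using b b_le by (simp add: g0_def uB coeff_restrict in_sp)
  have diff: "slb (g - g0) (uu + B + dl (ht B))"
    by (auto simp: slb_def g0_def in_sp coeff_restrict split: if_splits)
  have conj: "conjugacy K k g g0 B" if "Suc k \<le> K" for K
    by unfold_locales (use B BL that g g0P lbg0 lead diff in auto)
  show ?thesis
  proof (intro conjI ballI allI impI)
    interpret conjugacy "Suc k" k g g0 B by (rule conj) simp
    obtain \<phi> where \<phi>: "\<phi> \<in> Par (Acl k)" "pcomp (Suc k) \<phi> g = pcomp (Suc k) g0 \<phi>"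
      using conjugation_exists by metis
    have "\<phi> \<in> Par (Lv (Suc k))" using \<phi>(1) Par_mono[OF Acl_subset_Lv] by blast
    moreover have "g \<in> Par (Lv (Suc k))" "g0 \<in> Par (Lv (Suc k))" using g g0P by (auto intro: Par_Lv_mono[rotated])
    ultimately have "ts_conj (coeff (zz + \<phi>)) f = f\<^sub>0" using \<phi>(2) by (simp add: f f0 ts_conj_Par_iff)
    moreover have "coeff (zz + \<phi>) \<in> frakL0" using \<open>\<phi> \<in> Par (Lv (Suc k))\<close> by (auto simp: frakL0_iff)
    ultimately show "\<exists>\<phi>\<in>frakL0. ts_conj \<phi> f = f\<^sub>0" by blast
  next
    fix \<phi> assume \<phi>: "\<phi> \<in> frakL0" "ts_conj \<phi> f = f\<^sub>0"
    then obtain j p where p: "p \<in> Par (Lv j)" "\<phi> = coeff (zz + p)" by (auto simp: frakL0_iff)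
    \<comment> \<open>A depth that contains \<open>\<phi>\<close> and leaves room for
      \<open>\<ell>(k+1)\<close>.\<close>
    define K where "K = max j (Suc k)"
    interpret conjugacy K k g g0 B by (rule conj) (simp add: K_def)
    have inK: "p \<in> Par (Lv K)" "g \<in> Par (Lv K)" "g0 \<in> Par (Lv K)"
      using p g g0P by (auto simp: K_def intro: Par_Lv_mono[rotated])
    then have "pcomp K p g = pcomp K g0 p" using \<phi>(2) by (simp add: p f f0 ts_conj_Par_iff)
    then have "p \<in> Par (Acl k)" by (rule conjugation_in_Acl[OF inK(1)])
    then have "p \<in> Par (Lv (k + 1))" using Par_mono[OF Acl_subset_Lv, of k] by auto
    then show "\<phi> \<in> L0 (k + 1)" using p by (auto simp: L0_iff)
  next
    fix \<phi> h assume \<phi>: "\<phi> \<in> frakL0" and h: "h = ts_conj \<phi> f\<^sub>0 \<and> supp h \<subseteq> supp f\<^sub>0"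
    have "f\<^sub>0 \<in> frakL0" using g0P by (auto simp: f0 frakL0_iff)
    then have "h \<in> frakL0" using ts_conj_closed \<phi> h by blast
    then obtain i c where c: "c \<in> Par (Lv i)" "h = coeff (zz + c)" by (auto simp: frakL0_iff)
    from \<phi> obtain j p where p: "p \<in> Par (Lv j)" "\<phi> = coeff (zz + p)" by (auto simp: frakL0_iff)
    define K where "K = max i (max j k)"
    have inK: "p \<in> Par (Lv K)" "c \<in> Par (Lv K)" "g0 \<in> Par (Lv K)"
      using p c g0P by (auto simp: K_def intro: Par_Lv_mono[rotated])
    have "ts_conj (coeff (zz + p)) (coeff (zz + g0)) = coeff (zz + c)" using h by (simp add: p c f0)
    then have pcomp: "pcomp K p g0 = pcomp K c p" using inK by (simp add: ts_conj_Par_iff)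
    \<comment> \<open>The inclusion is known for the supports of \<open>h\<close> and
      \<open>f\<^sub>0\<close>, which include the exponent of \<open>z\<close>; that exponent lies
      below all of \<open>c\<close>.\<close>
    have "sp c \<subseteq> sp g0"
    proof
      fix x assume x: "x \<in> sp c"
      then have "uu < x" using c by (simp add: Par_def slb_def)
      then have z: "coeff zz x = 0" by (simp add: zz_def coeff_mon)
      then have "x \<in> supp h" using x by (simp add: c(2) supp_coeff in_sp)
      then have "x \<in> sp (zz + g0)" using h by (auto simp: f0 supp_coeff)
      then show "x \<in> sp g0" using z by (simp add: in_sp)
    qed
    then have "c = g0"
      by (intro normal_form_rigid[OF B lbg0 _ _ _ pcomp]) (use p in \<open>auto simp: g0_def Par_def\<close>)
    then show "h = f\<^sub>0" by (simp add: c(2) f0)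
  qed
qed

end
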